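(* Let $[a,b]$ be a compact interval, $\varepsilon_0>0$, and for every $\varepsilon\in[0,\varepsilon_0]$ let $q_\varepsilon\in L_2([a,b],\mathbb{C})$ and $\alpha(\varepsilon),\beta(\varepsilon)\in\mathbb{C}^{2\times 2}$. Let $L_\varepsilon$ be the operator in $L_2=L_2([a,b],\mathbb{C})$ generated by the formal expression $-y''+q_\varepsilon' y$ (understood via quasi-derivatives) and the boundary conditions $\alpha(\varepsilon)\mathcal{Y}_a(\varepsilon)+\beta(\varepsilon)\mathcal{Y}_b(\varepsilon)=0$, as defined in the context. Put $$A(\cdot;\varepsilon):=\begin{pmatrix} q_\varepsilon & 1\\ -q_\varepsilon^2 & -q_\varepsilon\end{pmatrix},\qquad R(\cdot;\varepsilon):=A(\cdot;\varepsilon)-A(\cdot;0).$$ Consider the following conditions as $\varepsilon\to+0$: 2) $\|(q_\varepsilon-q_0)^\vee\|_C\to 0$; 3) $\|(q_\varepsilon^2-q_0^2)^\vee\|_C\to 0$; 4) $\alpha(\varepsilon)\to\alpha(0)$ and $\beta(\varepsilon)\to\beta(0)$; (I) $\|R(\cdot;\varepsilon)R^\vee(\cdot;\varepsilon)\|_1\to 0$; (II) $\|R^\vee(\cdot;\varepsilon)R(\cdot;\varepsilon)\|_1\to 0$; (III) $\|R(\cdot;\varepsilon)R^\vee(\cdot;\varepsilon)-R^\vee(\cdot;\varepsilon)R(\cdot;\varepsilon)\|_1\to 0$. If the resolvent set of $L_0$ is not empty, conditions 2), 3), 4) hold, and at least one of the conditions (I), (II), (III) holds, then $L_\varepsilon$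 converges to $L_0$ in the sense of norm resolvent convergence as $\varepsilon\to+0$. Moreover, in the presence of 2) and 3), each of the conditions (I), (II), (III) is more general than the condition $\|q_\varepsilon\|_2=O(1)$ as $\varepsilon\to+0$; that is, $\|q_\varepsilon\|_2=O(1)$ together with 2) and 3) implies each of (I), (II), (III).
   Context: Notation: $\|\cdot\|_2$ is the norm of $L_2=L_2([a,b],\mathbb{C})$; $c^\vee(t):=\int_a^t c(x)\,dx$ for an integrable scalar or matrix function $c$ on $[a,b]$ (entrywise for matrices); $\|\cdot\|_C$ is the sup-norm on $[a,b]$; $\|\cdot\|_1$ is the norm of $L_1([a,b],\mathbb{C}^{2\times2})$ (integral of a fixed matrix norm). Products such as $R(\cdot;\varepsilon)R^\vee(\cdot;\varepsilon)$ are pointwise matrix products. Quasi-derivatives: for $q_\varepsilon\in L_2$ put $$D^{[0]}_\varepsilon y=y,\qquad D^{[1]}_\varepsilon y=y'-q_\varepsilon y,\qquad D^{[2]}_\varepsilon y=-(D^{[1]}_\varepsilon y)'-q_\varepsilon D^{[1]}_\varepsilon y-q_\varepsilon^2 y.$$ Here $D^{[2]}_\varepsilon y$ exists when $y$ and $D^{[1]}_\varepsilon y$ are absolutely continuous on $[a,b]$. The formal expression $l_\varepsilon(y)=-y''+q_\varepsilon' y$ is defined as $l_\varepsilon(y):=D^{[2]}_\varepsilon y$. Operator: $L_\varepsilon y:=l_\varepsilon(y)=D^{[2]}_\varepsilon y$ with domain $$\mathrm{Dom}(L_\varepsilon)=\{y\in L_2:\ \exists\, D^{[2]}_\varepsilon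 y\in L_2,\ \alpha(\varepsilon)\mathcal{Y}_a(\varepsilon)+\beta(\varepsilon)\mathcal{Y}_b(\varepsilon)=0\},$$ where $\mathcal{Y}_a(\varepsilon)=(y(a),D^{[1]}_\varepsilon y(a))$ and $\mathcal{Y}_b(\varepsilon)=(y(b),D^{[1]}_\varepsilon y(b))$ are viewed as column vectors in $\mathbb{C}^2$. Norm resolvent convergence of $L_\varepsilon$ to $L_0$ as $\varepsilon\to+0$ means: there is $\mu\in\mathbb{C}$ with $\mu\in\rho(L_0)$ and $\mu\in\rho(L_\varepsilon)$ for all sufficiently small $\varepsilon>0$, such that $\|(L_\varepsilon-\mu)^{-1}-(L_0-\mu)^{-1}\|\to 0$ as $\varepsilon\to+0$ (operator norm on $L_2$; $\rho(\cdot)$ denotes the resolvent set). *)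

theory Defs
  imports "HOL-Analysis.Analysis" "HOL-Library.Landau_Symbols"
begin

text \<open>
  Elements of $L_2([a,b],\mathbb{C})$ are represented by functions, of which only the restriction
  to $[a,b]$ matters; two functions represent the same element iff they satisfy \<open>ae_eq\<close>.
\<close>

definition L2 :: "real \<Rightarrow> real \<Rightarrow> (real \<Rightarrow> complex) set" where
  "L2 a b = {f. f \<in> borel_measurable (lebesgue_on {a..b}) \<and>
                integrable (lebesgue_on {a..b}) (\<lambda>x. (norm (f x))\<^sup>2)}"

definition norm_L2 :: "real \<Rightarrow> real \<Rightarrow> (real \<Rightarrow> complex) \<Rightarrow> real" where
  "norm_L2 a b f = sqrt (LINT x|lebesgue_on {a..b}. (norm (f x))\<^sup>2)"

definition ae_eq :: "real \<Rightarrow> real \<Rightarrow> (real \<Rightarrow> complex) \<Rightarrow> (real \<Rightarrow> complex) \<Rightarrow> bool" where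
  "ae_eq a b f g \<longleftrightarrow> (AE x in lebesgue_on {a..b}. f x = g x)"

definition norm_C :: "real \<Rightarrow> real \<Rightarrow> (real \<Rightarrow> complex) \<Rightarrow> real" where
  "norm_C a b c = (SUP t\<in>{a..b}. norm (c t))"

definition norm_L1 :: "real \<Rightarrow> real \<Rightarrow> (real \<Rightarrow> complex^2^2) \<Rightarrow> real" where
  "norm_L1 a b M = (LINT x|lebesgue_on {a..b}. norm (M x))"

definition vee :: "real \<Rightarrow> (real \<Rightarrow> complex) \<Rightarrow> real \<Rightarrow> complex" where
  "vee a c t = (LINT x|lebesgue_on {a..t}. c x)"

definition mat_vee :: "real \<Rightarrow> (real \<Rightarrow> complex^2^2) \<Rightarrow> real \<Rightarrow> complex^2^2" where
  "mat_vee a M t = (\<chi> i j. vee a (\<lambda>x. M x $ i $ j) t)"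

definition abs_cont_on :: "real \<Rightarrow> real \<Rightarrow> (real \<Rightarrow> complex) \<Rightarrow> bool" where
  "abs_cont_on a b f \<longleftrightarrow>
     (\<forall>e>0. \<exists>d>0. \<forall>S :: (real \<times> real) set.
        finite S \<longrightarrow> (\<forall>(s, t)\<in>S. a \<le> s \<and> s \<le> t \<and> t \<le> b) \<longrightarrow>
        disjoint_family_on (\<lambda>(s, t). {s<..<t}) S \<longrightarrow>
        (\<Sum>(s, t)\<in>S. t - s) < d \<longrightarrow> (\<Sum>(s, t)\<in>S. norm (f t - f s)) < e)"

text \<open>
  Quasi-derivatives are determined only almost everywhere, so they are introduced as relations.
  \<open>is_quasi_deriv1\<close> says that $u$ is a version of $y' - q y$, and \<open>is_quasi_deriv2\<close> that $D^{[2]} y$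
  exists and equals $f$, where $y$ and $u$ are the absolutely continuous functions $y$ and
  $D^{[1]} y$.
\<close>

definition is_quasi_deriv1 ::
  "real \<Rightarrow> real \<Rightarrow> (real \<Rightarrow> complex) \<Rightarrow> (real \<Rightarrow> complex) \<Rightarrow> (real \<Rightarrow> complex) \<Rightarrow> bool" where
  "is_quasi_deriv1 a b q y u \<longleftrightarrow>
     (AE x in lebesgue_on {a..b}.
        \<exists>y'. (y has_vector_derivative y') (at x) \<and> u x = y' - q x * y x)"

definition is_quasi_deriv2 ::
  "real \<Rightarrow> real \<Rightarrow> (real \<Rightarrow> complex) \<Rightarrow> (real \<Rightarrow> complex) \<Rightarrow> (real \<Rightarrow> complex)
    \<Rightarrow> (real \<Rightarrow> complex) \<Rightarrow> bool" where
  "is_quasi_deriv2 a b q y u f \<longleftrightarrow>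
     abs_cont_on a b y \<and> is_quasi_deriv1 a b q y u \<and> abs_cont_on a b u \<and>
     (AE x in lebesgue_on {a..b}.
        \<exists>u'. (u has_vector_derivative u') (at x) \<and>
             f x = - u' - q x * u x - (q x)\<^sup>2 * y x)"

text \<open>
  An operator in $L_2$ is given by its graph, a set of pairs of representatives that is closed
  under \<open>ae_eq\<close> in both components. The boundary values are those of the (for $a < b$ unique on
  $[a,b]$) absolutely continuous representatives $z$ of $y$ and $u$ of $D^{[1]} y$.
\<close>

definition SL_op ::
  "real \<Rightarrow> real \<Rightarrow> (real \<Rightarrow> complex) \<Rightarrow> complex^2^2 \<Rightarrow> complex^2^2
    \<Rightarrow> ((real \<Rightarrow> complex) \<times> (real \<Rightarrow> complex)) set" where
  "SL_op a b q \<alpha> \<beta> =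
     {(y, f). y \<in> L2 a b \<and> f \<in> L2 a b \<and>
        (\<exists>z u. ae_eq a b y z \<and> is_quasi_deriv2 a b q z u f \<and>
               \<alpha> *v vector [z a, u a] + \<beta> *v vector [z b, u b] = 0)}"

definition solves ::
  "real \<Rightarrow> real \<Rightarrow> ((real \<Rightarrow> complex) \<times> (real \<Rightarrow> complex)) set \<Rightarrow> complex
    \<Rightarrow> (real \<Rightarrow> complex) \<Rightarrow> (real \<Rightarrow> complex) \<Rightarrow> bool" where
  "solves a b T \<mu> f y \<longleftrightarrow> (\<exists>g. (y, g) \<in> T \<and> ae_eq a b (\<lambda>x. g x - \<mu> * y x) f)"

text \<open>
  The resolvent set: $T - \mu$ is a bijection from its domain onto $L_2$ with bounded inverse.
\<close>

definition resolvent_set ::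
  "real \<Rightarrow> real \<Rightarrow> ((real \<Rightarrow> complex) \<times> (real \<Rightarrow> complex)) set \<Rightarrow> complex set" where
  "resolvent_set a b T =
     {\<mu>. (\<forall>f\<in>L2 a b. \<exists>y. solves a b T \<mu> f y) \<and>
         (\<forall>f\<in>L2 a b. \<forall>y1 y2. solves a b T \<mu> f y1 \<longrightarrow> solves a b T \<mu> f y2 \<longrightarrow> ae_eq a b y1 y2) \<and>
         (\<exists>C. \<forall>f\<in>L2 a b. \<forall>y. solves a b T \<mu> f y \<longrightarrow> norm_L2 a b y \<le> C * norm_L2 a b f)}"

text \<open>
  For $\mu$ in the resolvent set the chosen value is unique up to \<open>ae_eq\<close>.
\<close>

definition resolvent ::
  "real \<Rightarrow> real \<Rightarrow> ((real \<Rightarrow> complex) \<times> (real \<Rightarrow> complex)) set \<Rightarrow> complex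
    \<Rightarrow> (real \<Rightarrow> complex) \<Rightarrow> (real \<Rightarrow> complex)" where
  "resolvent a b T \<mu> f = (SOME y. solves a b T \<mu> f y)"

definition opnorm_L2 ::
  "real \<Rightarrow> real \<Rightarrow> ((real \<Rightarrow> complex) \<Rightarrow> (real \<Rightarrow> complex)) \<Rightarrow> ennreal" where
  "opnorm_L2 a b B = (SUP f\<in>{f \<in> L2 a b. norm_L2 a b f \<le> 1}. ennreal (norm_L2 a b (B f)))"

definition norm_resolvent_convergent ::
  "real \<Rightarrow> real \<Rightarrow> (real \<Rightarrow> ((real \<Rightarrow> complex) \<times> (real \<Rightarrow> complex)) set) \<Rightarrow> bool" where
  "norm_resolvent_convergent a b L \<longleftrightarrow>
     (\<exists>\<mu>. \<mu> \<in> resolvent_set a b (L 0) \<and>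
          (\<forall>\<^sub>F \<epsilon> in at_right 0. \<mu> \<in> resolvent_set a b (L \<epsilon>)) \<and>
          ((\<lambda>\<epsilon>. opnorm_L2 a b
               (\<lambda>f x. resolvent a b (L \<epsilon>) \<mu> f x - resolvent a b (L 0) \<mu> f x)) \<longlongrightarrow> 0) (at_right 0))"

definition A_mat :: "(real \<Rightarrow> complex) \<Rightarrow> real \<Rightarrow> complex^2^2" where
  "A_mat q x = vector [vector [q x, 1], vector [- (q x)\<^sup>2, - q x]]"

definition R_mat :: "(real \<Rightarrow> real \<Rightarrow> complex) \<Rightarrow> real \<Rightarrow> real \<Rightarrow> complex^2^2" where
  "R_mat q \<epsilon> x = A_mat (q \<epsilon>) x - A_mat (q 0) x"

definition cond_I :: "real \<Rightarrow> real \<Rightarrow> (real \<Rightarrow> real \<Rightarrow> complex) \<Rightarrow> bool" where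
  "cond_I a b q \<longleftrightarrow>
     ((\<lambda>\<epsilon>. norm_L1 a b (\<lambda>x. R_mat q \<epsilon> x ** mat_vee a (R_mat q \<epsilon>) x)) \<longlongrightarrow> 0) (at_right 0)"

definition cond_II :: "real \<Rightarrow> real \<Rightarrow> (real \<Rightarrow> real \<Rightarrow> complex) \<Rightarrow> bool" where
  "cond_II a b q \<longleftrightarrow>
     ((\<lambda>\<epsilon>. norm_L1 a b (\<lambda>x. mat_vee a (R_mat q \<epsilon>) x ** R_mat q \<epsilon> x)) \<longlongrightarrow> 0) (at_right 0)"

definition cond_III :: "real \<Rightarrow> real \<Rightarrow> (real \<Rightarrow> real \<Rightarrow> complex) \<Rightarrow> bool" where
  "cond_III a b q \<longleftrightarrow>
     ((\<lambda>\<epsilon>. norm_L1 a b (\<lambda>x. R_mat q \<epsilon> x ** mat_vee a (R_mat q \<epsilon>) x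
                           - mat_vee a (R_mat q \<epsilon>) x ** R_mat q \<epsilon> x)) \<longlongrightarrow> 0) (at_right 0)"

end

theory Submission
  imports Defs "HOL-Complex_Analysis.Cauchy_Integral_Formula"
begin

text \<open>
  The gauge transformation $z = e^Q \zeta$, $u = e^{-Q}(M\zeta + \theta)$ with $Q = q^\vee$ and
  $M = -((q^2+\mu)e^{2Q})^\vee$ turns the first-order system of $(D^{[2]} - \mu) z = f$ into one with the
  continuous coefficients $e^{-2Q}$ and $M$. Hence Picard iteration and Gronwall's
  inequality suffice, and the fundamental matrices converge uniformly as soon as
  $Q_\varepsilon \to Q_0$ and $M_\varepsilon \to M_0$ uniformly. The first is condition 2). For the second put
  $r = q_\varepsilon - q_0$, $s = q_\varepsilon^2 - q_0^2$. Since $R$ is lower triangular and trace-free, the only nonzero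
  entry of $R R^\vee - R^\vee R$ is $2 (r s^\vee - s r^\vee)$, and the same function is, up to sign, the lower left entry of
  $R R^\vee$ and of $R^\vee R$. So each of (I), (II), (III) makes its $L_1$ norm tend to $0$, and this
  is exactly what is needed to integrate $s e^{2 r^\vee}$ by parts. A number $\mu$ belongs to the resolvent set iff
  $\det(\alpha + \beta\Psi(b)) \neq 0$ for the fundamental matrix $\Psi$ with $\Psi(a) = I$; this condition persists for
  small $\varepsilon$, and the Green functions converge uniformly.
\<close>

section \<open>Absolutely continuous functions\<close>

text \<open>The obstacle is that nothing bounds \<open>q \<epsilon>\<close> in L2. The coefficients
  of the first-order system need not be bounded in L1, so Gronwall's inequality applied to it
  directly gives constants that may blow up. The hypotheses control indefinite integrals, and the
  gauge is built so that only those survive: the factors e^Q and e^(-Q) remove q from the diagonal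
  and leave zeta' = e^(-2Q) eta, eta' = -(q^2 + mu) e^(2Q) zeta, and eta = M zeta + theta trades the
  last coefficient for its antiderivative M. The price is that M mixes q^2 with e^(2Q). Put v = vee
  r and w = vee s. Uniform smallness of w alone does not make the integral of s e^(2v) small:
  shifting the derivative onto e^(2v) produces r w e^(2v), and r need not be bounded in L1 either.
  The inhomogeneous term and uniqueness need no gauge: the Wronskian is 1, so the fundamental matrix
  is inverted explicitly, and only f times continuous entries gets integrated. All of this rests on
  the fact that an absolutely continuous function whose derivative vanishes almost everywhere is
  constant.\<close>

lemma integrable_lebesgue_on_iff_absolutely:
  fixes f :: "real \<Rightarrow> 'a::euclidean_space"
  shows "integrable (lebesgue_on {a..b}) f \<longleftrightarrow> f absolutely_integrable_on {a..b}"
  by (simp add: integrable_restrict_space set_integrable_def)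

section \<open>Indefinite integrals of integrable functions\<close>

lemma integrable_lebesgue_on_subinterval:
  fixes f :: "real \<Rightarrow> 'a::euclidean_space"
  assumes "integrable (lebesgue_on {a..b}) f" "a \<le> c" "d \<le> b"
  shows "integrable (lebesgue_on {c..d}) f"
  using assms unfolding integrable_lebesgue_on_iff_absolutely
  by (metis absolutely_integrable_on_subinterval atLeastatMost_subset_iff box_real(2))

lemma vee_eq_integral:
  assumes "integrable (lebesgue_on {a..b}) f" "t \<le> b"
  shows "vee a f t = integral {a..t} f"
  unfolding vee_def
  by (rule lebesgue_integral_eq_integral[OF integrable_lebesgue_on_subinterval[OF assms(1) order_refl assms(2)]]) simp

lemma vee_diff:
  assumes "integrable (lebesgue_on {a..b}) f" "a \<le> s" "s \<le> t" "t \<le> b"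
  shows "vee a f t - vee a f s = integral {s..t} f"
proof -
  have "integral {a..s} f + integral {s..t} f = integral {a..t} f"
    by (rule Henstock_Kurzweil_Integration.integral_combine)
      (use assms integrable_lebesgue_on_subinterval[OF assms(1), of a t] in \<open>auto intro: integrable_on_lebesgue_on\<close>)
  then show ?thesis
    using assms by (simp add: vee_eq_integral[OF assms(1)] algebra_simps)
qed

lemma vee_start [simp]: "vee a f a = 0"
proof -
  have "vee a f a = (LINT x|lebesgue. indicator {a..a} x *\<^sub>R f x)"
    unfolding vee_def by (rule integral_restrict_space) simp
  also have "\<dots> = 0"
    by (rule integral_eq_zero_AE, rule AE_I'[of "{a}"]) (auto split: split_indicator_asm)
  finally show ?thesis .
qed

lemma AE_lebesgue_on_interval_negligible:
  fixes a b :: real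
  shows "(AE x in lebesgue_on {a..b}. P x) \<longleftrightarrow> negligible {x \<in> {a..b}. \<not> P x}"
proof -
  have "(AE x in lebesgue_on {a..b}. P x) \<longleftrightarrow> (AE x in lebesgue. x \<in> {a..b} \<longrightarrow> P x)"
    by (simp add: AE_restrict_space_iff)
  also have "\<dots> \<longleftrightarrow> negligible {x \<in> {a..b}. \<not> P x}"
    unfolding eventually_ae_filter
    by (auto intro: negligible_subset simp: negligible_iff_null_sets[symmetric] Bex_def)
  finally show ?thesis .
qed

text \<open>Cut \<open>norm (f x)\<close> at a height \<open>n\<close>. The part below contributes
  at most \<open>n\<close> times the total length of the intervals, the excess \<open>G n\<close> at
  most its integral over all of \<open>{a..b}\<close>, and that integral is small for large
  \<open>n\<close> by dominated convergence.\<close>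

lemma abs_cont_on_vee:
  assumes f: "integrable (lebesgue_on {a..b}) f"
  shows "abs_cont_on a b (vee a f)"
  unfolding abs_cont_on_def
proof (intro allI impI)
  fix e :: real assume e: "e > 0"
  let ?M = "lebesgue_on {a..b}"
  define G where "G n x = max 0 (norm (f x) - real n)" for n x
  have [measurable]: "f \<in> borel_measurable ?M" using f by simp
  have [measurable]: "G n \<in> borel_measurable ?M" for n unfolding G_def[abs_def] by measurable
  have Gint: "integrable ?M (G n)" for n
    by (rule Bochner_Integration.integrable_bound[OF integrable_norm[OF f]]) (auto simp: G_def)
  have "(\<lambda>n. integral\<^sup>L ?M (G n)) \<longlonglongrightarrow> integral\<^sup>L ?M (\<lambda>x. 0)"
  proof (rule integral_dominated_convergence)
    show "integrable ?M (\<lambda>x. norm (f x))" using f by simp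
    show "AE x in ?M. (\<lambda>n. G n x) \<longlonglongrightarrow> 0"
    proof (rule AE_I2)
      fix x
      obtain N :: nat where N: "norm (f x) \<le> N" using real_arch_simple by blast
      show "(\<lambda>n. G n x) \<longlonglongrightarrow> 0"
        by (rule tendsto_eventually)
          (use N in \<open>auto simp: G_def eventually_sequentially intro!: exI[of _ N]\<close>)
    qed
  qed (auto simp: G_def)
  then have "\<forall>\<^sub>F n in sequentially. integral\<^sup>L ?M (G n) < e / 2"
    using e by (intro order_tendstoD(2)) auto
  then obtain n where n: "integral\<^sup>L ?M (G n) < e / 2"
    by (meson eventually_sequentially order_refl)
  \<comment> \<open>With this \<open>d\<close> the bounded part contributes at most
    \<open>e / 2\<close>; adding 1 keeps the denominator positive when \<open>n = 0\<close>.\<close>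
  define d where "d = e / (2 * (real n + 1))"
  have d: "d > 0" using e by (simp add: d_def)
  show "\<exists>d>0. \<forall>S :: (real \<times> real) set.
        finite S \<longrightarrow> (\<forall>(s, t)\<in>S. a \<le> s \<and> s \<le> t \<and> t \<le> b) \<longrightarrow>
        disjoint_family_on (\<lambda>(s, t). {s<..<t}) S \<longrightarrow>
        (\<Sum>(s, t)\<in>S. t - s) < d \<longrightarrow> (\<Sum>(s, t)\<in>S. norm (vee a f t - vee a f s)) < e"
  proof (intro exI[of _ d] conjI d allI impI)
    fix S :: "(real \<times> real) set"
    assume fin: "finite S" and sub: "\<forall>(s, t)\<in>S. a \<le> s \<and> s \<le> t \<and> t \<le> b"
      and dis: "disjoint_family_on (\<lambda>(s, t). {s<..<t}) S" and len: "(\<Sum>(s, t)\<in>S. t - s) < d"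
    have ind: "integrable ?M (\<lambda>x. indicator {s<..<t} x * G n x)" for s t
    proof (rule Bochner_Integration.integrable_bound[OF Gint])
      have "(indicator {s<..<t} :: real \<Rightarrow> real) \<in> borel_measurable ?M"
        by (rule measurable_restrict_space1, rule borel_measurable_indicator) simp
      then show "(\<lambda>x. indicator {s<..<t} x * G n x) \<in> borel_measurable ?M"
        by simp
    qed (auto simp: indicator_def)
    have one: "norm (vee a f t - vee a f s) \<le> real n * (t - s) + (LINT x|?M. indicator {s<..<t} x * G n x)"
      if "(s, t) \<in> S" for s t
    proof -
      from that sub have st: "a \<le> s" "s \<le> t" "t \<le> b" by auto
      have fs: "integrable (lebesgue_on {s..t}) f" and Gs: "integrable (lebesgue_on {s..t}) (G n)"
        using integrable_lebesgue_on_subinterval f Gint st by blast+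
      have "norm (vee a f t - vee a f s) = norm (integral {s..t} f)"
        using vee_diff[OF f st] by simp
      also have "\<dots> \<le> integral {s..t} (\<lambda>x. n + G n x)"
        by (rule integral_norm_bound_integral)
          (use fs Gs in \<open>auto simp: G_def intro!: integrable_add integrable_on_lebesgue_on\<close>)
      also have "\<dots> = real n * (t - s) + integral {s..t} (G n)"
        using Gs st by (subst integral_add) (auto intro: integrable_on_lebesgue_on)
      also have "integral {s..t} (G n) = integral\<^sup>L (lebesgue_on {s..t}) (G n)"
        using Gs by (simp add: lebesgue_integral_eq_integral)
      also have "\<dots> = integral\<^sup>L lebesgue (\<lambda>x. indicator {s..t} x *\<^sub>R G n x)"
        by (rule integral_restrict_space) simp
      \<comment> \<open>The closed interval is traded for the open one, which differs by a null set:
        the definition of \<open>abs_cont_on\<close> makes only the open intervals disjoint, and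
        disjointness is what bounds the sum of the indicators by 1.\<close>
      also have "\<dots> = integral\<^sup>L lebesgue (\<lambda>x. indicator {a..b} x *\<^sub>R (indicator {s<..<t} x * G n x))"
      proof (rule integral_cong_AE)
        show "(\<lambda>x. indicator {s..t} x *\<^sub>R G n x) \<in> borel_measurable lebesgue"
          using Gs by (simp add: integrable_restrict_space)
        show "(\<lambda>x. indicator {a..b} x *\<^sub>R (indicator {s<..<t} x * G n x)) \<in> borel_measurable lebesgue"
          using ind[of s t] by (simp add: integrable_restrict_space)
        show "AE x in lebesgue. indicator {s..t} x *\<^sub>R G n x
            = indicator {a..b} x *\<^sub>R (indicator {s<..<t} x * G n x)"
          by (rule AE_I'[of "{s,t}"]) (use st in \<open>auto simp: indicator_def\<close>)
      qed
      also have "\<dots> = (LINT x|?M. indicator {s<..<t} x * G n x)"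
        by (rule integral_restrict_space[symmetric]) simp
      finally show ?thesis .
    qed
    have "(\<Sum>(s, t)\<in>S. norm (vee a f t - vee a f s))
        \<le> (\<Sum>(s, t)\<in>S. real n * (t - s) + (LINT x|?M. indicator {s<..<t} x * G n x))"
      by (rule sum_mono) (use one in auto)
    also have "\<dots> = real n * (\<Sum>(s, t)\<in>S. t - s) + (\<Sum>(s, t)\<in>S. (LINT x|?M. indicator {s<..<t} x * G n x))"
      by (simp add: case_prod_unfold sum.distrib sum_distrib_left)
    also have "(\<Sum>(s, t)\<in>S. (LINT x|?M. indicator {s<..<t} x * G n x))
        = (LINT x|?M. (\<Sum>(s, t)\<in>S. indicator {s<..<t} x * G n x))"
      using ind by (simp add: case_prod_unfold)
    also have "\<dots> \<le> integral\<^sup>L ?M (G n)"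
    proof (rule integral_mono[OF _ Gint])
      show "integrable ?M (\<lambda>x. \<Sum>(s, t)\<in>S. indicator {s<..<t} x * G n x)"
        using ind by (simp add: case_prod_unfold)
      fix x
      have "(\<Sum>p\<in>S. indicator (case p of (s, t) \<Rightarrow> {s<..<t}) x) = (indicator (\<Union>p\<in>S. case p of (s, t) \<Rightarrow> {s<..<t}) x :: real)"
        by (rule indicator_UN_disjoint[OF fin dis, symmetric])
      then have "(\<Sum>(s, t)\<in>S. indicator {s<..<t} x :: real) \<le> 1"
        by (simp add: case_prod_unfold indicator_def)
      then show "(\<Sum>(s, t)\<in>S. indicator {s<..<t} x * G n x) \<le> G n x"
        by (simp add: case_prod_unfold sum_distrib_right[symmetric] G_def mult_left_le_one_le sum_nonneg)
    qed
    finally have "(\<Sum>(s, t)\<in>S. norm (vee a f t - vee a f s)) \<le> real n * (\<Sum>(s, t)\<in>S. t - s) + integral\<^sup>L ?M (G n)"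
      by simp
    moreover have "real n * (\<Sum>(s, t)\<in>S. t - s) \<le> real n * d"
      using len by (intro mult_left_mono) auto
    moreover have "real n * d \<le> e / 2" using e by (simp add: d_def field_simps)
    ultimately show "(\<Sum>(s, t)\<in>S. norm (vee a f t - vee a f s)) < e" using n by linarith
  qed
qed

text \<open>Lebesgue's differentiation theorem. \<open>integrable_ccontinuous_explicit\<close>
  concerns averages to the right of \<open>x\<close> only; applied to the reflected function it
  gives the averages to the left, and together they give a two-sided derivative.\<close>

lemma vee_has_vector_derivative_AE:
  assumes f: "integrable (lebesgue_on {a..b}) f"
  shows "AE x in lebesgue_on {a..b}. (vee a f has_vector_derivative f x) (at x)"
proof -
  \<comment> \<open>Extension by zero makes the function integrable on every interval, as the
    theorem on averages demands.\<close>
  define g where "g x = (if x \<in> {a..b} then f x else 0)" for x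
  have g: "g absolutely_integrable_on UNIV"
    using f unfolding integrable_lebesgue_on_iff_absolutely g_def[abs_def]
    by (simp only: absolutely_integrable_restrict_UNIV)
  have g_on: "g integrable_on {c..d}" for c d
    using g by (metis absolutely_integrable_on_def integrable_on_subinterval set_lebesgue_integral_eq_integral(1) subset_UNIV)
  have g_rev: "(\<lambda>x. g (- x)) integrable_on {c..d}" for c d
    using g_on[of "-d" "-c"] Henstock_Kurzweil_Integration.integrable_reflect_real[of g "-c" "-d"] by simp
  obtain N1 where N1: "negligible N1" and r1: "\<And>x e. \<lbrakk>x \<notin> N1; 0 < e\<rbrakk> \<Longrightarrow>
      \<exists>d>0. \<forall>h. 0 < h \<and> h < d \<longrightarrow> norm (integral {x..x + h} g /\<^sub>R h - g x) < e"
    using integrable_ccontinuous_explicit[of g] g_on by auto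
  obtain N2 where N2: "negligible N2" and r2: "\<And>x e. \<lbrakk>x \<notin> N2; 0 < e\<rbrakk> \<Longrightarrow>
      \<exists>d>0. \<forall>h. 0 < h \<and> h < d \<longrightarrow> norm (integral {x..x + h} (\<lambda>x. g (-x)) /\<^sub>R h - g (-x)) < e"
    using integrable_ccontinuous_explicit[of "\<lambda>x. g (-x)"] g_rev by auto
  have N2': "negligible (uminus ` N2)"
    by (rule negligible_differentiable_image_negligible[OF _ N2]) (auto intro!: derivative_intros)
  have der: "(vee a f has_vector_derivative f x) (at x)"
    if x: "a < x" "x < b" "x \<notin> N1" "x \<notin> uminus ` N2" for x
    unfolding has_vector_derivative_def has_derivative_at_alt
  proof (intro conjI allI impI)
    show "bounded_linear (\<lambda>h. h *\<^sub>R f x)" by (rule bounded_linear_scaleR_left)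
    fix e :: real assume e: "e > 0"
    obtain d1 where d1: "d1 > 0" "\<And>h. 0 < h \<Longrightarrow> h < d1 \<Longrightarrow> norm (integral {x..x + h} g /\<^sub>R h - g x) < e"
      using r1[OF x(3) e] by auto
    have "- x \<notin> N2" using x(4) by (metis imageI minus_minus)
    then obtain d2 where d2: "d2 > 0" "\<And>h. 0 < h \<Longrightarrow> h < d2 \<Longrightarrow> norm (integral {-x..-x + h} (\<lambda>x. g (-x)) /\<^sub>R h - g x) < e"
      using r2[of "-x", OF _ e] by auto
    define d where "d = min (min d1 d2) (min (x - a) (b - x))"
    have g_eq: "integral {s..t} g = vee a f t - vee a f s" if "a \<le> s" "s \<le> t" "t \<le> b" for s t
      unfolding vee_diff[OF f that] by (rule integral_cong) (use that in \<open>auto simp: g_def\<close>)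
    have key: "norm (w - h *\<^sub>R z) \<le> e * h" if "norm (w /\<^sub>R h - z) < e" "h > 0" for w z :: complex and h
    proof -
      have "w - h *\<^sub>R z = h *\<^sub>R (w /\<^sub>R h - z)" using that by (simp add: algebra_simps)
      then have "norm (w - h *\<^sub>R z) = h * norm (w /\<^sub>R h - z)" using that by simp
      then show ?thesis using that by (simp add: mult.commute mult_left_mono)
    qed
    show "\<exists>d>0. \<forall>y. norm (y - x) < d \<longrightarrow>
        norm (vee a f y - vee a f x - (y - x) *\<^sub>R f x) \<le> e * norm (y - x)"
    proof (intro exI[of _ d] conjI allI impI)
      show "d > 0" using d1 d2 x by (simp add: d_def)
      fix y assume y: "norm (y - x) < d"
      have gx: "g x = f x" using x by (simp add: g_def)
      consider "y = x" | "y > x" | "y < x" by linarith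
      then show "norm (vee a f y - vee a f x - (y - x) *\<^sub>R f x) \<le> e * norm (y - x)"
      proof cases
        case 1 then show ?thesis by simp
      next
        case 2
        have "norm (integral {x..x + (y - x)} g /\<^sub>R (y - x) - g x) < e"
          by (rule d1(2)) (use 2 y in \<open>auto simp: d_def\<close>)
        moreover have "integral {x..x + (y - x)} g = vee a f y - vee a f x"
          using g_eq[of x y] 2 y x by (auto simp: d_def)
        ultimately show ?thesis using key[where w = "vee a f y - vee a f x" and h = "y - x" and z = "f x"] 2 gx by simp
      next
        case 3
        have "norm (integral {-x..-x + (x - y)} (\<lambda>x. g (-x)) /\<^sub>R (x - y) - g x) < e"
          by (rule d2(2)) (use 3 y in \<open>auto simp: d_def\<close>)
        moreover have "integral {-x..-x + (x - y)} (\<lambda>x. g (-x)) = integral {y..x} g"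
          using Henstock_Kurzweil_Integration.integral_reflect_real[of x y g] by simp
        moreover have "\<dots> = vee a f x - vee a f y"
          using g_eq[of y x] 3 y x by (auto simp: d_def)
        ultimately have "norm (vee a f x - vee a f y - (x - y) *\<^sub>R f x) \<le> e * (x - y)"
          using key[where w = "vee a f x - vee a f y" and h = "x - y" and z = "f x"] 3 gx by simp
        moreover have "vee a f y - vee a f x - (y - x) *\<^sub>R f x = - (vee a f x - vee a f y - (x - y) *\<^sub>R f x)"
          by (simp add: algebra_simps)
        ultimately show ?thesis using 3 by (simp only: norm_minus_cancel) simp
      qed
    qed
  qed
  have "negligible {x \<in> {a..b}. \<not> (vee a f has_vector_derivative f x) (at x)}"
    by (rule negligible_subset[of "N1 \<union> uminus ` N2 \<union> {a, b}"])
      (use N1 N2' der in \<open>auto simp: less_le\<close>)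
  then show ?thesis by (simp add: AE_lebesgue_on_interval_negligible)
qed

section \<open>Consequences of absolute continuity\<close>

lemma abs_cont_onD:
  assumes "abs_cont_on a b F" "e > 0"
  obtains d where "d > 0" "\<And>S :: (real \<times> real) set. \<lbrakk>finite S; \<And>s t. (s, t) \<in> S \<Longrightarrow> a \<le> s \<and> s \<le> t \<and> t \<le> b;
    disjoint_family_on (\<lambda>(s, t). {s<..<t}) S; (\<Sum>(s, t)\<in>S. t - s) < d\<rbrakk>
    \<Longrightarrow> (\<Sum>(s, t)\<in>S. norm (F t - F s)) < e"
proof -
  from assms obtain d where "d > 0" and d: "\<forall>S :: (real \<times> real) set.
        finite S \<longrightarrow> (\<forall>(s, t)\<in>S. a \<le> s \<and> s \<le> t \<and> t \<le> b) \<longrightarrow>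
        disjoint_family_on (\<lambda>(s, t). {s<..<t}) S \<longrightarrow>
        (\<Sum>(s, t)\<in>S. t - s) < d \<longrightarrow> (\<Sum>(s, t)\<in>S. norm (F t - F s)) < e"
    unfolding abs_cont_on_def by meson
  show thesis
  proof (rule that[OF \<open>d > 0\<close>])
    fix S :: "(real \<times> real) set"
    assume "finite S" "\<And>s t. (s, t) \<in> S \<Longrightarrow> a \<le> s \<and> s \<le> t \<and> t \<le> b"
      "disjoint_family_on (\<lambda>(s, t). {s<..<t}) S" "(\<Sum>(s, t)\<in>S. t - s) < d"
    then show "(\<Sum>(s, t)\<in>S. norm (F t - F s)) < e"
      using d by blast
  qed
qed

lemma abs_cont_on_subinterval:
  assumes "abs_cont_on a b F" "a \<le> c" "d \<le> b"
  shows "abs_cont_on c d F"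
  unfolding abs_cont_on_def
proof (intro allI impI)
  fix e :: real assume e: "e > 0"
  obtain D where "D > 0" and D: "\<And>S :: (real \<times> real) set. \<lbrakk>finite S; \<And>s t. (s, t) \<in> S \<Longrightarrow> a \<le> s \<and> s \<le> t \<and> t \<le> b;
    disjoint_family_on (\<lambda>(s, t). {s<..<t}) S; (\<Sum>(s, t)\<in>S. t - s) < D\<rbrakk>
    \<Longrightarrow> (\<Sum>(s, t)\<in>S. norm (F t - F s)) < e"
    using abs_cont_onD[OF assms(1) e] by blast
  show "\<exists>D>0. \<forall>S :: (real \<times> real) set.
        finite S \<longrightarrow> (\<forall>(s, t)\<in>S. c \<le> s \<and> s \<le> t \<and> t \<le> d) \<longrightarrow>
        disjoint_family_on (\<lambda>(s, t). {s<..<t}) S \<longrightarrow>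
        (\<Sum>(s, t)\<in>S. t - s) < D \<longrightarrow> (\<Sum>(s, t)\<in>S. norm (F t - F s)) < e"
    using \<open>D > 0\<close> by (intro exI[of _ D] conjI allI impI D) (use assms in \<open>fastforce+\<close>)
qed

lemma abs_cont_on_imp_continuous_on:
  assumes "abs_cont_on a b F"
  shows "continuous_on {a..b} F"
  unfolding continuous_on_iff
proof (intro ballI allI impI)
  fix x e :: real assume x: "x \<in> {a..b}" and e: "e > 0"
  obtain D where "D > 0" and D: "\<And>S :: (real \<times> real) set. \<lbrakk>finite S; \<And>s t. (s, t) \<in> S \<Longrightarrow> a \<le> s \<and> s \<le> t \<and> t \<le> b;
    disjoint_family_on (\<lambda>(s, t). {s<..<t}) S; (\<Sum>(s, t)\<in>S. t - s) < D\<rbrakk>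
    \<Longrightarrow> (\<Sum>(s, t)\<in>S. norm (F t - F s)) < e"
    using abs_cont_onD[OF assms(1) e] by blast
  have main: "norm (F t - F s) < e" if "a \<le> s" "s \<le> t" "t \<le> b" "t - s < D" for s t
    using D[of "{(s, t)}"] that by (simp add: disjoint_family_on_def)
  show "\<exists>d>0. \<forall>x'\<in>{a..b}. dist x' x < d \<longrightarrow> dist (F x') (F x) < e"
  proof (intro exI[of _ D] conjI ballI impI \<open>D > 0\<close>)
    fix y assume y: "y \<in> {a..b}" "dist y x < D"
    show "dist (F y) (F x) < e"
    proof (cases "x \<le> y")
      case True
      then show ?thesis using main[of x y] x y by (simp add: dist_norm)
    next
      case False
      then show ?thesis using main[of y x] x y by (simp add: dist_norm norm_minus_commute[of "F y"])
    qed
  qed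
qed

text \<open>The common source of absolute continuity for sums, products and compositions: each needs
  just one estimate of its increments by increments of functions already known to be absolutely
  continuous.\<close>

lemma abs_cont_on_dominated:
  assumes A: "abs_cont_on a b A" and B: "abs_cont_on a b B" and C: "C > 0"
    and le: "\<And>s t. \<lbrakk>a \<le> s; s \<le> t; t \<le> b\<rbrakk> \<Longrightarrow> norm (F t - F s) \<le> C * (norm (A t - A s) + norm (B t - B s))"
  shows "abs_cont_on a b F"
  unfolding abs_cont_on_def
proof (intro allI impI)
  fix e :: real assume "e > 0"
  then have e: "e / (2 * C) > 0" using C by simp
  obtain dA where dA: "dA > 0" "\<And>S :: (real \<times> real) set. \<lbrakk>finite S; \<And>s t. (s, t) \<in> S \<Longrightarrow> a \<le> s \<and> s \<le> t \<and> t \<le> b;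
    disjoint_family_on (\<lambda>(s, t). {s<..<t}) S; (\<Sum>(s, t)\<in>S. t - s) < dA\<rbrakk>
    \<Longrightarrow> (\<Sum>(s, t)\<in>S. norm (A t - A s)) < e / (2 * C)"
    using abs_cont_onD[OF A e] by blast
  obtain dB where dB: "dB > 0" "\<And>S :: (real \<times> real) set. \<lbrakk>finite S; \<And>s t. (s, t) \<in> S \<Longrightarrow> a \<le> s \<and> s \<le> t \<and> t \<le> b;
    disjoint_family_on (\<lambda>(s, t). {s<..<t}) S; (\<Sum>(s, t)\<in>S. t - s) < dB\<rbrakk>
    \<Longrightarrow> (\<Sum>(s, t)\<in>S. norm (B t - B s)) < e / (2 * C)"
    using abs_cont_onD[OF B e] by blast
  show "\<exists>D>0. \<forall>S :: (real \<times> real) set.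
        finite S \<longrightarrow> (\<forall>(s, t)\<in>S. a \<le> s \<and> s \<le> t \<and> t \<le> b) \<longrightarrow>
        disjoint_family_on (\<lambda>(s, t). {s<..<t}) S \<longrightarrow>
        (\<Sum>(s, t)\<in>S. t - s) < D \<longrightarrow> (\<Sum>(s, t)\<in>S. norm (F t - F s)) < e"
  proof (intro exI[of _ "min dA dB"] conjI allI impI)
    fix S :: "(real \<times> real) set"
    assume fin: "finite S" and sub: "\<forall>(s, t)\<in>S. a \<le> s \<and> s \<le> t \<and> t \<le> b"
      and dis: "disjoint_family_on (\<lambda>(s, t). {s<..<t}) S" and len: "(\<Sum>(s, t)\<in>S. t - s) < min dA dB"
    have "(\<Sum>(s, t)\<in>S. norm (F t - F s)) \<le> (\<Sum>(s, t)\<in>S. C * (norm (A t - A s) + norm (B t - B s)))"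
      by (rule sum_mono) (use le sub in auto)
    also have "\<dots> = C * ((\<Sum>(s, t)\<in>S. norm (A t - A s)) + (\<Sum>(s, t)\<in>S. norm (B t - B s)))"
      by (simp add: case_prod_unfold sum.distrib sum_distrib_left[symmetric])
    also have "\<dots> < C * (e / (2 * C) + e / (2 * C))"
      by (intro mult_strict_left_mono add_strict_mono dA dB C fin dis) (use sub len in auto)
    also have "\<dots> = e" using C by simp
    finally show "(\<Sum>(s, t)\<in>S. norm (F t - F s)) < e" .
  qed (use dA dB in auto)
qed

text \<open>A gauge argument replaces a covering theorem. At a point of the exceptional null set
  \<open>N\<close> the gauge stays inside an open \<open>U\<close> of measure less than
  \<open>d\<close>; at any other point it is so fine that increments are at most \<open>e\<close>
  times the length. In a fine tagged division the cells tagged in \<open>N\<close> have total length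
  below \<open>d\<close>, so absolute continuity bounds their increments by \<open>e\<close>; the
  other cells contribute at most \<open>e * (b - a)\<close>.\<close>

lemma abs_cont_on_deriv_zero:
  assumes "a \<le> b" and F: "abs_cont_on a b F"
    and der: "AE x in lebesgue_on {a..b}. (F has_vector_derivative 0) (at x)"
  shows "F b = F a"
proof -
  have "norm (F b - F a) \<le> e * (b - a) + e" if e: "e > 0" for e
  proof -
    obtain d where d: "d > 0" "\<And>S :: (real \<times> real) set. \<lbrakk>finite S; \<And>s t. (s, t) \<in> S \<Longrightarrow> a \<le> s \<and> s \<le> t \<and> t \<le> b;
      disjoint_family_on (\<lambda>(s, t). {s<..<t}) S; (\<Sum>(s, t)\<in>S. t - s) < d\<rbrakk>
      \<Longrightarrow> (\<Sum>(s, t)\<in>S. norm (F t - F s)) < e"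
      using abs_cont_onD[OF F e] by blast
    define N where "N = {x \<in> {a..b}. \<not> (F has_vector_derivative 0) (at x)}"
    have N: "negligible N" using der by (simp add: AE_lebesgue_on_interval_negligible N_def)
    obtain U where U: "open U" "N \<subseteq> U" "U - N \<in> lmeasurable" "emeasure lebesgue (U - N) < ennreal d"
      using sets_lebesgue_outer_open[of N d] N d by (auto simp: negligible_imp_sets)
    have Nn: "N \<in> null_sets lebesgue" using N negligible_iff_null_sets by blast
    have "emeasure lebesgue U = emeasure lebesgue (U - N)"
      using Nn U by (intro emeasure_Diff_null_set[symmetric]) auto
    then have Ue: "emeasure lebesgue U < ennreal d" using U(4) by simp
    then have Um: "U \<in> lmeasurable"
      using U(1) by (intro fmeasurableI) (auto intro: less_trans)
    have Ud: "measure lebesgue U < d"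
      using Ue emeasure_eq_measure2[OF Um] by (simp add: ennreal_less_iff)
    have "\<exists>r>0. (x \<in> N \<longrightarrow> ball x r \<subseteq> U) \<and>
        (x \<in> {a..b} - N \<longrightarrow> (\<forall>y. \<bar>y - x\<bar> < r \<longrightarrow> norm (F y - F x) \<le> e * \<bar>y - x\<bar>))" for x
    proof (cases "x \<in> N")
      case True then show ?thesis using U open_contains_ball by blast
    next
      case False
      show ?thesis
      proof (cases "x \<in> {a..b}")
        case True
        with False have "(F has_vector_derivative 0) (at x)" by (simp add: N_def)
        then show ?thesis using False e
          unfolding has_vector_derivative_def has_derivative_at_alt by auto
      qed (use False in \<open>auto intro!: exI[of _ 1]\<close>)
    qed
    then have "\<forall>x. \<exists>r. r > 0 \<and> (x \<in> N \<longrightarrow> ball x r \<subseteq> U) \<and>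
        (x \<in> {a..b} - N \<longrightarrow> (\<forall>y. \<bar>y - x\<bar> < r \<longrightarrow> norm (F y - F x) \<le> e * \<bar>y - x\<bar>))"
      by blast
    from choice[OF this] obtain r where r': "\<forall>x. r x > 0 \<and> (x \<in> N \<longrightarrow> ball x (r x) \<subseteq> U) \<and>
        (x \<in> {a..b} - N \<longrightarrow> (\<forall>y. \<bar>y - x\<bar> < r x \<longrightarrow> norm (F y - F x) \<le> e * \<bar>y - x\<bar>))"
      by blast
    have r: "\<And>x. r x > 0" "\<And>x. x \<in> N \<Longrightarrow> ball x (r x) \<subseteq> U"
      "\<And>x y. x \<in> {a..b} - N \<Longrightarrow> \<bar>y - x\<bar> < r x \<Longrightarrow> norm (F y - F x) \<le> e * \<bar>y - x\<bar>"
      using r' by blast+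
    have "gauge (\<lambda>x. ball x (r x))" using r(1) by (intro gauge_ball_dependent) blast
    then obtain p where p: "p tagged_division_of {a..b}" and fine: "(\<lambda>x. ball x (r x)) fine p"
      using fine_division_exists_real by blast
    have fin: "finite p" using p by blast
    have pK: "\<exists>u v. K = {u..v} \<and> Inf K = u \<and> Sup K = v \<and> u \<le> x \<and> x \<le> v \<and> a \<le> u \<and> v \<le> b
        \<and> K \<subseteq> ball x (r x)" if xK: "(x, K) \<in> p" for x K
    proof -
      obtain u v where uv: "K = cbox u v" using tagged_division_ofD(4)[OF p xK] by blast
      have "x \<in> K" "K \<subseteq> {a..b}"
        using tagged_division_ofD(2)[OF p xK] tagged_division_ofD(3)[OF p xK] .
      moreover from this uv have "u \<le> v" by auto
      ultimately show ?thesis using uv fineD[OF fine xK]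
        by (intro exI[of _ u] exI[of _ v]) simp
    qed
    let ?f = "\<lambda>(x, K). norm (F (Sup K) - F (Inf K))"
    \<comment> \<open>Degenerate cells are left out. Their increment is 0, and for cells of positive
      length disjoint interiors force different pairs of end points, which makes
      \<open>\<iota>\<close> injective on \<open>p1\<close>.\<close>
    define p1 where "p1 = {(x, K) \<in> p. x \<in> N \<and> Inf K < Sup K}"
    define p2 where "p2 = {(x, K) \<in> p. x \<notin> N}"
    define \<iota> where "\<iota> = (\<lambda>(x::real, K::real set). (Inf K, Sup K))"
    have fin12: "finite p1" "finite p2"
      using fin by (auto simp: p1_def p2_def intro: finite_subset)
    have dis: "{Inf K<..<Sup K} \<inter> {Inf L<..<Sup L} = {}" if KL: "(x, K) \<in> p" "(y, L) \<in> p" "(x, K) \<noteq> (y, L)" for x y K L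
    proof -
      obtain u v u' v' where "K = {u..v}" "L = {u'..v'}" "Inf K = u" "Sup K = v" "Inf L = u'" "Sup L = v'"
        using pK[OF KL(1)] pK[OF KL(2)] by blast
      then show ?thesis using tagged_division_ofD(5)[OF p KL] by (simp add: interior_atLeastAtMost_real)
    qed
    have inj: "inj_on \<iota> p1"
    proof (rule inj_onI)
      fix P Q assume PQ: "P \<in> p1" "Q \<in> p1" "\<iota> P = \<iota> Q"
      obtain x K y L where "P = (x, K)" "Q = (y, L)" by (metis surj_pair)
      with PQ dis[of x K y L] show "P = Q" by (auto simp: p1_def \<iota>_def)
    qed
    have disj: "disjoint_family_on (\<lambda>(s, t). {s<..<t}) (\<iota> ` p1)"
      unfolding disjoint_family_on_def
    proof (intro ballI impI)
      fix P Q assume P: "P \<in> \<iota> ` p1" and Q: "Q \<in> \<iota> ` p1" and ne: "P \<noteq> Q"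
      from P obtain x K where K: "(x, K) \<in> p1" "P = (Inf K, Sup K)" by (auto simp: \<iota>_def)
      from Q obtain y L where L: "(y, L) \<in> p1" "Q = (Inf L, Sup L)" by (auto simp: \<iota>_def)
      have "(x, K) \<in> p" "(y, L) \<in> p" "(x, K) \<noteq> (y, L)" using K L ne by (auto simp: p1_def)
      from dis[OF this] show "(case P of (s, t) \<Rightarrow> {s<..<t}) \<inter> (case Q of (s, t) \<Rightarrow> {s<..<t}) = {}"
        by (simp only: K L prod.case)
    qed
    have "(\<Sum>(s, t)\<in>\<iota> ` p1. t - s) = (\<Sum>(s, t)\<in>\<iota> ` p1. measure lebesgue {s<..<t})"
      by (rule sum.cong) (auto simp: \<iota>_def p1_def)
    also have "\<dots> = measure lebesgue (\<Union>(s, t)\<in>\<iota> ` p1. {s<..<t})"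
      unfolding case_prod_unfold
    proof (rule measure_finite_Union[symmetric])
      show "emeasure lebesgue {fst P<..<snd P} \<noteq> \<infinity>" for P :: "real \<times> real"
        using fmeasurableD2[OF lmeasurable_box[of "fst P" "snd P"]] by (simp only: box_real) simp
    qed (use fin12 disj in \<open>auto simp: case_prod_unfold\<close>)
    also have "\<dots> \<le> measure lebesgue U"
    proof (rule measure_mono_fmeasurable[OF _ _ Um])
      show "(\<Union>(s, t)\<in>\<iota> ` p1. {s<..<t}) \<subseteq> U"
      proof
        fix y assume "y \<in> (\<Union>(s, t)\<in>\<iota> ` p1. {s<..<t})"
        then obtain x K where xK: "(x, K) \<in> p" "x \<in> N" "Inf K < y" "y < Sup K"
          by (auto simp: \<iota>_def p1_def)
        obtain u v where uv: "K = {u..v}" "Inf K = u" "Sup K = v" "K \<subseteq> ball x (r x)"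
          using pK[OF xK(1)] by blast
        have "y \<in> K" using xK(3,4) unfolding uv(2,3) by (simp add: uv(1))
        then show "y \<in> U" using uv(4) r(2)[OF xK(2)] by blast
      qed
      show "(\<Union>(s, t)\<in>\<iota> ` p1. {s<..<t}) \<in> sets lebesgue"
        using fin12 by (intro sets.finite_UN) auto
    qed
    finally have "(\<Sum>(s, t)\<in>\<iota> ` p1. t - s) < d" using Ud by simp
    have "(\<Sum>(s, t)\<in>\<iota> ` p1. norm (F t - F s)) < e"
    proof (rule d(2)[OF _ _ disj])
      show "finite (\<iota> ` p1)" using fin12 by simp
      show "(\<Sum>(s, t)\<in>\<iota> ` p1. t - s) < d" by fact
      fix s t assume "(s, t) \<in> \<iota> ` p1"
      then obtain x K where xK: "(x, K) \<in> p" "s = Inf K" "t = Sup K" by (auto simp: \<iota>_def p1_def)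
      obtain u v where "Inf K = u" "Sup K = v" "u \<le> x" "x \<le> v" "a \<le> u" "v \<le> b"
        using pK[OF xK(1)] by blast
      then show "a \<le> s \<and> s \<le> t \<and> t \<le> b" unfolding xK(2,3) by linarith
    qed
    then have s1: "(\<Sum>P\<in>p1. ?f P) < e"
      by (subst (asm) sum.reindex[OF inj]) (simp add: \<iota>_def case_prod_unfold o_def)
    have "(\<Sum>P\<in>p2. ?f P) \<le> (\<Sum>(x, K)\<in>p2. e * (Sup K - Inf K))"
    proof (rule sum_mono)
      fix P assume P: "P \<in> p2"
      obtain x K where P_eq: "P = (x, K)" by (cases P)
      then have xK: "(x, K) \<in> p" "x \<notin> N" using P by (auto simp: p2_def)
      obtain u v where uv: "K = {u..v}" "Inf K = u" "Sup K = v" "u \<le> x" "x \<le> v" "a \<le> u" "v \<le> b"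
        "K \<subseteq> ball x (r x)" using pK[OF xK(1)] by blast
      have uvK: "u \<in> K" "v \<in> K" using uv by auto
      have "norm (F v - F x) \<le> e * \<bar>v - x\<bar>" "norm (F u - F x) \<le> e * \<bar>u - x\<bar>"
        using r(3)[of x v] r(3)[of x u] xK(2) uv(4-7) subsetD[OF uv(8) uvK(1)] subsetD[OF uv(8) uvK(2)]
        by (simp_all add: dist_real_def abs_minus_commute)
      then have "norm (F v - F u) \<le> e * (v - x) + e * (x - u)"
        using norm_triangle_ineq4[of "F v - F x" "F u - F x"] uv by simp
      then show "?f P \<le> (case P of (x, K) \<Rightarrow> e * (Sup K - Inf K))"
        unfolding P_eq prod.case uv(2,3) by (simp add: algebra_simps)
    qed
    also have "\<dots> \<le> (\<Sum>(x, K)\<in>p. e * (Sup K - Inf K))"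
    proof (rule sum_mono2[OF fin])
      fix P assume P: "P \<in> p - p2"
      obtain x K where xK: "P = (x, K)" by (cases P)
      obtain u v where "Inf K = u" "Sup K = v" "u \<le> x" "x \<le> v"
        using pK[of x K] P xK by blast
      then have "Inf K \<le> Sup K" by linarith
      then show "0 \<le> (case P of (x, K) \<Rightarrow> e * (Sup K - Inf K))"
        unfolding xK using e by simp
    qed (auto simp: p2_def)
    also have "\<dots> = e * (b - a)"
      using additive_tagged_division_1[OF assms(1) p, of "\<lambda>x. x"]
      by (simp add: case_prod_unfold sum_distrib_left[symmetric])
    finally have s2: "(\<Sum>P\<in>p2. ?f P) \<le> e * (b - a)" .
    have "F b - F a = (\<Sum>(x, K)\<in>p. F (Sup K) - F (Inf K))"
      using additive_tagged_division_1[OF assms(1) p, of F] by simp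
    also have "norm \<dots> \<le> (\<Sum>P\<in>p. ?f P)"
      by (rule order_trans[OF norm_sum]) (simp add: case_prod_unfold)
    also have "\<dots> = (\<Sum>P\<in>p1 \<union> p2. ?f P)"
    proof (rule sum.mono_neutral_right[OF fin])
      show "p1 \<union> p2 \<subseteq> p" by (auto simp: p1_def p2_def)
      show "\<forall>P\<in>p - (p1 \<union> p2). ?f P = 0"
      proof
        fix P assume P: "P \<in> p - (p1 \<union> p2)"
        obtain x K where P_eq: "P = (x, K)" by (cases P)
        have xK: "(x, K) \<in> p" "(x, K) \<notin> p1" "(x, K) \<notin> p2" using P by (auto simp: P_eq)
        obtain u v where "Inf K = u" "Sup K = v" "u \<le> x" "x \<le> v"
          using pK[OF xK(1)] by blast
        then have "Inf K \<le> Sup K" by linarith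
        moreover have "\<not> Inf K < Sup K" using xK by (auto simp: p1_def p2_def)
        ultimately have "Sup K = Inf K" by linarith
        then show "?f P = 0" by (simp add: P_eq)
      qed
    qed
    also have "\<dots> = (\<Sum>P\<in>p1. ?f P) + (\<Sum>P\<in>p2. ?f P)"
      by (rule sum.union_disjoint) (use fin12 in \<open>auto simp: p1_def p2_def\<close>)
    finally show ?thesis using s1 s2 by linarith
  qed
  note main = this
  have "norm (F b - F a) \<le> 0 + e" if "e > 0" for e
  proof -
    have c: "b - a + 1 > 0" using assms(1) by simp
    have "norm (F b - F a) \<le> e / (b - a + 1) * (b - a) + e / (b - a + 1)"
      by (rule main) (use c that in simp)
    also have "\<dots> = e / (b - a + 1) * (b - a + 1)" by (simp only: distrib_left mult_1_right)
    also have "\<dots> = e" using c by simp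
    finally show ?thesis by simp
  qed
  then have "norm (F b - F a) \<le> 0" by (rule field_le_epsilon)
  then show ?thesis by simp
qed

section \<open>Calculus of almost everywhere derivatives\<close>

definition ac_deriv :: "real \<Rightarrow> real \<Rightarrow> (real \<Rightarrow> complex) \<Rightarrow> (real \<Rightarrow> complex) \<Rightarrow> bool" where
  "ac_deriv a b F f \<longleftrightarrow>
     abs_cont_on a b F \<and> (AE x in lebesgue_on {a..b}. (F has_vector_derivative f x) (at x))"

lemma ac_deriv_continuous: "ac_deriv a b F f \<Longrightarrow> continuous_on {a..b} F"
  by (simp add: ac_deriv_def abs_cont_on_imp_continuous_on)

lemma ac_deriv_vee:
  "integrable (lebesgue_on {a..b}) f \<Longrightarrow> ac_deriv a b (vee a f) f"
  by (simp add: ac_deriv_def abs_cont_on_vee vee_has_vector_derivative_AE)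

lemma ac_deriv_const: "ac_deriv a b (\<lambda>_. c) (\<lambda>_. 0)"
  by (auto simp: ac_deriv_def abs_cont_on_def case_prod_unfold intro: exI[of _ 1])

lemma ac_deriv_AE_cong:
  assumes "ac_deriv a b F f" "AE x in lebesgue_on {a..b}. f x = g x"
  shows "ac_deriv a b F g"
  using assms unfolding ac_deriv_def by (auto elim: eventually_elim2)

lemma ac_deriv_rhs_cong:
  assumes "ac_deriv a b F f" "\<And>x. a \<le> x \<Longrightarrow> x \<le> b \<Longrightarrow> f x = g x"
  shows "ac_deriv a b F g"
  by (rule ac_deriv_AE_cong[OF assms(1)]) (use assms(2) in \<open>auto intro!: AE_I2\<close>)

lemma AE_interior:
  fixes a b :: real
  shows "AE x in lebesgue_on {a..b}. a < x \<and> x < b"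
  unfolding AE_lebesgue_on_interval_negligible
  by (rule negligible_subset[of "{a, b}"]) auto

text \<open>Changing \<open>F\<close> outside \<open>{a..b}\<close> can affect the two-sided
  derivative only at \<open>a\<close> and \<open>b\<close>, which form a null set.\<close>

lemma ac_deriv_cong:
  assumes F: "ac_deriv a b F f" and eq: "\<And>x. a \<le> x \<Longrightarrow> x \<le> b \<Longrightarrow> F x = G x"
  shows "ac_deriv a b G f"
  unfolding ac_deriv_def
proof
  have AF: "abs_cont_on a b F" using F by (simp add: ac_deriv_def)
  show "abs_cont_on a b G"
    by (rule abs_cont_on_dominated[OF AF AF, of 1]) (auto simp: eq[symmetric])
  have "AE x in lebesgue_on {a..b}. (F has_vector_derivative f x) (at x)"
    using F by (simp add: ac_deriv_def)
  then show "AE x in lebesgue_on {a..b}. (G has_vector_derivative f x) (at x)"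
    using AE_interior
  proof eventually_elim
    case (elim x)
    then show ?case
      by (intro has_vector_derivative_transform_within_open[of F "f x" x "{a<..<b}" G]) (auto simp: eq)
  qed
qed

lemma ac_deriv_add:
  assumes "ac_deriv a b F f" "ac_deriv a b G g"
  shows "ac_deriv a b (\<lambda>x. F x + G x) (\<lambda>x. f x + g x)"
  unfolding ac_deriv_def
proof
  show "abs_cont_on a b (\<lambda>x. F x + G x)"
    by (rule abs_cont_on_dominated[of _ _ F G 1])
      (use assms in \<open>auto simp: ac_deriv_def add_diff_add intro: norm_triangle_ineq\<close>)
  show "AE x in lebesgue_on {a..b}. ((\<lambda>x. F x + G x) has_vector_derivative f x + g x) (at x)"
    using assms[unfolded ac_deriv_def, THEN conjunct2]
    by eventually_elim (rule has_vector_derivative_add)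
qed

lemma ac_deriv_mult:
  assumes F: "ac_deriv a b F f" and G: "ac_deriv a b G g"
  shows "ac_deriv a b (\<lambda>x. F x * G x) (\<lambda>x. F x * g x + f x * G x)"
  unfolding ac_deriv_def
proof
  have "bounded (F ` {a..b} \<union> G ` {a..b})"
    using F G by (auto intro!: compact_imp_bounded compact_continuous_image ac_deriv_continuous)
  then obtain B where B: "B > 0" "\<And>x. x \<in> {a..b} \<Longrightarrow> norm (F x) \<le> B" "\<And>x. x \<in> {a..b} \<Longrightarrow> norm (G x) \<le> B"
    by (auto simp: bounded_pos)
  show "abs_cont_on a b (\<lambda>x. F x * G x)"
  proof (rule abs_cont_on_dominated[of _ _ F G B])
    fix s t assume st: "a \<le> s" "s \<le> t" "t \<le> b"
    have "F t * G t - F s * G s = (F t - F s) * G t + F s * (G t - G s)" by (simp add: algebra_simps)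
    also have "norm \<dots> \<le> norm (F t - F s) * B + B * norm (G t - G s)"
      by (intro order_trans[OF norm_triangle_ineq] add_mono) (use st B in \<open>auto simp: norm_mult intro!: mult_mono\<close>)
    finally show "norm (F t * G t - F s * G s) \<le> B * (norm (F t - F s) + norm (G t - G s))"
      by (simp add: algebra_simps)
  qed (use F G B in \<open>auto simp: ac_deriv_def\<close>)
  show "AE x in lebesgue_on {a..b}. ((\<lambda>x. F x * G x) has_vector_derivative F x * g x + f x * G x) (at x)"
    using F[unfolded ac_deriv_def, THEN conjunct2] G[unfolded ac_deriv_def, THEN conjunct2]
    by eventually_elim (rule has_vector_derivative_mult)
qed

lemma ac_deriv_cmult:
  assumes "ac_deriv a b F f"
  shows "ac_deriv a b (\<lambda>x. c * F x) (\<lambda>x. c * f x)"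
  using ac_deriv_mult[OF ac_deriv_const assms, of c] by simp

lemma ac_deriv_minus:
  assumes "ac_deriv a b F f"
  shows "ac_deriv a b (\<lambda>x. - F x) (\<lambda>x. - f x)"
  using ac_deriv_cmult[OF assms, of "-1"] by simp

lemma ac_deriv_diff:
  assumes "ac_deriv a b F f" "ac_deriv a b G g"
  shows "ac_deriv a b (\<lambda>x. F x - G x) (\<lambda>x. f x - g x)"
  using ac_deriv_add[OF assms(1) ac_deriv_minus[OF assms(2)]] by simp

text \<open>The range of \<open>F\<close> lies in a disc, a convex set on which
  \<open>deriv h\<close> is bounded, so \<open>h\<close> is Lipschitz there. Besides exponentials,
  this serves the entire function of \<open>entire_quotient_exp\<close>.\<close>

lemma ac_deriv_compose_entire:
  assumes F: "ac_deriv a b F f" and h: "h holomorphic_on UNIV"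
  shows "ac_deriv a b (\<lambda>x. h (F x)) (\<lambda>x. f x * deriv h (F x))"
  unfolding ac_deriv_def
proof
  have "bounded (F ` {a..b})"
    using F by (auto intro!: compact_imp_bounded compact_continuous_image ac_deriv_continuous)
  then obtain R where R: "\<And>x. x \<in> {a..b} \<Longrightarrow> norm (F x) \<le> R"
    unfolding bounded_iff by blast
  have "continuous_on (cball 0 R) (deriv h)"
    using holomorphic_on_subset[OF holomorphic_deriv[OF h open_UNIV], of "cball 0 R"]
    by (auto intro: holomorphic_on_imp_continuous_on)
  then have "bounded (deriv h ` cball 0 R)"
    by (intro compact_imp_bounded compact_continuous_image) auto
  then obtain B where B: "B > 0" "\<And>z. norm z \<le> R \<Longrightarrow> norm (deriv h z) \<le> B"
    by (auto simp: bounded_pos)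
  have hd: "(h has_field_derivative deriv h z) (at z within S)" for z S
    using h by (auto simp: holomorphic_derivI intro: has_field_derivative_at_within)
  show "abs_cont_on a b (\<lambda>x. h (F x))"
  proof (rule abs_cont_on_dominated[of _ _ F F B])
    fix s t assume st: "a \<le> s" "s \<le> t" "t \<le> b"
    have "norm (h (F t) - h (F s)) \<le> B * norm (F t - F s)"
      by (rule field_differentiable_bound[of "cball 0 R" h "deriv h"])
        (use st B R hd in \<open>auto\<close>)
    also have "\<dots> \<le> B * (norm (F t - F s) + norm (F t - F s))"
      using B by (intro mult_left_mono) auto
    finally show "norm (h (F t) - h (F s)) \<le> B * (norm (F t - F s) + norm (F t - F s))" .
  qed (use F B in \<open>auto simp: ac_deriv_def\<close>)
  show "AE x in lebesgue_on {a..b}. ((\<lambda>x. h (F x)) has_vector_derivative f x * deriv h (F x)) (at x)"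
    using F[unfolded ac_deriv_def, THEN conjunct2]
  proof eventually_elim
    case (elim x)
    from field_vector_diff_chain_at[OF this hd[of "F x" UNIV]] show ?case by (simp add: o_def)
  qed
qed

lemma ac_deriv_exp:
  assumes "ac_deriv a b F f"
  shows "ac_deriv a b (\<lambda>x. exp (c * F x)) (\<lambda>x. c * f x * exp (c * F x))"
proof -
  have "exp holomorphic_on (UNIV :: complex set)" by (rule holomorphic_on_exp)
  from ac_deriv_compose_entire[OF ac_deriv_cmult[OF assms] this] show ?thesis
    by (simp add: DERIV_imp_deriv[OF DERIV_exp])
qed

lemma ac_deriv_zero:
  assumes F: "ac_deriv a b F (\<lambda>_. 0)" and t: "a \<le> t" "t \<le> b"
  shows "F t = F a"
proof (rule abs_cont_on_deriv_zero[OF t(1)])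
  show "abs_cont_on a t F"
    using F t by (auto simp: ac_deriv_def intro: abs_cont_on_subinterval)
  show "AE x in lebesgue_on {a..t}. (F has_vector_derivative 0) (at x)"
    using F t unfolding ac_deriv_def AE_lebesgue_on_interval_negligible
    by (auto elim: negligible_subset)
qed

text \<open>The difference of \<open>F\<close> and \<open>vee a f\<close> is absolutely continuous
  with derivative zero almost everywhere. Integrability of \<open>f\<close> is not built into
  \<open>ac_deriv\<close>; it is asked for here, where \<open>f\<close> is integrated.\<close>

lemma ac_deriv_integral:
  assumes F: "ac_deriv a b F f" and f: "integrable (lebesgue_on {a..b}) f" and t: "a \<le> t" "t \<le> b"
  shows "F t = F a + vee a f t"
proof -
  have "ac_deriv a b (\<lambda>x. F x - vee a f x) (\<lambda>_. 0)"
    using ac_deriv_diff[OF F ac_deriv_vee[OF f]] by simp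
  from ac_deriv_zero[OF this t] show ?thesis by (simp add: algebra_simps)
qed

section \<open>Continuous factors and bounds for indefinite integrals\<close>

lemma continuous_on_borel_measurable_lebesgue_on:
  fixes c :: "real \<Rightarrow> complex"
  shows "continuous_on {a..b} c \<Longrightarrow> c \<in> borel_measurable (lebesgue_on {a..b})"
  by (rule continuous_imp_measurable_on_sets_lebesgue) auto

lemma integrable_continuous_mult:
  fixes c f :: "real \<Rightarrow> complex"
  assumes c: "continuous_on {a..b} c" and f: "integrable (lebesgue_on {a..b}) f"
  shows "integrable (lebesgue_on {a..b}) (\<lambda>x. c x * f x)"
proof -
  have "bounded (c ` {a..b})"
    using c by (auto intro!: compact_imp_bounded compact_continuous_image)
  then obtain B where B: "B > 0" "\<And>x. x \<in> {a..b} \<Longrightarrow> norm (c x) \<le> B"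
    by (auto simp: bounded_pos)
  show ?thesis
  proof (rule Bochner_Integration.integrable_bound)
    show "integrable (lebesgue_on {a..b}) (\<lambda>x. of_real B * f x)" using f by simp
    show "(\<lambda>x. c x * f x) \<in> borel_measurable (lebesgue_on {a..b})"
      using continuous_on_borel_measurable_lebesgue_on[OF c] f by auto
    show "AE x in lebesgue_on {a..b}. norm (c x * f x) \<le> norm (of_real B * f x)"
      using B by (auto intro!: AE_I2 mult_right_mono simp: norm_mult)
  qed
qed

lemma integrable_continuous_lebesgue_on:
  fixes c :: "real \<Rightarrow> complex"
  assumes "continuous_on {a..b} c"
  shows "integrable (lebesgue_on {a..b}) c"
proof -
  have "integrable (lebesgue_on {a..b}) (\<lambda>_. 1 :: complex)"
    by (simp add: integrable_lebesgue_on_iff_absolutely absolutely_integrable_on_const)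
  from integrable_continuous_mult[OF assms this] show ?thesis by simp
qed

lemma norm_vee_le:
  assumes f: "integrable (lebesgue_on {a..b}) f" and t: "t \<le> b"
  shows "norm (vee a f t) \<le> (LINT x|lebesgue_on {a..b}. norm (f x))"
proof -
  have "norm (vee a f t) \<le> (LINT x|lebesgue_on {a..t}. norm (f x))"
    unfolding vee_def by (rule integral_norm_bound)
  also have "\<dots> = (LINT x|lebesgue. indicator {a..t} x *\<^sub>R norm (f x))"
    by (rule integral_restrict_space) simp
  also have "\<dots> \<le> (LINT x|lebesgue. indicator {a..b} x *\<^sub>R norm (f x))"
  proof (rule integral_mono)
    have "integrable (lebesgue_on {a..t}) (\<lambda>x. norm (f x))" "integrable (lebesgue_on {a..b}) (\<lambda>x. norm (f x))"
      using f integrable_lebesgue_on_subinterval[OF f order_refl t] by auto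
    then show "integrable lebesgue (\<lambda>x. indicator {a..t} x *\<^sub>R norm (f x))"
      "integrable lebesgue (\<lambda>x. indicator {a..b} x *\<^sub>R norm (f x))"
      by (simp_all add: integrable_restrict_space)
  qed (use t in \<open>auto simp: indicator_def\<close>)
  also have "\<dots> = (LINT x|lebesgue_on {a..b}. norm (f x))"
    by (rule integral_restrict_space[symmetric]) simp
  finally show ?thesis .
qed

lemma vee_add:
  assumes f: "integrable (lebesgue_on {a..b}) f" and g: "integrable (lebesgue_on {a..b}) g" and t: "t \<le> b"
  shows "vee a (\<lambda>x. f x + g x) t = vee a f t + vee a g t"
  unfolding vee_def
  by (intro Bochner_Integration.integral_add integrable_lebesgue_on_subinterval[OF f order_refl t]
      integrable_lebesgue_on_subinterval[OF g order_refl t])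

lemma vee_minus: "vee a (\<lambda>x. - f x) t = - vee a f t"
  by (simp add: vee_def)

lemma vee_diff_fun:
  assumes f: "integrable (lebesgue_on {a..b}) f" and g: "integrable (lebesgue_on {a..b}) g" and t: "t \<le> b"
  shows "vee a (\<lambda>x. f x - g x) t = vee a f t - vee a g t"
  unfolding vee_def
  by (intro Bochner_Integration.integral_diff integrable_lebesgue_on_subinterval[OF f order_refl t]
      integrable_lebesgue_on_subinterval[OF g order_refl t])

section \<open>Linear systems with continuous coefficients\<close>

lemma has_integral_exp_weight:
  fixes lam :: real
  assumes "a \<le> t" "lam \<noteq> 0"
  shows "((\<lambda>s. exp (lam * (s - a))) has_integral (exp (lam * (t - a)) - 1) / lam) {a..t}"
proof -
  have "((\<lambda>s. exp (lam * (s - a))) has_integral (exp (lam * (t - a)) / lam - exp (lam * (a - a)) / lam)) {a..t}"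
    by (rule fundamental_theorem_of_calculus[OF assms(1)])
      (use assms in \<open>auto intro!: derivative_eq_intros simp: has_real_derivative_iff_has_vector_derivative[symmetric]\<close>)
  then show ?thesis by (simp add: diff_divide_distrib)
qed

text \<open>Both the existence and the stability of solutions use the weight $e^{-(2K+1)(t-a)}$, for which
  the integral operator becomes a contraction with constant at most $1/2$.\<close>

lemma weighted_integral_bound:
  fixes g :: "real \<Rightarrow> 'b::banach"
  assumes t: "a \<le> t" and K: "K \<ge> 0" and m: "m \<ge> 0" and g: "g integrable_on {a..t}"
    and le: "\<And>s. a \<le> s \<Longrightarrow> s \<le> t \<Longrightarrow> norm (g s) \<le> K * (exp ((2 * K + 1) * (s - a)) * m)"
  shows "norm (integral {a..t} g) \<le> exp ((2 * K + 1) * (t - a)) * (m / 2)"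
proof -
  define lam where "lam = 2 * K + 1"
  have lam: "lam > 0" "K / lam \<le> 1 / 2" using K by (auto simp: lam_def field_simps)
  have hi: "((\<lambda>s. K * m * exp (lam * (s - a))) has_integral K * m * ((exp (lam * (t - a)) - 1) / lam)) {a..t}"
    using has_integral_exp_weight[OF t, of lam] lam by (intro has_integral_mult_right) auto
  have "norm (integral {a..t} g) \<le> integral {a..t} (\<lambda>s. K * m * exp (lam * (s - a)))"
    by (rule integral_norm_bound_integral[OF g])
      (use hi le in \<open>auto simp: lam_def mult_ac has_integral_integrable\<close>)
  also have "\<dots> = K * m * ((exp (lam * (t - a)) - 1) / lam)" using hi by (rule integral_unique)
  also have "\<dots> = (K / lam) * (m * (exp (lam * (t - a)) - 1))" by simp
  also have "\<dots> \<le> (1 / 2) * (m * exp (lam * (t - a)))"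
    using lam K m t by (intro mult_mono mult_nonneg_nonneg) auto
  finally show ?thesis by (simp add: lam_def mult_ac)
qed

text \<open>The fixed point is sought for the quotient of the solution by the weight
  \<open>w\<close>, so that the plain sup norm becomes the weighted one and the integral operator
  halves distances. Continuity of \<open>f\<close> is assumed along continuous curves, which is what
  makes the integrands continuous.\<close>

lemma picard:
  fixes f :: "real \<Rightarrow> 'b::banach \<Rightarrow> 'b"
  assumes ab: "a \<le> b" and K: "K \<ge> 0"
    and cont: "\<And>x. continuous_on {a..b} x \<Longrightarrow> continuous_on {a..b} (\<lambda>t. f t (x t))"
    and lip: "\<And>t x y. a \<le> t \<Longrightarrow> t \<le> b \<Longrightarrow> norm (f t x - f t y) \<le> K * norm (x - y)"
  obtains x where "continuous_on {a..b} x"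
    "\<And>t. a \<le> t \<Longrightarrow> t \<le> b \<Longrightarrow> x t = x0 + integral {a..t} (\<lambda>s. f s (x s))"
proof -
  define w where "w t = exp ((2 * K + 1) * (t - a))" for t
  \<comment> \<open>Elements of the type of bounded continuous functions live on all of
    \<open>real\<close>. Clamping the argument to \<open>{a..b}\<close> continues a function by its
    boundary values, without increasing its sup norm.\<close>
  define c where "c t = max a (min b t)" for t
  have c: "a \<le> c t" "c t \<le> b" "continuous_on UNIV c" for t
    using ab by (auto simp: c_def intro!: continuous_intros)
  have c_id: "c t = t" if "a \<le> t" "t \<le> b" for t using that by (simp add: c_def)
  have w: "w t > 0" "continuous_on S w" for t S by (auto simp: w_def intro!: continuous_intros)
  define J where "J \<xi> t = x0 + integral {a..t} (\<lambda>s. f s (w s *\<^sub>R apply_bcontfun \<xi> s))" for \<xi> t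
  have xc: "continuous_on S (apply_bcontfun \<xi>)" for \<xi> :: "real \<Rightarrow>\<^sub>C 'b" and S
    using apply_bcontfun[of \<xi>] by (auto simp: bcontfun_def intro: continuous_on_subset)
  have fc: "continuous_on {a..b} (\<lambda>s. f s (w s *\<^sub>R apply_bcontfun \<xi> s))" for \<xi>
    by (intro cont continuous_intros w xc)
  have fi: "(\<lambda>s. f s (w s *\<^sub>R apply_bcontfun \<xi> s)) integrable_on {a..t}" if "t \<le> b" for \<xi> t
    using fc[of \<xi>] that by (intro integrable_continuous_real) (auto elim: continuous_on_subset)
  have Jc: "continuous_on {a..b} (J \<xi>)" for \<xi>
    unfolding J_def[abs_def] using fi[of b \<xi>]
    by (intro continuous_intros indefinite_integral_continuous_1) auto
  define \<Phi> where "\<Phi> \<xi> t = (1 / w (c t)) *\<^sub>R J \<xi> (c t)" for \<xi> t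
  have bc: "\<Phi> \<xi> \<in> bcontfun" for \<xi>
  proof -
    have g: "continuous_on {a..b} (\<lambda>t. (1 / w t) *\<^sub>R J \<xi> t)"
      by (intro continuous_intros w Jc) (metis less_irrefl w(1))
    have "continuous_on UNIV (\<lambda>t. (1 / w (c t)) *\<^sub>R J \<xi> (c t))"
      by (rule continuous_on_compose2[OF g c(3)]) (use c in auto)
    moreover have "bounded (range (\<lambda>t. (1 / w (c t)) *\<^sub>R J \<xi> (c t)))"
      by (rule bounded_subset[OF compact_imp_bounded[OF compact_continuous_image[OF g compact_Icc]]])
        (use c in auto)
    ultimately show ?thesis unfolding \<Phi>_def[abs_def] bcontfun_def by simp
  qed
  define T where "T \<xi> = Bcontfun (\<Phi> \<xi>)" for \<xi>
  have T: "apply_bcontfun (T \<xi>) t = \<Phi> \<xi> t" for \<xi> t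
    unfolding T_def by (simp add: Bcontfun_inverse[OF bc])
  have "dist (T \<xi>) (T \<eta>) \<le> (1 / 2) * dist \<xi> \<eta>" for \<xi> \<eta>
  proof (rule dist_bound)
    fix t
    let ?t = "c t"
    have "\<Phi> \<xi> t - \<Phi> \<eta> t = (1 / w ?t) *\<^sub>R integral {a..?t} (\<lambda>s. f s (w s *\<^sub>R apply_bcontfun \<xi> s) - f s (w s *\<^sub>R apply_bcontfun \<eta> s))"
      using fi[OF c(2)] by (simp add: \<Phi>_def J_def integral_diff scaleR_diff_right scaleR_add_right)
    moreover have "norm (integral {a..?t} (\<lambda>s. f s (w s *\<^sub>R apply_bcontfun \<xi> s) - f s (w s *\<^sub>R apply_bcontfun \<eta> s)))
        \<le> w ?t * (dist \<xi> \<eta> / 2)"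
    proof (rule weighted_integral_bound[OF c(1) K, folded w_def])
      fix s assume s: "a \<le> s" "s \<le> ?t"
      have "norm (f s (w s *\<^sub>R apply_bcontfun \<xi> s) - f s (w s *\<^sub>R apply_bcontfun \<eta> s))
          \<le> K * norm (w s *\<^sub>R apply_bcontfun \<xi> s - w s *\<^sub>R apply_bcontfun \<eta> s)"
        using s c(2)[of t] by (intro lip) auto
      also have "norm (w s *\<^sub>R apply_bcontfun \<xi> s - w s *\<^sub>R apply_bcontfun \<eta> s)
          = w s * dist (apply_bcontfun \<xi> s) (apply_bcontfun \<eta> s)"
        using w(1)[of s] by (simp add: scaleR_diff_right[symmetric] dist_norm)
      also have "K * \<dots> \<le> K * (w s * dist \<xi> \<eta>)"
        using K w(1)[of s] by (intro mult_left_mono dist_bounded) auto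
      finally show "norm (f s (w s *\<^sub>R apply_bcontfun \<xi> s) - f s (w s *\<^sub>R apply_bcontfun \<eta> s))
          \<le> K * (w s * dist \<xi> \<eta>)" .
    qed (use fi c in \<open>auto intro: integrable_diff\<close>)
    ultimately show "dist (apply_bcontfun (T \<xi>) t) (apply_bcontfun (T \<eta>) t) \<le> (1 / 2) * dist \<xi> \<eta>"
      using w(1)[of ?t] by (simp add: T dist_norm divide_simps mult.commute)
  qed
  then obtain \<xi> where \<xi>: "T \<xi> = \<xi>"
    using banach_fix_type[of "1/2" T] by auto
  show thesis
  proof (rule that[of "\<lambda>t. w t *\<^sub>R apply_bcontfun \<xi> t"])
    show "continuous_on {a..b} (\<lambda>t. w t *\<^sub>R apply_bcontfun \<xi> t)"
      by (intro continuous_intros w xc)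
    fix t assume t: "a \<le> t" "t \<le> b"
    have "w t *\<^sub>R apply_bcontfun \<xi> t = w t *\<^sub>R apply_bcontfun (T \<xi>) t" by (simp add: \<xi>)
    also have "\<dots> = J \<xi> t" using w(1)[of t] by (simp only: T) (simp add: \<Phi>_def c_id t)
    finally show "w t *\<^sub>R apply_bcontfun \<xi> t = x0 + integral {a..t} (\<lambda>s. f s (w s *\<^sub>R apply_bcontfun \<xi> s))"
      by (simp add: J_def)
  qed
qed

text \<open>Let \<open>m\<close> be the maximum of \<open>e t / w t\<close>, attained at
  \<open>t0\<close>. The hypothesis at \<open>t0\<close> and the weighted bound give
  \<open>w t0 * m \<le> C + w t0 * m / 2\<close>. Absorbing the last term is the origin of the
  factor 2, and \<open>w t0 \<ge> 1\<close> then gives \<open>m \<le> 2 * C\<close>.\<close>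

lemma gronwall:
  fixes e :: "real \<Rightarrow> real"
  assumes ab: "a \<le> b" and K: "K \<ge> 0" and e: "continuous_on {a..b} e" and nn: "\<And>t. a \<le> t \<Longrightarrow> t \<le> b \<Longrightarrow> 0 \<le> e t"
    and le: "\<And>t. a \<le> t \<Longrightarrow> t \<le> b \<Longrightarrow> e t \<le> C + integral {a..t} (\<lambda>s. K * e s)"
    and t: "a \<le> t" "t \<le> b"
  shows "e t \<le> 2 * C * exp ((2 * K + 1) * (b - a))"
proof -
  define w where "w t = exp ((2 * K + 1) * (t - a))" for t
  have w: "w t > 0" "continuous_on S w" for t S by (auto simp: w_def intro!: continuous_intros)
  have w1: "w t \<ge> 1" "w t \<le> w b" if "a \<le> t" "t \<le> b" for t
    using that K by (auto simp: w_def intro!: mult_left_mono)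
  have "continuous_on {a..b} (\<lambda>t. e t / w t)"
    by (intro continuous_intros e w) (metis less_irrefl w(1))
  then obtain t0 where t0: "a \<le> t0" "t0 \<le> b" and max: "\<And>t. a \<le> t \<Longrightarrow> t \<le> b \<Longrightarrow> e t / w t \<le> e t0 / w t0"
    using continuous_attains_sup[of "{a..b}" "\<lambda>t. e t / w t"] ab by auto
  define m where "m = e t0 / w t0"
  have m: "m \<ge> 0" using nn[OF t0] w(1)[of t0] by (simp add: m_def)
  have em: "e t \<le> w t * m" if "a \<le> t" "t \<le> b" for t
    using max[OF that] w(1)[of t] by (simp add: m_def pos_divide_le_eq mult.commute)
  have "norm (integral {a..t0} (\<lambda>s. K * e s)) \<le> w t0 * (m / 2)"
    unfolding w_def
  proof (rule weighted_integral_bound[OF t0(1) K m])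
    show "(\<lambda>s. K * e s) integrable_on {a..t0}"
      using t0 by (intro integrable_continuous_real continuous_intros continuous_on_subset[OF e]) auto
    fix s assume "a \<le> s" "s \<le> t0"
    then show "norm (K * e s) \<le> K * (exp ((2 * K + 1) * (s - a)) * m)"
      using em[of s] nn[of s] t0 K by (auto simp: w_def intro!: mult_left_mono)
  qed
  then have "e t0 \<le> C + w t0 * (m / 2)" using le[OF t0] by simp
  moreover have "e t0 = w t0 * m" using w(1)[of t0] by (simp add: m_def)
  ultimately have "w t0 * m \<le> 2 * C" by (simp add: field_simps)
  moreover have "1 * m \<le> w t0 * m" using w1(1)[OF t0] m by (rule mult_right_mono)
  ultimately have m2: "m \<le> 2 * C" by simp
  have "e t \<le> w t * m" by (rule em[OF t])
  also have "\<dots> \<le> w b * (2 * C)"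
    using w1[OF t] m2 m by (intro mult_mono) auto
  finally show ?thesis by (simp add: w_def mult_ac)
qed

section \<open>The space L2\<close>

lemma L2_measurable: "f \<in> L2 a b \<Longrightarrow> f \<in> borel_measurable (lebesgue_on {a..b})"
  by (simp add: L2_def)

lemma integrable_const_lebesgue_on:
  fixes a b c :: real
  shows "integrable (lebesgue_on {a..b}) (\<lambda>_. c)"
  unfolding integrable_lebesgue_on_iff_absolutely by (rule absolutely_integrable_on_const) simp

lemma integral_const_lebesgue_on:
  fixes a b c :: real
  assumes "a \<le> b"
  shows "(LINT x|lebesgue_on {a..b}. c) = (b - a) * c"
proof -
  have "(LINT x|lebesgue_on {a..b}. c) = integral {a..b} (\<lambda>_. c)"
    by (rule lebesgue_integral_eq_integral[OF integrable_const_lebesgue_on]) simp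
  then show ?thesis using assms by simp
qed

lemma L2_mult_integrable:
  assumes "f \<in> L2 a b" "g \<in> L2 a b"
  shows "integrable (lebesgue_on {a..b}) (\<lambda>x. f x * g x)"
proof (rule Bochner_Integration.integrable_bound)
  show "integrable (lebesgue_on {a..b}) (\<lambda>x. (norm (f x))\<^sup>2 + (norm (g x))\<^sup>2)"
    using assms by (simp add: L2_def)
  show "(\<lambda>x. f x * g x) \<in> borel_measurable (lebesgue_on {a..b})"
    by (intro borel_measurable_times L2_measurable assms)
  have "norm (f x * g x) \<le> (norm (f x))\<^sup>2 + (norm (g x))\<^sup>2" for x
    using sum_squares_bound[of "norm (f x)" "norm (g x)"] mult_nonneg_nonneg[OF norm_ge_zero[of "f x"] norm_ge_zero[of "g x"]]
    unfolding norm_mult by linarith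
  then show "AE x in lebesgue_on {a..b}. norm (f x * g x) \<le> norm ((norm (f x))\<^sup>2 + (norm (g x))\<^sup>2)"
    by (intro AE_I2) simp
qed

lemma L2_square_integrable:
  "f \<in> L2 a b \<Longrightarrow> integrable (lebesgue_on {a..b}) (\<lambda>x. (f x)\<^sup>2)"
  using L2_mult_integrable[of f a b f] by (simp add: power2_eq_square)

lemma L2_continuous:
  assumes "continuous_on {a..b} f"
  shows "f \<in> L2 a b"
  unfolding L2_def
proof (intro CollectI conjI)
  show "f \<in> borel_measurable (lebesgue_on {a..b})"
    using assms by (rule continuous_on_borel_measurable_lebesgue_on)
  have "integrable (lebesgue_on {a..b}) (\<lambda>x. f x * cnj (f x))"
    using assms by (intro integrable_continuous_lebesgue_on continuous_intros)
  from integrable_norm[OF this]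
  show "integrable (lebesgue_on {a..b}) (\<lambda>x. (norm (f x))\<^sup>2)"
    by (simp add: norm_mult power2_eq_square)
qed

lemma L2_integrable:
  assumes "f \<in> L2 a b"
  shows "integrable (lebesgue_on {a..b}) f"
  using L2_mult_integrable[OF assms L2_continuous[of a b "\<lambda>_. 1"]] by simp

lemma L2_cmult: "f \<in> L2 a b \<Longrightarrow> (\<lambda>x. c * f x) \<in> L2 a b"
  by (auto simp: L2_def norm_mult power_mult_distrib intro!: borel_measurable_times)

lemma L2_add:
  assumes "f \<in> L2 a b" "g \<in> L2 a b"
  shows "(\<lambda>x. f x + g x) \<in> L2 a b"
  unfolding L2_def
proof (intro CollectI conjI)
  show [measurable]: "(\<lambda>x. f x + g x) \<in> borel_measurable (lebesgue_on {a..b})"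
    by (intro borel_measurable_add L2_measurable assms)
  show "integrable (lebesgue_on {a..b}) (\<lambda>x. (norm (f x + g x))\<^sup>2)"
  proof (rule Bochner_Integration.integrable_bound)
    show "integrable (lebesgue_on {a..b}) (\<lambda>x. 2 * (norm (f x))\<^sup>2 + 2 * (norm (g x))\<^sup>2)"
      using assms by (simp add: L2_def)
    have "(norm (f x + g x))\<^sup>2 \<le> 2 * (norm (f x))\<^sup>2 + 2 * (norm (g x))\<^sup>2" for x
    proof -
      have "(norm (f x + g x))\<^sup>2 \<le> (norm (f x) + norm (g x))\<^sup>2"
        by (intro power_mono norm_triangle_ineq) auto
      also have "\<dots> \<le> 2 * (norm (f x))\<^sup>2 + 2 * (norm (g x))\<^sup>2"
        using sum_squares_bound[of "norm (f x)" "norm (g x)"] by (simp add: power2_sum)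
      finally show ?thesis .
    qed
    then show "AE x in lebesgue_on {a..b}. norm ((norm (f x + g x))\<^sup>2) \<le> norm (2 * (norm (f x))\<^sup>2 + 2 * (norm (g x))\<^sup>2)"
      by (intro AE_I2) simp
  qed simp
qed

lemma norm_L2_square: "(norm_L2 a b f)\<^sup>2 = (LINT x|lebesgue_on {a..b}. (norm (f x))\<^sup>2)"
  by (simp add: norm_L2_def)

lemma norm_L2_nonneg: "0 \<le> norm_L2 a b f"
  by (simp add: norm_L2_def)

text \<open>The Cauchy-Schwarz inequality against the constant 1, read off from the nonnegative
  integral of \<open>(norm (f x) - m)\<^sup>2\<close> with \<open>m\<close> the mean of
  \<open>norm (f x)\<close>.\<close>

lemma L1_le_L2:
  assumes ab: "a < b" and f: "f \<in> L2 a b"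
  shows "(LINT x|lebesgue_on {a..b}. norm (f x)) \<le> sqrt (b - a) * norm_L2 a b f"
proof -
  let ?M = "lebesgue_on {a..b}"
  define I where "I = (LINT x|?M. norm (f x))"
  define m where "m = I / (b - a)"
  have i1: "integrable ?M (\<lambda>x. norm (f x))" using L2_integrable[OF f] by simp
  have i2: "integrable ?M (\<lambda>x. (norm (f x))\<^sup>2)" using f by (simp add: L2_def)
  have "0 \<le> (LINT x|?M. (norm (f x) - m)\<^sup>2)" by simp
  also have "(LINT x|?M. (norm (f x) - m)\<^sup>2) = (LINT x|?M. (norm (f x))\<^sup>2 + m\<^sup>2 - 2 * m * norm (f x))"
    by (simp add: power2_diff mult_ac)
  also have "\<dots> = (LINT x|?M. (norm (f x))\<^sup>2) + (b - a) * m\<^sup>2 - 2 * m * I"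
    using i1 i2 ab integrable_const_lebesgue_on[of a b "m\<^sup>2"] integral_const_lebesgue_on[of a b "m\<^sup>2"]
    by (simp add: I_def del: lebesgue_integral_const)
  also have "\<dots> = (norm_L2 a b f)\<^sup>2 - I\<^sup>2 / (b - a)"
  proof -
    have "L * (I / L)\<^sup>2 - 2 * (I / L) * I = - (I\<^sup>2 / L)" if "L > 0" for L
      using that by (simp add: power2_eq_square)
    from this[of "b - a"] show ?thesis using ab by (simp add: norm_L2_square m_def)
  qed
  finally have "I\<^sup>2 \<le> (b - a) * (norm_L2 a b f)\<^sup>2"
    using ab by (simp add: field_simps)
  also have "\<dots> = (sqrt (b - a) * norm_L2 a b f)\<^sup>2"
    using ab by (simp add: power_mult_distrib)
  finally show ?thesis
    unfolding I_def by (rule power2_le_imp_le) (use ab in \<open>simp add: norm_L2_nonneg\<close>)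
qed

text \<open>The integral of a non-integrable function is 0, so the estimate applies directly to
  functions known only through an almost everywhere bound, such as differences of chosen resolvent
  values.\<close>

lemma norm_L2_le_bound:
  assumes ab: "a < b" and M: "M \<ge> 0" and le: "AE x in lebesgue_on {a..b}. norm (f x) \<le> M"
  shows "norm_L2 a b f \<le> sqrt (b - a) * M"
proof -
  have "(LINT x|lebesgue_on {a..b}. (norm (f x))\<^sup>2) \<le> (LINT x|lebesgue_on {a..b}. M\<^sup>2)"
    by (rule integral_mono_AE') (use le integrable_const_lebesgue_on in \<open>auto elim!: eventually_mono intro: power_mono\<close>)
  also have "\<dots> = (b - a) * M\<^sup>2"
    using ab by (intro integral_const_lebesgue_on) simp
  finally have "(norm_L2 a b f)\<^sup>2 \<le> (sqrt (b - a) * M)\<^sup>2"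
    using ab by (simp add: norm_L2_square power_mult_distrib)
  then show ?thesis by (rule power2_le_imp_le) (use ab M in simp)
qed

section \<open>The first-order system and its reduced form\<close>

definition sl_system ::
  "real \<Rightarrow> real \<Rightarrow> (real \<Rightarrow> complex) \<Rightarrow> complex \<Rightarrow> (real \<Rightarrow> complex) \<Rightarrow> (real \<Rightarrow> complex) \<Rightarrow> (real \<Rightarrow> complex) \<Rightarrow> bool"
  where "sl_system a b q \<mu> f z u \<longleftrightarrow>
     ac_deriv a b z (\<lambda>x. q x * z x + u x) \<and>
     ac_deriv a b u (\<lambda>x. - q x * u x - (q x)\<^sup>2 * z x - \<mu> * z x - f x)"

text \<open>Here \<open>X\<close> is the pair (zeta, theta). With p = e^(-2Q) (M zeta + theta) the
  system reads zeta' = p, theta' = - M p: the term M' zeta in the derivative of M zeta + theta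
  accounts for the coefficient q^2 + mu, and only the continuous \<open>Q\<close> and
  \<open>M\<close> remain.\<close>

definition reduced_rhs :: "(real \<Rightarrow> complex) \<Rightarrow> (real \<Rightarrow> complex) \<Rightarrow> real \<Rightarrow> complex \<times> complex \<Rightarrow> complex \<times> complex" where
  "reduced_rhs Q M t X =
     (exp (- 2 * Q t) * (M t * fst X + snd X), - exp (- 2 * Q t) * M t * (M t * fst X + snd X))"

text \<open>An integral equation, because \<open>picard\<close> produces solutions in this form and
  \<open>gronwall\<close> compares them in it.\<close>

definition reduced_solution ::
  "real \<Rightarrow> real \<Rightarrow> (real \<Rightarrow> complex) \<Rightarrow> (real \<Rightarrow> complex) \<Rightarrow> complex \<times> complex \<Rightarrow> (real \<Rightarrow> complex \<times> complex) \<Rightarrow> bool" where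
  "reduced_solution a b Q M X0 X \<longleftrightarrow> continuous_on {a..b} X \<and>
     (\<forall>t\<in>{a..b}. X t = X0 + integral {a..t} (\<lambda>s. reduced_rhs Q M s (X s)))"

lemma reduced_rhs_diff: "reduced_rhs Q M t X - reduced_rhs Q M t Y = reduced_rhs Q M t (X - Y)"
  by (simp add: reduced_rhs_def algebra_simps)

text \<open>One factor \<open>1 + B\<close> comes from the inner combination of the components of
  \<open>X\<close>, the other from adding the two components of the result. Since the right-hand
  side is linear in \<open>X\<close>, this is also its Lipschitz constant.\<close>

lemma reduced_rhs_bound:
  assumes "norm (Q t) \<le> B" "norm (M t) \<le> B"
  shows "norm (reduced_rhs Q M t X) \<le> exp (2 * B) * (1 + B)\<^sup>2 * norm X"
proof -
  have B: "B \<ge> 0" using assms(1) norm_ge_zero order_trans by blast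
  have e: "norm (exp (- 2 * Q t)) \<le> exp (2 * B)"
    using abs_Re_le_cmod[of "Q t"] assms(1) by (simp add: norm_exp_eq_Re)
  have "norm (M t * fst X + snd X) \<le> B * norm X + norm X"
    by (intro order_trans[OF norm_triangle_ineq] add_mono)
      (use assms(2) B norm_fst_le[of "fst X" "snd X"] norm_snd_le[of "snd X" "fst X"] in \<open>auto simp: norm_mult intro!: mult_mono\<close>)
  then have c: "norm (M t * fst X + snd X) \<le> (1 + B) * norm X" by (simp add: algebra_simps)
  have "norm (reduced_rhs Q M t X) \<le> norm (exp (- 2 * Q t) * (M t * fst X + snd X))
      + norm (- exp (- 2 * Q t) * M t * (M t * fst X + snd X))"
    unfolding reduced_rhs_def by (rule norm_Pair_le)
  also have "\<dots> \<le> exp (2 * B) * ((1 + B) * norm X) + exp (2 * B) * B * ((1 + B) * norm X)"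
    unfolding norm_mult norm_minus_cancel
    by (intro add_mono mult_mono e c assms(2)) (use B in auto)
  also have "\<dots> = exp (2 * B) * (1 + B)\<^sup>2 * norm X" by (simp add: algebra_simps power2_eq_square)
  finally show ?thesis .
qed

lemma reduced_rhs_continuous:
  assumes "continuous_on S Q" "continuous_on S M" "continuous_on S X"
  shows "continuous_on S (\<lambda>t. reduced_rhs Q M t (X t))"
  unfolding reduced_rhs_def by (intro continuous_intros assms)

lemma bounded_on_interval:
  fixes Q :: "real \<Rightarrow> 'a::real_normed_vector"
  assumes "continuous_on {a..b} Q"
  obtains B where "B > 0" "\<And>t. a \<le> t \<Longrightarrow> t \<le> b \<Longrightarrow> norm (Q t) \<le> B"
proof -
  have "bounded (Q ` {a..b})"
    using assms by (auto intro!: compact_imp_bounded compact_continuous_image)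
  then show thesis using that by (auto simp: bounded_pos)
qed

lemma reduced_solution_exists:
  assumes ab: "a \<le> b" and Q: "continuous_on {a..b} Q" and M: "continuous_on {a..b} M"
  shows "\<exists>X. reduced_solution a b Q M X0 X"
proof -
  obtain B1 where B1: "B1 > 0" "\<And>t. a \<le> t \<Longrightarrow> t \<le> b \<Longrightarrow> norm (Q t) \<le> B1" using bounded_on_interval[OF Q] by blast
  obtain B2 where B2: "B2 > 0" "\<And>t. a \<le> t \<Longrightarrow> t \<le> b \<Longrightarrow> norm (M t) \<le> B2" using bounded_on_interval[OF M] by blast
  define B where "B = max B1 B2"
  have B: "norm (Q t) \<le> B" "norm (M t) \<le> B" if "a \<le> t" "t \<le> b" for t
    using B1(2)[OF that] B2(2)[OF that] by (auto simp: B_def)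
  obtain X where "continuous_on {a..b} X"
    "\<And>t. a \<le> t \<Longrightarrow> t \<le> b \<Longrightarrow> X t = X0 + integral {a..t} (\<lambda>s. reduced_rhs Q M s (X s))"
  proof (rule picard[OF ab, of "exp (2 * B) * (1 + B)\<^sup>2" "reduced_rhs Q M" X0])
    fix t and X Y :: "complex \<times> complex"
    assume "a \<le> t" "t \<le> b"
    then show "norm (reduced_rhs Q M t X - reduced_rhs Q M t Y) \<le> exp (2 * B) * (1 + B)\<^sup>2 * norm (X - Y)"
      unfolding reduced_rhs_diff by (intro reduced_rhs_bound B)
  qed (auto intro: reduced_rhs_continuous Q M)
  then show ?thesis unfolding reduced_solution_def by auto
qed

text \<open>Eventually \<open>Q i\<close> stays within distance 1 of the bounded \<open>Q0\<close>,
  hence in one compact disc, where the exponential is uniformly continuous.\<close>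

lemma uniform_limit_exp:
  fixes Q :: "'i \<Rightarrow> real \<Rightarrow> complex"
  assumes u: "uniform_limit {a..b} Q Q0 F" and Q0: "continuous_on {a..b} Q0"
  shows "uniform_limit {a..b} (\<lambda>i t. exp (c * Q i t)) (\<lambda>t. exp (c * Q0 t)) F"
proof -
  obtain B where B: "B > 0" "\<And>t. a \<le> t \<Longrightarrow> t \<le> b \<Longrightarrow> norm (Q0 t) \<le> B" using bounded_on_interval[OF Q0] by blast
  show ?thesis
  proof (rule uniform_limit_compose_uniformly_continuous_on[where f = "\<lambda>w. exp (c * w)" and B = "cball 0 (B + 1)"])
    show "uniformly_continuous_on (cball 0 (B + 1)) (\<lambda>w. exp (c * w))"
      by (intro compact_uniformly_continuous continuous_intros) auto
    show "uniform_limit {a..b} Q Q0 F" by (rule u)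
    show "\<forall>\<^sub>F i in F. \<forall>t\<in>{a..b}. Q i t \<in> cball 0 (B + 1)"
      using uniform_limitD[OF u zero_less_one]
    proof eventually_elim
      case (elim i)
      show ?case
      proof
        fix t assume t: "t \<in> {a..b}"
        then have "dist (Q i t) (Q0 t) < 1" using elim by simp
        then show "Q i t \<in> cball 0 (B + 1)"
          using B(2)[of t] t norm_triangle_sub[of "Q i t" "Q0 t"] by (simp add: dist_norm)
      qed
    qed
  qed auto
qed

lemma uniform_limit_Pair:
  assumes "uniform_limit S f l F" "uniform_limit S g m F"
  shows "uniform_limit S (\<lambda>i x. (f i x, g i x)) (\<lambda>x. (l x, m x)) F"
proof (rule uniform_limitI)
  fix e :: real assume "e > 0"
  then have e: "e / 2 > 0" by simp
  show "\<forall>\<^sub>F i in F. \<forall>x\<in>S. dist (f i x, g i x) (l x, m x) < e"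
    using uniform_limitD[OF assms(1) e] uniform_limitD[OF assms(2) e]
  proof eventually_elim
    case (elim i)
    show ?case
    proof
      fix x assume x: "x \<in> S"
      have "dist (f i x, g i x) (l x, m x) \<le> dist (f i x) (l x) + dist (g i x) (m x)"
        unfolding dist_Pair_Pair by (rule sqrt_sum_squares_le_sum) auto
      also have "\<dots> < e" using elim x by force
      finally show "dist (f i x, g i x) (l x, m x) < e" .
    qed
  qed
qed

text \<open>By linearity the difference of \<open>X i\<close> and \<open>Y\<close> solves the system
  of index \<open>i\<close> up to a defect, the difference of the two right-hand sides along the
  fixed curve \<open>Y\<close>. The defect tends to 0 uniformly, and Gronwall's inequality transfers
  this to the solutions.\<close>

lemma reduced_solution_limit:
  fixes Q M :: "'i \<Rightarrow> real \<Rightarrow> complex"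
  assumes ab: "a \<le> b"
    and cQ: "\<forall>\<^sub>F i in F. continuous_on {a..b} (Q i)" and cM: "\<forall>\<^sub>F i in F. continuous_on {a..b} (M i)"
    and cQ0: "continuous_on {a..b} Q0" and cM0: "continuous_on {a..b} M0"
    and uQ: "uniform_limit {a..b} Q Q0 F" and uM: "uniform_limit {a..b} M M0 F"
    and X: "\<forall>\<^sub>F i in F. reduced_solution a b (Q i) (M i) X0 (X i)"
    and Y: "reduced_solution a b Q0 M0 X0 Y"
  shows "uniform_limit {a..b} X Y F"
proof (rule uniform_limitI)
  fix e :: real assume e: "e > 0"
  obtain B1 where B1: "B1 > 0" "\<And>t. a \<le> t \<Longrightarrow> t \<le> b \<Longrightarrow> norm (Q0 t) \<le> B1" using bounded_on_interval[OF cQ0] by blast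
  obtain B2 where B2: "B2 > 0" "\<And>t. a \<le> t \<Longrightarrow> t \<le> b \<Longrightarrow> norm (M0 t) \<le> B2" using bounded_on_interval[OF cM0] by blast
  \<comment> \<open>The 1 is the uniform distance that \<open>Q i\<close> and \<open>M i\<close>
    eventually keep from their limits, so a single \<open>B\<close>, and with it a single
    \<open>K\<close>, serves all late \<open>i\<close>.\<close>
  define B where "B = max B1 B2 + 1"
  define K where "K = exp (2 * B) * (1 + B)\<^sup>2"
  have K: "K \<ge> 0" by (simp add: K_def)
  \<comment> \<open>Chosen so that the Gronwall bound with \<open>C = \<eta> * (b - a)\<close> stays
    below \<open>e\<close>; \<open>b - a + 1\<close> is positive even if
    \<open>a = b\<close>.\<close>
  define \<eta> where "\<eta> = e / (4 * (b - a + 1) * exp ((2 * K + 1) * (b - a)))"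
  have \<eta>: "\<eta> > 0" using e ab by (simp add: \<eta>_def)
  have cY: "continuous_on {a..b} Y" using Y by (simp add: reduced_solution_def)
  have bnd: "bounded (g ` {a..b})" if "continuous_on {a..b} g" for g :: "real \<Rightarrow> complex"
    using that by (auto intro!: compact_imp_bounded compact_continuous_image)
  have uE: "uniform_limit {a..b} (\<lambda>i t. exp (- 2 * Q i t)) (\<lambda>t. exp (- 2 * Q0 t)) F"
    by (rule uniform_limit_exp[OF uQ cQ0])
  have uD: "uniform_limit {a..b} (\<lambda>i t. reduced_rhs (Q i) (M i) t (Y t)) (\<lambda>t. reduced_rhs Q0 M0 t (Y t)) F"
    unfolding reduced_rhs_def
    by (intro uniform_limit_Pair uniform_lim_mult uniform_limit_add uniform_limit_uminus uniform_limit_const uE uM bnd)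
      (intro continuous_intros cM0 cQ0 cY)+
  show "\<forall>\<^sub>F i in F. \<forall>t\<in>{a..b}. dist (X i t) (Y t) < e"
    using uniform_limitD[OF uD \<eta>] uniform_limitD[OF uQ zero_less_one] uniform_limitD[OF uM zero_less_one] cQ cM X
  proof eventually_elim
    case (elim i)
    have cX: "continuous_on {a..b} (X i)" using elim by (simp add: reduced_solution_def)
    have B: "norm (Q i t) \<le> B" "norm (M i t) \<le> B" if t: "a \<le> t" "t \<le> b" for t
    proof -
      have "dist (Q i t) (Q0 t) < 1" "dist (M i t) (M0 t) < 1" using elim t by auto
      then show "norm (Q i t) \<le> B" "norm (M i t) \<le> B"
        using B1(2)[OF t] B2(2)[OF t] norm_triangle_sub[of "Q i t" "Q0 t"] norm_triangle_sub[of "M i t" "M0 t"]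
        by (auto simp: B_def dist_norm)
    qed
    define d where "d t = norm (X i t - Y t)" for t
    have cd: "continuous_on {a..b} d" unfolding d_def[abs_def] by (intro continuous_intros cX cY)
    have "d t \<le> 2 * (\<eta> * (b - a)) * exp ((2 * K + 1) * (b - a))" if "a \<le> t" "t \<le> b" for t
    proof (rule gronwall[OF ab K cd _ _ that])
      fix t assume t: "a \<le> t" "t \<le> b"
      show "0 \<le> d t" by (simp add: d_def)
      have ci: "(\<lambda>s. reduced_rhs (Q i) (M i) s (X i s)) integrable_on {a..t}"
         "(\<lambda>s. reduced_rhs Q0 M0 s (Y s)) integrable_on {a..t}"
        using t elim cQ0 cM0 cX cY
        by (auto intro!: integrable_continuous_real reduced_rhs_continuous elim: continuous_on_subset)
      have "X i t - Y t = integral {a..t} (\<lambda>s. reduced_rhs (Q i) (M i) s (X i s) - reduced_rhs Q0 M0 s (Y s))"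
        using elim(6) Y t ci by (simp add: reduced_solution_def integral_diff)
      then have "d t \<le> integral {a..t} (\<lambda>s. K * d s + \<eta>)"
        unfolding d_def
      proof (simp only:, intro integral_norm_bound_integral integrable_diff ci)
        show "(\<lambda>s. K * norm (X i s - Y s) + \<eta>) integrable_on {a..t}"
          using t by (intro integrable_continuous_real continuous_intros continuous_on_subset[OF cX] continuous_on_subset[OF cY]) auto
        fix s assume s: "s \<in> {a..t}"
        have "reduced_rhs (Q i) (M i) s (X i s) - reduced_rhs Q0 M0 s (Y s)
            = reduced_rhs (Q i) (M i) s (X i s - Y s) + (reduced_rhs (Q i) (M i) s (Y s) - reduced_rhs Q0 M0 s (Y s))"
          by (simp add: reduced_rhs_diff[symmetric])
        also have "norm \<dots> \<le> K * norm (X i s - Y s) + \<eta>"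
          unfolding K_def
          by (intro order_trans[OF norm_triangle_ineq] add_mono reduced_rhs_bound B)
            (use s t elim(1) in \<open>auto simp: dist_norm less_imp_le\<close>)
        finally show "norm (reduced_rhs (Q i) (M i) s (X i s) - reduced_rhs Q0 M0 s (Y s)) \<le> K * norm (X i s - Y s) + \<eta>" .
      qed
      also have "\<dots> = integral {a..t} (\<lambda>s. K * d s) + \<eta> * (t - a)"
        using t by (subst integral_add)
          (auto intro!: integrable_continuous_real continuous_intros continuous_on_subset[OF cd])
      also have "\<dots> \<le> integral {a..t} (\<lambda>s. K * d s) + \<eta> * (b - a)"
        using t \<eta> by simp
      finally show "d t \<le> \<eta> * (b - a) + integral {a..t} (\<lambda>s. K * d s)" by simp
    qed
    moreover have "2 * (\<eta> * (b - a)) * exp ((2 * K + 1) * (b - a)) < e"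
    proof -
      have "2 * (\<eta> * (b - a)) * exp ((2 * K + 1) * (b - a)) = e * ((b - a) / (2 * (b - a + 1)))"
      proof -
        have "2 * (e / (4 * L * E) * M) * E = e * (M / (2 * L))" if "L > 0" "E > 0" for L E M :: real
          using that by simp
        from this[of "b - a + 1" "exp ((2 * K + 1) * (b - a))" "b - a"] show ?thesis
          using ab by (simp add: \<eta>_def)
      qed
      also have "\<dots> < e * 1"
        using e ab by (intro mult_strict_left_mono) auto
      finally show ?thesis by simp
    qed
    ultimately show ?case by (force simp: d_def dist_norm)
  qed
qed

section \<open>The fundamental matrix\<close>

definition gauge_M :: "real \<Rightarrow> (real \<Rightarrow> complex) \<Rightarrow> complex \<Rightarrow> real \<Rightarrow> complex" where
  "gauge_M a q \<mu> t = - vee a (\<lambda>x. ((q x)\<^sup>2 + \<mu>) * exp (2 * vee a q x)) t"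

lemma continuous_on_vee: "integrable (lebesgue_on {a..b}) f \<Longrightarrow> continuous_on {a..b} (vee a f)"
  by (rule ac_deriv_continuous[OF ac_deriv_vee])

lemma ac_deriv_gauge_M:
  assumes q: "q \<in> L2 a b"
  shows "ac_deriv a b (gauge_M a q \<mu>) (\<lambda>x. - (((q x)\<^sup>2 + \<mu>) * exp (2 * vee a q x)))"
proof -
  have "integrable (lebesgue_on {a..b}) (\<lambda>x. exp (2 * vee a q x) * ((q x)\<^sup>2 + \<mu>))"
    by (intro integrable_continuous_mult continuous_intros continuous_on_vee L2_integrable[OF q]
      Bochner_Integration.integrable_add L2_square_integrable[OF q] integrable_continuous_lebesgue_on)
  then have "ac_deriv a b (vee a (\<lambda>x. ((q x)\<^sup>2 + \<mu>) * exp (2 * vee a q x))) (\<lambda>x. ((q x)\<^sup>2 + \<mu>) * exp (2 * vee a q x))"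
    by (intro ac_deriv_vee) (simp add: mult.commute)
  from ac_deriv_minus[OF this] show ?thesis unfolding gauge_M_def[abs_def] .
qed

text \<open>Only this direction of the gauge transformation is needed: it constructs solutions of
  the homogeneous system, while uniqueness is later obtained from the Wronskian.\<close>

lemma sl_system_of_reduced_solution:
  fixes a b :: real
  assumes ab: "a \<le> b" and q: "q \<in> L2 a b"
    and X: "reduced_solution a b (vee a q) (gauge_M a q \<mu>) X0 X"
  shows "sl_system a b q \<mu> (\<lambda>_. 0) (\<lambda>t. exp (vee a q t) * fst (X t))
           (\<lambda>t. exp (- vee a q t) * (gauge_M a q \<mu> t * fst (X t) + snd (X t)))" (is ?sys)
    and "X a = X0"
proof -
  let ?Q = "vee a q" and ?M = "gauge_M a q \<mu>"
  have dQ: "ac_deriv a b ?Q q" by (rule ac_deriv_vee[OF L2_integrable[OF q]])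
  have dM: "ac_deriv a b ?M (\<lambda>x. - (((q x)\<^sup>2 + \<mu>) * exp (2 * ?Q x)))" by (rule ac_deriv_gauge_M[OF q])
  define p where "p t = exp (- 2 * ?Q t) * (?M t * fst (X t) + snd (X t))" for t
  have cX: "continuous_on {a..b} X" using X by (simp add: reduced_solution_def)
  have cp: "continuous_on {a..b} p"
    unfolding p_def[abs_def]
    by (intro continuous_intros cX ac_deriv_continuous[OF dQ] ac_deriv_continuous[OF dM])
  have cMp: "continuous_on {a..b} (\<lambda>t. - ?M t * p t)"
    by (intro continuous_intros cp ac_deriv_continuous[OF dM])
  have rhs: "reduced_rhs ?Q ?M t (X t) = (p t, - ?M t * p t)" for t
    by (simp add: reduced_rhs_def p_def)
  have Xt: "X t = X0 + integral {a..t} (\<lambda>s. (p s, - ?M s * p s))" if "a \<le> t" "t \<le> b" for t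
    using X that by (simp add: reduced_solution_def rhs)
  have int: "(\<lambda>s. (p s, - ?M s * p s)) integrable_on {a..t}" if "t \<le> b" for t
    by (rule integrable_continuous_real, rule continuous_on_subset[of "{a..b}"])
      (use that in \<open>auto intro!: continuous_intros cp cMp[simplified]\<close>)
  have fstX: "fst X0 + vee a p t = fst (X t)" if "a \<le> t" "t \<le> b" for t
    using Xt[OF that] integral_linear[OF int[OF that(2)] bounded_linear_fst] vee_eq_integral[OF integrable_continuous_lebesgue_on[OF cp] that(2)]
    by (simp add: o_def)
  have sndX: "snd X0 + vee a (\<lambda>t. - ?M t * p t) t = snd (X t)" if "a \<le> t" "t \<le> b" for t
    using Xt[OF that] integral_linear[OF int[OF that(2)] bounded_linear_snd] vee_eq_integral[OF integrable_continuous_lebesgue_on[OF cMp] that(2)]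
    by (simp add: o_def)
  have d1: "ac_deriv a b (\<lambda>t. fst (X t)) p"
    by (rule ac_deriv_cong[where F = "\<lambda>t. fst X0 + vee a p t"])
      (use ac_deriv_add[OF ac_deriv_const ac_deriv_vee[OF integrable_continuous_lebesgue_on[OF cp]]] fstX in auto)
  have d2: "ac_deriv a b (\<lambda>t. snd (X t)) (\<lambda>t. - ?M t * p t)"
    by (rule ac_deriv_cong[where F = "\<lambda>t. snd X0 + vee a (\<lambda>t. - ?M t * p t) t"])
      (use ac_deriv_add[OF ac_deriv_const ac_deriv_vee[OF integrable_continuous_lebesgue_on[OF cMp]]] sndX in auto)
  have e1: "ac_deriv a b (\<lambda>t. exp (?Q t)) (\<lambda>t. q t * exp (?Q t))"
    using ac_deriv_exp[OF dQ, of 1] by simp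
  have e2: "ac_deriv a b (\<lambda>t. exp (- ?Q t)) (\<lambda>t. - q t * exp (- ?Q t))"
    using ac_deriv_exp[OF dQ, of "-1"] by simp
  have e: "exp (?Q t) * exp (- (2 * ?Q t)) = exp (- ?Q t)" "exp (- ?Q t) * exp (2 * ?Q t) = exp (?Q t)" for t
    by (simp_all add: mult_exp_exp)
  have e': "exp (- ?Q t) * (exp (2 * ?Q t) * y) = exp (?Q t) * y" "exp (?Q t) * (exp (- (2 * ?Q t)) * y) = exp (- ?Q t) * y" for t y
    by (simp_all add: e mult.assoc[symmetric])
  show ?sys
    unfolding sl_system_def
  proof
    show "ac_deriv a b (\<lambda>t. exp (?Q t) * fst (X t))
       (\<lambda>x. q x * (exp (?Q x) * fst (X x)) + exp (- ?Q x) * (?M x * fst (X x) + snd (X x)))"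
      by (rule ac_deriv_rhs_cong[OF ac_deriv_mult[OF e1 d1]]) (simp add: p_def e')
    show "ac_deriv a b (\<lambda>t. exp (- ?Q t) * (?M t * fst (X t) + snd (X t)))
       (\<lambda>x. - q x * (exp (- ?Q x) * (?M x * fst (X x) + snd (X x))) - (q x)\<^sup>2 * (exp (?Q x) * fst (X x))
          - \<mu> * (exp (?Q x) * fst (X x)) - 0)"
      by (rule ac_deriv_rhs_cong[OF ac_deriv_mult[OF e2 ac_deriv_add[OF ac_deriv_mult[OF dM d1] d2]]])
        (simp add: e e' algebra_simps)
  qed
  show "X a = X0" using Xt[of a] ab by simp
qed

section \<open>Wronskian and variation of constants\<close>

definition fundamental :: "real \<Rightarrow> real \<Rightarrow> (real \<Rightarrow> complex) \<Rightarrow> complex \<Rightarrow> (real \<Rightarrow> complex^2^2) \<Rightarrow> bool" where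
  "fundamental a b q \<mu> \<Psi> \<longleftrightarrow>
     (\<forall>j. sl_system a b q \<mu> (\<lambda>_. 0) (\<lambda>t. \<Psi> t $ 1 $ j) (\<lambda>t. \<Psi> t $ 2 $ j)) \<and> \<Psi> a = mat 1"

lemma fundamentalD:
  assumes "fundamental a b q \<mu> \<Psi>"
  shows "ac_deriv a b (\<lambda>t. \<Psi> t $ 1 $ j) (\<lambda>x. q x * \<Psi> x $ 1 $ j + \<Psi> x $ 2 $ j)"
    and "ac_deriv a b (\<lambda>t. \<Psi> t $ 2 $ j) (\<lambda>x. - q x * \<Psi> x $ 2 $ j - (q x)\<^sup>2 * \<Psi> x $ 1 $ j - \<mu> * \<Psi> x $ 1 $ j)"
    and "\<Psi> a $ 1 $ 1 = 1" "\<Psi> a $ 1 $ 2 = 0" "\<Psi> a $ 2 $ 1 = 0" "\<Psi> a $ 2 $ 2 = 1"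
    and "continuous_on {a..b} (\<lambda>t. \<Psi> t $ i $ j)"
proof -
  show d1: "ac_deriv a b (\<lambda>t. \<Psi> t $ 1 $ j) (\<lambda>x. q x * \<Psi> x $ 1 $ j + \<Psi> x $ 2 $ j)"
    and d2: "ac_deriv a b (\<lambda>t. \<Psi> t $ 2 $ j) (\<lambda>x. - q x * \<Psi> x $ 2 $ j - (q x)\<^sup>2 * \<Psi> x $ 1 $ j - \<mu> * \<Psi> x $ 1 $ j)"
    using assms unfolding fundamental_def sl_system_def by simp_all
  show "\<Psi> a $ 1 $ 1 = 1" "\<Psi> a $ 1 $ 2 = 0" "\<Psi> a $ 2 $ 1 = 0" "\<Psi> a $ 2 $ 2 = 1"
    using assms by (simp_all add: fundamental_def mat_def)
  show "continuous_on {a..b} (\<lambda>t. \<Psi> t $ i $ j)"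
    using exhaust_2[of i] ac_deriv_continuous[OF d1] ac_deriv_continuous[OF d2] by auto
qed

text \<open>The coefficient matrix has diagonal \<open>q x\<close>, \<open>- q x\<close>, hence
  trace 0, so the determinant keeps its initial value.\<close>

lemma wronskian:
  assumes F: "fundamental a b q \<mu> \<Psi>" and t: "a \<le> t" "t \<le> b"
  shows "\<Psi> t $ 1 $ 1 * \<Psi> t $ 2 $ 2 - \<Psi> t $ 1 $ 2 * \<Psi> t $ 2 $ 1 = 1"
proof -
  have "ac_deriv a b (\<lambda>t. \<Psi> t $ 1 $ 1 * \<Psi> t $ 2 $ 2 - \<Psi> t $ 1 $ 2 * \<Psi> t $ 2 $ 1) (\<lambda>_. 0)"
    by (rule ac_deriv_rhs_cong[OF ac_deriv_diff[OF ac_deriv_mult[OF fundamentalD(1,2)[OF F]] ac_deriv_mult[OF fundamentalD(1,2)[OF F]]]])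
      (simp add: algebra_simps)
  from ac_deriv_zero[OF this t] show ?thesis by (simp add: fundamentalD(3-6)[OF F])
qed

text \<open>Component \<open>i\<close> of \<Psi> (c + the integral of \<Psi>^(-1) g) with g = (0,
  -f). As det \<Psi> = 1, the vector \<Psi>^(-1) g is (\<Psi>_12 f, -\<Psi>_11 f). Index 1 is the
  solution, index 2 its quasi-derivative.\<close>

definition var_z :: "real \<Rightarrow> (real \<Rightarrow> complex^2^2) \<Rightarrow> (real \<Rightarrow> complex) \<Rightarrow> complex \<Rightarrow> complex \<Rightarrow> 2 \<Rightarrow> real \<Rightarrow> complex" where
  "var_z a \<Psi> f c1 c2 i t =
     \<Psi> t $ i $ 1 * (c1 + vee a (\<lambda>x. \<Psi> x $ 1 $ 2 * f x) t) + \<Psi> t $ i $ 2 * (c2 - vee a (\<lambda>x. \<Psi> x $ 1 $ 1 * f x) t)"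

lemma variation_of_constants:
  assumes F: "fundamental a b q \<mu> \<Psi>" and f: "integrable (lebesgue_on {a..b}) f"
  shows "sl_system a b q \<mu> f (var_z a \<Psi> f c1 c2 1) (var_z a \<Psi> f c1 c2 2)" (is ?sys)
    and "var_z a \<Psi> f c1 c2 1 a = c1" "var_z a \<Psi> f c1 c2 2 a = c2"
proof -
  note D = fundamentalD[OF F]
  have v: "ac_deriv a b (vee a (\<lambda>x. \<Psi> x $ 1 $ j * f x)) (\<lambda>x. \<Psi> x $ 1 $ j * f x)" for j
    by (intro ac_deriv_vee integrable_continuous_mult D f)
  have w: "\<Psi> x $ 2 $ 2 * \<Psi> x $ 1 $ 1 = 1 + \<Psi> x $ 2 $ 1 * \<Psi> x $ 1 $ 2" if "a \<le> x" "x \<le> b" for x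
    using wronskian[OF F that] by (simp add: algebra_simps)
  \<comment> \<open>The Wronskian identity multiplied by an arbitrary factor, so that it can act as
    a rewrite rule after \<open>algebra_simps\<close> has multiplied out the terms containing
    \<open>f x\<close>.\<close>
  have w': "g + g * (\<Psi> x $ 1 $ 2 * \<Psi> x $ 2 $ 1) = g * (\<Psi> x $ 1 $ 1 * \<Psi> x $ 2 $ 2)" if "a \<le> x" "x \<le> b" for x g
    using arg_cong[OF w[OF that], of "\<lambda>y. g * y"] by (simp add: algebra_simps)
  show ?sys
    unfolding sl_system_def var_z_def[abs_def]
  proof
    show "ac_deriv a b (\<lambda>t. \<Psi> t $ 1 $ 1 * (c1 + vee a (\<lambda>x. \<Psi> x $ 1 $ 2 * f x) t) + \<Psi> t $ 1 $ 2 * (c2 - vee a (\<lambda>x. \<Psi> x $ 1 $ 1 * f x) t))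
     (\<lambda>x. q x * (\<Psi> x $ 1 $ 1 * (c1 + vee a (\<lambda>x. \<Psi> x $ 1 $ 2 * f x) x) + \<Psi> x $ 1 $ 2 * (c2 - vee a (\<lambda>x. \<Psi> x $ 1 $ 1 * f x) x)) +
          (\<Psi> x $ 2 $ 1 * (c1 + vee a (\<lambda>x. \<Psi> x $ 1 $ 2 * f x) x) + \<Psi> x $ 2 $ 2 * (c2 - vee a (\<lambda>x. \<Psi> x $ 1 $ 1 * f x) x)))"
      by (rule ac_deriv_rhs_cong[OF ac_deriv_add[OF ac_deriv_mult[OF D(1) ac_deriv_add[OF ac_deriv_const v]]
              ac_deriv_mult[OF D(1) ac_deriv_diff[OF ac_deriv_const v]]]])
        (simp add: algebra_simps)
    show "ac_deriv a b (\<lambda>t. \<Psi> t $ 2 $ 1 * (c1 + vee a (\<lambda>x. \<Psi> x $ 1 $ 2 * f x) t) + \<Psi> t $ 2 $ 2 * (c2 - vee a (\<lambda>x. \<Psi> x $ 1 $ 1 * f x) t))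
     (\<lambda>x. - q x * (\<Psi> x $ 2 $ 1 * (c1 + vee a (\<lambda>x. \<Psi> x $ 1 $ 2 * f x) x) + \<Psi> x $ 2 $ 2 * (c2 - vee a (\<lambda>x. \<Psi> x $ 1 $ 1 * f x) x)) -
          (q x)\<^sup>2 * (\<Psi> x $ 1 $ 1 * (c1 + vee a (\<lambda>x. \<Psi> x $ 1 $ 2 * f x) x) + \<Psi> x $ 1 $ 2 * (c2 - vee a (\<lambda>x. \<Psi> x $ 1 $ 1 * f x) x)) -
          \<mu> * (\<Psi> x $ 1 $ 1 * (c1 + vee a (\<lambda>x. \<Psi> x $ 1 $ 2 * f x) x) + \<Psi> x $ 1 $ 2 * (c2 - vee a (\<lambda>x. \<Psi> x $ 1 $ 1 * f x) x)) - f x)"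
      by (rule ac_deriv_rhs_cong[OF ac_deriv_add[OF ac_deriv_mult[OF D(2) ac_deriv_add[OF ac_deriv_const v]]
              ac_deriv_mult[OF D(2) ac_deriv_diff[OF ac_deriv_const v]]]])
        (simp add: algebra_simps w')
  qed
  show "var_z a \<Psi> f c1 c2 1 a = c1" "var_z a \<Psi> f c1 c2 2 a = c2"
    by (simp_all add: var_z_def D)
qed

text \<open>The components of \<Psi>^(-1) (z, u) have derivatives free of \<open>q\<close>, namely
  plus or minus an entry of \<Psi> times \<open>f\<close>. These are integrable, so integration
  recovers the components from their values at \<open>a\<close>.\<close>

lemma sl_system_unique:
  assumes F: "fundamental a b q \<mu> \<Psi>" and f: "integrable (lebesgue_on {a..b}) f"
    and zu: "sl_system a b q \<mu> f z u" and t: "a \<le> t" "t \<le> b"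
  shows "z t = var_z a \<Psi> f (z a) (u a) 1 t" "u t = var_z a \<Psi> f (z a) (u a) 2 t"
proof -
  note D = fundamentalD[OF F]
  have dz: "ac_deriv a b z (\<lambda>x. q x * z x + u x)"
    and du: "ac_deriv a b u (\<lambda>x. - q x * u x - (q x)\<^sup>2 * z x - \<mu> * z x - f x)"
    using zu by (simp_all add: sl_system_def)
  have i: "integrable (lebesgue_on {a..b}) (\<lambda>x. \<Psi> x $ 1 $ j * f x)" for j
    by (intro integrable_continuous_mult D f)
  have k1: "\<Psi> t $ 2 $ 2 * z t - \<Psi> t $ 1 $ 2 * u t = z a + vee a (\<lambda>x. \<Psi> x $ 1 $ 2 * f x) t"
  proof -
    have "ac_deriv a b (\<lambda>t. \<Psi> t $ 2 $ 2 * z t - \<Psi> t $ 1 $ 2 * u t) (\<lambda>x. \<Psi> x $ 1 $ 2 * f x)"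
      by (rule ac_deriv_rhs_cong[OF ac_deriv_diff[OF ac_deriv_mult[OF D(2) dz] ac_deriv_mult[OF D(1) du]]])
        (simp add: algebra_simps)
    from ac_deriv_integral[OF this i t] show ?thesis by (simp add: D)
  qed
  have k2: "\<Psi> t $ 1 $ 1 * u t - \<Psi> t $ 2 $ 1 * z t = u a - vee a (\<lambda>x. \<Psi> x $ 1 $ 1 * f x) t"
  proof -
    have "ac_deriv a b (\<lambda>t. \<Psi> t $ 2 $ 1 * z t - \<Psi> t $ 1 $ 1 * u t) (\<lambda>x. \<Psi> x $ 1 $ 1 * f x)"
      by (rule ac_deriv_rhs_cong[OF ac_deriv_diff[OF ac_deriv_mult[OF D(2) dz] ac_deriv_mult[OF D(1) du]]])
        (simp add: algebra_simps)
    from ac_deriv_integral[OF this i t] show ?thesis by (simp add: D algebra_simps)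
  qed
  have W: "\<Psi> t $ 1 $ 1 * \<Psi> t $ 2 $ 2 - \<Psi> t $ 1 $ 2 * \<Psi> t $ 2 $ 1 = 1" by (rule wronskian[OF F t])
  have "z t = (\<Psi> t $ 1 $ 1 * \<Psi> t $ 2 $ 2 - \<Psi> t $ 1 $ 2 * \<Psi> t $ 2 $ 1) * z t" by (simp add: W)
  also have "\<dots> = \<Psi> t $ 1 $ 1 * (\<Psi> t $ 2 $ 2 * z t - \<Psi> t $ 1 $ 2 * u t) + \<Psi> t $ 1 $ 2 * (\<Psi> t $ 1 $ 1 * u t - \<Psi> t $ 2 $ 1 * z t)"
    by (simp add: algebra_simps)
  finally show "z t = var_z a \<Psi> f (z a) (u a) 1 t" unfolding k1 k2 var_z_def .
  have "u t = (\<Psi> t $ 1 $ 1 * \<Psi> t $ 2 $ 2 - \<Psi> t $ 1 $ 2 * \<Psi> t $ 2 $ 1) * u t" by (simp add: W)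
  also have "\<dots> = \<Psi> t $ 2 $ 1 * (\<Psi> t $ 2 $ 2 * z t - \<Psi> t $ 1 $ 2 * u t) + \<Psi> t $ 2 $ 2 * (\<Psi> t $ 1 $ 1 * u t - \<Psi> t $ 2 $ 1 * z t)"
    by (simp add: algebra_simps)
  finally show "u t = var_z a \<Psi> f (z a) (u a) 2 t" unfolding k1 k2 var_z_def .
qed

section \<open>The resolvent\<close>

text \<open>The defining equations determine the value of the derivative, so each existential
  quantifier collapses to an explicit derivative.\<close>

lemma is_quasi_deriv2_iff:
  "is_quasi_deriv2 a b q z u g \<longleftrightarrow>
     ac_deriv a b z (\<lambda>x. q x * z x + u x) \<and> ac_deriv a b u (\<lambda>x. - q x * u x - (q x)\<^sup>2 * z x - g x)"
proof -
  have 1: "(\<exists>y'. (z has_vector_derivative y') (at x) \<and> u x = y' - q x * z x)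
      \<longleftrightarrow> (z has_vector_derivative q x * z x + u x) (at x)" for x
    by (metis add.commute diff_add_cancel add_diff_cancel_right')
  have 2: "(\<exists>u'. (u has_vector_derivative u') (at x) \<and> g x = - u' - q x * u x - (q x)\<^sup>2 * z x)
      \<longleftrightarrow> (u has_vector_derivative - q x * u x - (q x)\<^sup>2 * z x - g x) (at x)" for x
  proof
    assume "\<exists>u'. (u has_vector_derivative u') (at x) \<and> g x = - u' - q x * u x - (q x)\<^sup>2 * z x"
    then obtain u' where u': "(u has_vector_derivative u') (at x)" "g x = - u' - q x * u x - (q x)\<^sup>2 * z x"
      by blast
    have "u' = - q x * u x - (q x)\<^sup>2 * z x - g x" unfolding u'(2) by simp
    with u'(1) show "(u has_vector_derivative - q x * u x - (q x)\<^sup>2 * z x - g x) (at x)" by simp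
  qed (auto intro!: exI[of _ "- q x * u x - (q x)\<^sup>2 * z x - g x"])
  show ?thesis
    unfolding is_quasi_deriv2_def is_quasi_deriv1_def ac_deriv_def 1 2 by blast
qed

text \<open>Up to a null set the image of \<open>y\<close> under the operator must be
  \<open>f x + \<mu> * y x\<close>, and there \<open>y\<close> may be replaced by \<open>z\<close>;
  so the spectral parameter moves into the differential system.\<close>

lemma solves_SL_op_iff:
  assumes f: "f \<in> L2 a b"
  shows "solves a b (SL_op a b q \<alpha> \<beta>) \<mu> f y \<longleftrightarrow> y \<in> L2 a b \<and>
    (\<exists>z u. ae_eq a b y z \<and> sl_system a b q \<mu> f z u \<and> \<alpha> *v vector [z a, u a] + \<beta> *v vector [z b, u b] = 0)"
proof
  assume "solves a b (SL_op a b q \<alpha> \<beta>) \<mu> f y"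
  then obtain g z u where y: "y \<in> L2 a b" and eq: "ae_eq a b (\<lambda>x. g x - \<mu> * y x) f" and yz: "ae_eq a b y z"
    and zu: "is_quasi_deriv2 a b q z u g" and bc: "\<alpha> *v vector [z a, u a] + \<beta> *v vector [z b, u b] = 0"
    unfolding solves_def SL_op_def by auto
  have "sl_system a b q \<mu> f z u"
    unfolding sl_system_def
  proof
    show "ac_deriv a b z (\<lambda>x. q x * z x + u x)" using zu by (simp add: is_quasi_deriv2_iff)
    show "ac_deriv a b u (\<lambda>x. - q x * u x - (q x)\<^sup>2 * z x - \<mu> * z x - f x)"
    proof (rule ac_deriv_AE_cong)
      show "ac_deriv a b u (\<lambda>x. - q x * u x - (q x)\<^sup>2 * z x - g x)" using zu by (simp add: is_quasi_deriv2_iff)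
      show "AE x in lebesgue_on {a..b}. - q x * u x - (q x)\<^sup>2 * z x - g x = - q x * u x - (q x)\<^sup>2 * z x - \<mu> * z x - f x"
        using eq[unfolded ae_eq_def] yz[unfolded ae_eq_def] by eventually_elim (simp add: algebra_simps)
    qed
  qed
  then show "y \<in> L2 a b \<and>
    (\<exists>z u. ae_eq a b y z \<and> sl_system a b q \<mu> f z u \<and> \<alpha> *v vector [z a, u a] + \<beta> *v vector [z b, u b] = 0)"
    using y yz bc by blast
next
  assume "y \<in> L2 a b \<and>
    (\<exists>z u. ae_eq a b y z \<and> sl_system a b q \<mu> f z u \<and> \<alpha> *v vector [z a, u a] + \<beta> *v vector [z b, u b] = 0)"
  then obtain z u where y: "y \<in> L2 a b" and yz: "ae_eq a b y z" and zu: "sl_system a b q \<mu> f z u"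
    and bc: "\<alpha> *v vector [z a, u a] + \<beta> *v vector [z b, u b] = 0"
    by blast
  define g where "g x = f x + \<mu> * y x" for x
  have g: "g \<in> L2 a b" unfolding g_def[abs_def] by (intro L2_add L2_cmult f y)
  have "is_quasi_deriv2 a b q z u g"
    unfolding is_quasi_deriv2_iff
  proof
    show "ac_deriv a b z (\<lambda>x. q x * z x + u x)" using zu by (simp add: sl_system_def)
    show "ac_deriv a b u (\<lambda>x. - q x * u x - (q x)\<^sup>2 * z x - g x)"
    proof (rule ac_deriv_AE_cong)
      show "ac_deriv a b u (\<lambda>x. - q x * u x - (q x)\<^sup>2 * z x - \<mu> * z x - f x)" using zu by (simp add: sl_system_def)
      show "AE x in lebesgue_on {a..b}. - q x * u x - (q x)\<^sup>2 * z x - \<mu> * z x - f x = - q x * u x - (q x)\<^sup>2 * z x - g x"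
        using yz[unfolded ae_eq_def] by eventually_elim (simp add: g_def)
    qed
  qed
  moreover have "ae_eq a b (\<lambda>x. g x - \<mu> * y x) f" by (simp add: ae_eq_def g_def)
  ultimately show "solves a b (SL_op a b q \<alpha> \<beta>) \<mu> f y"
    unfolding solves_def SL_op_def using y g yz bc by blast
qed

section \<open>Two by two linear algebra\<close>

lemma matrix_vector_2:
  fixes A :: "complex^2^2"
  shows "(A *v v) $ i = A $ i $ 1 * v $ 1 + A $ i $ 2 * v $ 2"
  by (simp add: matrix_vector_mult_def sum_2)

lemma matrix_matrix_2:
  fixes A B :: "complex^2^2"
  shows "(A ** B) $ i $ j = A $ i $ 1 * B $ 1 $ j + A $ i $ 2 * B $ 2 $ j"
  by (simp add: matrix_matrix_mult_def sum_2)

lemma cramer_2: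
  fixes D :: "complex^2^2"
  assumes "det D \<noteq> 0"
  shows "D *v vector [c1, c2] = r \<longleftrightarrow>
    c1 = (D $ 2 $ 2 * r $ 1 - D $ 1 $ 2 * r $ 2) * inverse (det D) \<and>
    c2 = (D $ 1 $ 1 * r $ 2 - D $ 2 $ 1 * r $ 1) * inverse (det D)"
proof -
  have d: "D $ 1 $ 1 * D $ 2 $ 2 - D $ 1 $ 2 * D $ 2 $ 1 = det D" by (simp add: det_2)
  have "D *v vector [c1, c2] = r \<longleftrightarrow> D $ 1 $ 1 * c1 + D $ 1 $ 2 * c2 = r $ 1 \<and> D $ 2 $ 1 * c1 + D $ 2 $ 2 * c2 = r $ 2"
    by (simp add: vec_eq_iff forall_2 matrix_vector_2)
  also have "\<dots> \<longleftrightarrow> det D * c1 = D $ 2 $ 2 * r $ 1 - D $ 1 $ 2 * r $ 2 \<and> det D * c2 = D $ 1 $ 1 * r $ 2 - D $ 2 $ 1 * r $ 1" (is "?A \<longleftrightarrow> ?B")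
  proof
    assume ?A
    then have r: "r $ 1 = D $ 1 $ 1 * c1 + D $ 1 $ 2 * c2" "r $ 2 = D $ 2 $ 1 * c1 + D $ 2 $ 2 * c2" by simp_all
    show ?B unfolding r d[symmetric] by (simp add: algebra_simps)
  next
    assume B: ?B
    have "det D * (D $ 1 $ 1 * c1 + D $ 1 $ 2 * c2) = D $ 1 $ 1 * (det D * c1) + D $ 1 $ 2 * (det D * c2)"
      by (simp add: algebra_simps)
    also have "\<dots> = det D * r $ 1"
      unfolding conjunct1[OF B] conjunct2[OF B] unfolding d[symmetric] by (simp add: algebra_simps)
    finally have 1: "D $ 1 $ 1 * c1 + D $ 1 $ 2 * c2 = r $ 1" using assms by simp
    have "det D * (D $ 2 $ 1 * c1 + D $ 2 $ 2 * c2) = D $ 2 $ 1 * (det D * c1) + D $ 2 $ 2 * (det D * c2)"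
      by (simp add: algebra_simps)
    also have "\<dots> = det D * r $ 2"
      unfolding conjunct1[OF B] conjunct2[OF B] unfolding d[symmetric] by (simp add: algebra_simps)
    finally have 2: "D $ 2 $ 1 * c1 + D $ 2 $ 2 * c2 = r $ 2" using assms by simp
    show ?A using 1 2 by simp
  qed
  also have "\<dots> \<longleftrightarrow> c1 = (D $ 2 $ 2 * r $ 1 - D $ 1 $ 2 * r $ 2) * inverse (det D) \<and>
    c2 = (D $ 1 $ 1 * r $ 2 - D $ 2 $ 1 * r $ 1) * inverse (det D)"
    using assms by (auto simp: field_simps)
  finally show ?thesis .
qed

section \<open>The Green function\<close>

definition green_rhs :: "real \<Rightarrow> real \<Rightarrow> complex^2^2 \<Rightarrow> (real \<Rightarrow> complex^2^2) \<Rightarrow> (real \<Rightarrow> complex) \<Rightarrow> complex^2" where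
  "green_rhs a b \<beta> \<Psi> f =
     - ((\<beta> ** \<Psi> b) *v vector [vee a (\<lambda>x. \<Psi> x $ 1 $ 2 * f x) b, - vee a (\<lambda>x. \<Psi> x $ 1 $ 1 * f x) b])"

text \<open>Cramer's rule for the initial values that meet the boundary conditions. The factor
  \<open>inverse (det D)\<close> in place of a quotient lets limits be taken with rules for sums,
  differences and products alone.\<close>

definition green_const :: "real \<Rightarrow> real \<Rightarrow> complex^2^2 \<Rightarrow> complex^2^2 \<Rightarrow> (real \<Rightarrow> complex^2^2) \<Rightarrow> (real \<Rightarrow> complex) \<Rightarrow> complex \<times> complex" where
  "green_const a b \<alpha> \<beta> \<Psi> f =
     (let D = \<alpha> + \<beta> ** \<Psi> b; r = green_rhs a b \<beta> \<Psi> f in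
       ((D $ 2 $ 2 * r $ 1 - D $ 1 $ 2 * r $ 2) * inverse (det D),
        (D $ 1 $ 1 * r $ 2 - D $ 2 $ 1 * r $ 1) * inverse (det D)))"

definition green :: "real \<Rightarrow> real \<Rightarrow> complex^2^2 \<Rightarrow> complex^2^2 \<Rightarrow> (real \<Rightarrow> complex^2^2) \<Rightarrow> (real \<Rightarrow> complex) \<Rightarrow> real \<Rightarrow> complex" where
  "green a b \<alpha> \<beta> \<Psi> f =
     var_z a \<Psi> f (fst (green_const a b \<alpha> \<beta> \<Psi> f)) (snd (green_const a b \<alpha> \<beta> \<Psi> f)) 1"

text \<open>The values at \<open>b\<close> are \<open>\<Psi> b\<close> applied to c + v, where v
  collects the two integrals over the whole interval. The part with c joins \<open>\<alpha>\<close>,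
  the part with v becomes the right-hand side.\<close>

lemma boundary_condition_iff:
  "\<alpha> *v vector [c1, c2] + \<beta> *v vector [var_z a \<Psi> f c1 c2 1 b, var_z a \<Psi> f c1 c2 2 b] = 0
    \<longleftrightarrow> (\<alpha> + \<beta> ** \<Psi> b) *v vector [c1, c2] = green_rhs a b \<beta> \<Psi> f"
proof -
  have "vector [var_z a \<Psi> f c1 c2 1 b, var_z a \<Psi> f c1 c2 2 b]
      = \<Psi> b *v (vector [c1, c2] + vector [vee a (\<lambda>x. \<Psi> x $ 1 $ 2 * f x) b, - vee a (\<lambda>x. \<Psi> x $ 1 $ 1 * f x) b])"
    by (simp add: vec_eq_iff forall_2 matrix_vector_2 var_z_def)
  then show ?thesis
    unfolding green_rhs_def
    by (simp add: matrix_vector_mult_add_rdistrib matrix_vector_right_distrib matrix_vector_mul_assoc add.assoc eq_neg_iff_add_eq_0)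
qed

text \<open>The open set of interior points where \<open>z\<close> does not vanish is negligible,
  hence empty; continuity adds the end points.\<close>

lemma continuous_AE_zero:
  fixes z :: "real \<Rightarrow> complex"
  assumes ab: "a < b" and z: "continuous_on {a..b} z" and ae: "AE x in lebesgue_on {a..b}. z x = 0"
    and t: "a \<le> t" "t \<le> b"
  shows "z t = 0"
proof -
  define S where "S = {x \<in> {a<..<b}. z x \<noteq> 0}"
  have "open ({a<..<b} \<inter> z -` (- {0}))"
    by (rule continuous_open_preimage) (use z in \<open>auto elim: continuous_on_subset\<close>)
  also have "{a<..<b} \<inter> z -` (- {0}) = S" by (auto simp: S_def)
  finally have "open S" .
  moreover have "negligible S"
    using ae unfolding AE_lebesgue_on_interval_negligible S_def by (rule negligible_subset) auto
  ultimately have "S = {}" using open_not_negligible by blast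
  then have "z x = 0" if "x \<in> {a<..<b}" for x using that by (auto simp: S_def)
  then show ?thesis
    using continuous_constant_on_closure[of "{a<..<b}" z 0 t] z ab t by simp
qed

lemma green_solves:
  assumes ab: "a < b" and F: "fundamental a b q \<mu> \<Psi>" and f: "f \<in> L2 a b"
    and det: "det (\<alpha> + \<beta> ** \<Psi> b) \<noteq> 0"
  shows "solves a b (SL_op a b q \<alpha> \<beta>) \<mu> f (green a b \<alpha> \<beta> \<Psi> f)"
    and "green a b \<alpha> \<beta> \<Psi> f \<in> L2 a b"
    and "solves a b (SL_op a b q \<alpha> \<beta>) \<mu> f y \<Longrightarrow> ae_eq a b y (green a b \<alpha> \<beta> \<Psi> f)"
proof -
  have fi: "integrable (lebesgue_on {a..b}) f" by (rule L2_integrable[OF f])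
  define c1 c2 where "c1 = fst (green_const a b \<alpha> \<beta> \<Psi> f)" and "c2 = snd (green_const a b \<alpha> \<beta> \<Psi> f)"
  note V = variation_of_constants[OF F fi, of c1 c2]
  have bc: "(\<alpha> + \<beta> ** \<Psi> b) *v vector [c1, c2] = green_rhs a b \<beta> \<Psi> f"
    unfolding cramer_2[OF det] by (simp add: c1_def c2_def green_const_def Let_def)
  have g: "green a b \<alpha> \<beta> \<Psi> f = var_z a \<Psi> f c1 c2 1" by (simp add: green_def c1_def c2_def)
  show gL2: "green a b \<alpha> \<beta> \<Psi> f \<in> L2 a b"
    unfolding g using V(1) by (intro L2_continuous ac_deriv_continuous) (auto simp: sl_system_def)
  show "solves a b (SL_op a b q \<alpha> \<beta>) \<mu> f (green a b \<alpha> \<beta> \<Psi> f)"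
    unfolding solves_SL_op_iff[OF f]
  proof (intro conjI gL2 exI)
    show "ae_eq a b (green a b \<alpha> \<beta> \<Psi> f) (green a b \<alpha> \<beta> \<Psi> f)" by (simp add: ae_eq_def)
    show "sl_system a b q \<mu> f (green a b \<alpha> \<beta> \<Psi> f) (var_z a \<Psi> f c1 c2 2)" unfolding g by (rule V)
    show "\<alpha> *v vector [green a b \<alpha> \<beta> \<Psi> f a, var_z a \<Psi> f c1 c2 2 a] +
       \<beta> *v vector [green a b \<alpha> \<beta> \<Psi> f b, var_z a \<Psi> f c1 c2 2 b] = 0"
      unfolding g V(2,3) boundary_condition_iff by (rule bc)
  qed
  assume "solves a b (SL_op a b q \<alpha> \<beta>) \<mu> f y"
  then obtain z u where yz: "ae_eq a b y z" and zu: "sl_system a b q \<mu> f z u"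
    and B: "\<alpha> *v vector [z a, u a] + \<beta> *v vector [z b, u b] = 0"
    unfolding solves_SL_op_iff[OF f] by blast
  \<comment> \<open>Uniqueness: every solution arises by variation of constants from its own initial
    values, and the invertible linear system behind the boundary conditions forces these to be
    \<open>c1\<close> and \<open>c2\<close>.\<close>
  note U = sl_system_unique[OF F fi zu]
  have "\<alpha> *v vector [z a, u a] + \<beta> *v vector [var_z a \<Psi> f (z a) (u a) 1 b, var_z a \<Psi> f (z a) (u a) 2 b] = 0"
    using B U[of b] ab by simp
  then have "z a = c1" "u a = c2"
    unfolding boundary_condition_iff cramer_2[OF det] by (simp_all add: c1_def c2_def green_const_def Let_def)
  then have "z t = green a b \<alpha> \<beta> \<Psi> f t" if "a \<le> t" "t \<le> b" for t
    using U(1)[OF that] by (simp add: g)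
  then have "ae_eq a b z (green a b \<alpha> \<beta> \<Psi> f)"
    unfolding ae_eq_def by (intro AE_I2) simp
  with yz show "ae_eq a b y (green a b \<alpha> \<beta> \<Psi> f)"
    unfolding ae_eq_def by (auto elim: eventually_elim2)
qed

lemma norm_vee_mult_le:
  assumes f: "integrable (lebesgue_on {a..b}) f" and g: "continuous_on {a..b} g"
    and B: "\<And>x. a \<le> x \<Longrightarrow> x \<le> b \<Longrightarrow> norm (g x) \<le> B" and t: "t \<le> b"
  shows "norm (vee a (\<lambda>x. g x * f x) t) \<le> B * (LINT x|lebesgue_on {a..b}. norm (f x))"
proof -
  have i: "integrable (lebesgue_on {a..b}) (\<lambda>x. g x * f x)" by (rule integrable_continuous_mult[OF g f])
  have "norm (vee a (\<lambda>x. g x * f x) t) \<le> (LINT x|lebesgue_on {a..b}. norm (g x * f x))"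
    by (rule norm_vee_le[OF i t])
  also have "\<dots> \<le> (LINT x|lebesgue_on {a..b}. B * norm (f x))"
    by (rule integral_mono) (use integrable_norm[OF i] f B in \<open>auto simp: norm_mult intro!: mult_right_mono\<close>)
  finally show ?thesis by simp
qed

lemma green_bound:
  assumes ab: "a < b" and F: "fundamental a b q \<mu> \<Psi>"
  obtains C where "C \<ge> 0" "\<And>f t. \<lbrakk>f \<in> L2 a b; a \<le> t; t \<le> b\<rbrakk> \<Longrightarrow> norm (green a b \<alpha> \<beta> \<Psi> f t) \<le> C * norm_L2 a b f"
proof -
  note cont = fundamentalD(7)[OF F]
  obtain B1 where B1: "B1 > 0" "\<And>t. a \<le> t \<Longrightarrow> t \<le> b \<Longrightarrow> norm (\<Psi> t $ 1 $ 1) \<le> B1" using bounded_on_interval[OF cont] by blast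
  obtain B2 where B2: "B2 > 0" "\<And>t. a \<le> t \<Longrightarrow> t \<le> b \<Longrightarrow> norm (\<Psi> t $ 1 $ 2) \<le> B2" using bounded_on_interval[OF cont] by blast
  define D E where "D = \<alpha> + \<beta> ** \<Psi> b" and "E = \<beta> ** \<Psi> b"
  \<comment> \<open>Per unit of the L1 norm of \<open>f\<close>, the number \<open>e i\<close>
    bounds entry \<open>i\<close> of \<open>green_rhs\<close>, and \<open>d1\<close>,
    \<open>d2\<close> bound the two constants. The factor \<open>sqrt (b - a)\<close> in
    \<open>C\<close> passes from the L1 to the L2 norm.\<close>
  define e where "e i = norm (E $ i $ 1) * B2 + norm (E $ i $ 2) * B1" for i
  define d1 d2 where "d1 = (norm (D $ 2 $ 2) * e 1 + norm (D $ 1 $ 2) * e 2) * norm (inverse (det D))"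
    and "d2 = (norm (D $ 1 $ 1) * e 2 + norm (D $ 2 $ 1) * e 1) * norm (inverse (det D))"
  define C where "C = (B1 * (d1 + B2) + B2 * (d2 + B1)) * sqrt (b - a)"
  have nn: "e i \<ge> 0" "d1 \<ge> 0" "d2 \<ge> 0" for i using B1 B2 by (auto simp: e_def d1_def d2_def)
  show thesis
  proof (rule that[of C])
    show "C \<ge> 0" using B1(1) B2(1) nn ab by (simp add: C_def)
    fix f t assume f: "f \<in> L2 a b" and t: "a \<le> t" "t \<le> b"
    define I where "I = (LINT x|lebesgue_on {a..b}. norm (f x))"
    have I: "I \<ge> 0" by (simp add: I_def)
    have v1: "norm (vee a (\<lambda>x. \<Psi> x $ 1 $ 1 * f x) t) \<le> B1 * I" if "t \<le> b" for t
      unfolding I_def by (rule norm_vee_mult_le[OF L2_integrable[OF f] cont B1(2) that])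
    have v2: "norm (vee a (\<lambda>x. \<Psi> x $ 1 $ 2 * f x) t) \<le> B2 * I" if "t \<le> b" for t
      unfolding I_def by (rule norm_vee_mult_le[OF L2_integrable[OF f] cont B2(2) that])
    define r where "r = green_rhs a b \<beta> \<Psi> f"
    have r: "norm (r $ i) \<le> e i * I" for i
    proof -
      have "norm (r $ i) = norm (E $ i $ 1 * vee a (\<lambda>x. \<Psi> x $ 1 $ 2 * f x) b - E $ i $ 2 * vee a (\<lambda>x. \<Psi> x $ 1 $ 1 * f x) b)"
        by (simp add: r_def green_rhs_def E_def[symmetric] matrix_vector_2 norm_minus_commute)
      also have "\<dots> \<le> norm (E $ i $ 1) * (B2 * I) + norm (E $ i $ 2) * (B1 * I)"
        by (intro order_trans[OF norm_triangle_ineq4] add_mono) (auto simp: norm_mult v1 v2 intro!: mult_left_mono)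
      finally show ?thesis by (simp add: e_def algebra_simps)
    qed
    have comb: "norm ((x * r $ i - y * r $ j) * w) \<le> (norm x * e i + norm y * e j) * norm w * I" for x y w i j
    proof -
      have "norm (x * r $ i - y * r $ j) \<le> norm x * (e i * I) + norm y * (e j * I)"
        by (intro order_trans[OF norm_triangle_ineq4] add_mono) (auto simp: norm_mult r intro!: mult_left_mono)
      then have "norm (x * r $ i - y * r $ j) * norm w \<le> (norm x * (e i * I) + norm y * (e j * I)) * norm w"
        by (rule mult_right_mono) simp
      also have "(norm x * (e i * I) + norm y * (e j * I)) * norm w = (norm x * e i + norm y * e j) * norm w * I"
        by (simp add: algebra_simps)
      finally show ?thesis by (simp only: norm_mult)
    qed
    define c1 c2 where "c1 = fst (green_const a b \<alpha> \<beta> \<Psi> f)" and "c2 = snd (green_const a b \<alpha> \<beta> \<Psi> f)"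
    have c: "norm c1 \<le> d1 * I" "norm c2 \<le> d2 * I"
      unfolding c1_def c2_def green_const_def Let_def D_def[symmetric] r_def[symmetric] fst_conv snd_conv d1_def d2_def
      by (rule comb)+
    have "norm (green a b \<alpha> \<beta> \<Psi> f t) \<le> B1 * (d1 * I + B2 * I) + B2 * (d2 * I + B1 * I)"
      unfolding green_def var_z_def c1_def[symmetric] c2_def[symmetric]
      by (intro order_trans[OF norm_triangle_ineq] add_mono, unfold norm_mult)
        (intro mult_mono order_trans[OF norm_triangle_ineq] order_trans[OF norm_triangle_ineq4] add_mono c v1 v2 t B1(2) B2(2);
          use B1(1) B2(1) in simp)+
    also have "\<dots> = (B1 * (d1 + B2) + B2 * (d2 + B1)) * I" by (simp add: algebra_simps)
    also have "\<dots> \<le> (B1 * (d1 + B2) + B2 * (d2 + B1)) * (sqrt (b - a) * norm_L2 a b f)"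
      using L1_le_L2[OF ab f] nn B1(1) B2(1) unfolding I_def by (intro mult_left_mono) auto
    finally show "norm (green a b \<alpha> \<beta> \<Psi> f t) \<le> C * norm_L2 a b f" by (simp add: C_def)
  qed
qed

lemma resolvent_setI:
  assumes ab: "a < b" and F: "fundamental a b q \<mu> \<Psi>" and det: "det (\<alpha> + \<beta> ** \<Psi> b) \<noteq> 0"
  shows "\<mu> \<in> resolvent_set a b (SL_op a b q \<alpha> \<beta>)"
  unfolding resolvent_set_def
proof (intro CollectI conjI ballI allI impI)
  note G = green_solves[OF ab F _ det]
  fix f assume f: "f \<in> L2 a b"
  show "\<exists>y. solves a b (SL_op a b q \<alpha> \<beta>) \<mu> f y" using G(1)[OF f] by blast
  fix y1 y2 assume "solves a b (SL_op a b q \<alpha> \<beta>) \<mu> f y1" "solves a b (SL_op a b q \<alpha> \<beta>) \<mu> f y2"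
  from G(3)[OF f this(1)] G(3)[OF f this(2)] show "ae_eq a b y1 y2"
    unfolding ae_eq_def by (auto elim: eventually_elim2)
next
  note G = green_solves[OF ab F _ det]
  obtain C where C: "C \<ge> 0" "\<And>f t. \<lbrakk>f \<in> L2 a b; a \<le> t; t \<le> b\<rbrakk> \<Longrightarrow> norm (green a b \<alpha> \<beta> \<Psi> f t) \<le> C * norm_L2 a b f"
    using green_bound[OF ab F] by blast
  show "\<exists>C. \<forall>f\<in>L2 a b. \<forall>y. solves a b (SL_op a b q \<alpha> \<beta>) \<mu> f y \<longrightarrow> norm_L2 a b y \<le> C * norm_L2 a b f"
  proof (intro exI ballI allI impI)
    fix f y assume f: "f \<in> L2 a b" and y: "solves a b (SL_op a b q \<alpha> \<beta>) \<mu> f y"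
    have "AE x in lebesgue_on {a..b}. norm (y x) \<le> C * norm_L2 a b f"
      using G(3)[OF f y, unfolded ae_eq_def] AE_interior
      by eventually_elim (use C(2)[OF f] in auto)
    then have "norm_L2 a b y \<le> sqrt (b - a) * (C * norm_L2 a b f)"
      by (intro norm_L2_le_bound[OF ab]) (simp_all add: C norm_L2_nonneg)
    then show "norm_L2 a b y \<le> (sqrt (b - a) * C) * norm_L2 a b f" by simp
  qed
qed

text \<open>A kernel vector c of the boundary matrix gives a solution \<open>z\<close> of the
  homogeneous problem. Uniqueness in the resolvent set makes \<open>z\<close> vanish almost
  everywhere, hence everywhere by continuity; the first equation then gives \<open>u = 0\<close>,
  and the initial values c vanish.\<close>

lemma resolvent_setD:
  assumes ab: "a < b" and F: "fundamental a b q \<mu> \<Psi>" and mu: "\<mu> \<in> resolvent_set a b (SL_op a b q \<alpha> \<beta>)"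
  shows "det (\<alpha> + \<beta> ** \<Psi> b) \<noteq> 0"
proof
  let ?D = "\<alpha> + \<beta> ** \<Psi> b"
  let ?T = "SL_op a b q \<alpha> \<beta>"
  have z0: "(\<lambda>_. 0) \<in> L2 a b" by (rule L2_continuous) simp
  assume "det ?D = 0"
  then have "\<not> (\<exists>B. B ** ?D = mat 1)"
    by (simp only: invertible_left_inverse[symmetric] invertible_det_nz)
  then obtain c where c: "c \<noteq> 0" "?D *v c = 0"
    unfolding matrix_left_invertible_ker by blast
  define z u where "z = var_z a \<Psi> (\<lambda>_. 0) (c $ 1) (c $ 2) 1" and "u = var_z a \<Psi> (\<lambda>_. 0) (c $ 1) (c $ 2) 2"
  have cv: "vector [c $ 1, c $ 2] = c" by (simp add: vec_eq_iff forall_2)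
  note V = variation_of_constants[OF F L2_integrable[OF z0], of "c $ 1" "c $ 2", folded z_def u_def]
  have dz: "ac_deriv a b z (\<lambda>x. q x * z x + u x)" and "ac_deriv a b u (\<lambda>x. - q x * u x - (q x)\<^sup>2 * z x - \<mu> * z x - 0)"
    using V(1) by (simp_all add: sl_system_def)
  then have cz: "continuous_on {a..b} z" and cu: "continuous_on {a..b} u" by (auto intro: ac_deriv_continuous)
  have "green_rhs a b \<beta> \<Psi> (\<lambda>_. 0) = 0"
    by (simp add: green_rhs_def vee_def vec_eq_iff forall_2 matrix_vector_2)
  then have "\<alpha> *v vector [z a, u a] + \<beta> *v vector [z b, u b] = 0"
    unfolding V(2,3) unfolding z_def u_def boundary_condition_iff by (simp add: cv c)
  moreover have "ae_eq a b z z" by (simp add: ae_eq_def)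
  ultimately have s1: "solves a b ?T \<mu> (\<lambda>_. 0) z"
    unfolding solves_SL_op_iff[OF z0] using V(1) L2_continuous[OF cz] by blast
  have "sl_system a b q \<mu> (\<lambda>_. 0) (\<lambda>_. 0) (\<lambda>_. 0)"
    using ac_deriv_const[of a b 0] by (simp add: sl_system_def)
  moreover have "\<alpha> *v vector [0, 0] + \<beta> *v vector [0, 0] = 0"
    by (simp add: vec_eq_iff forall_2 matrix_vector_2)
  moreover have "ae_eq a b (\<lambda>_. 0) (\<lambda>_. 0)" by (simp add: ae_eq_def)
  ultimately have s2: "solves a b ?T \<mu> (\<lambda>_. 0) (\<lambda>_. 0)"
    unfolding solves_SL_op_iff[OF z0] using z0 by blast
  have "ae_eq a b z (\<lambda>_. 0)"
    using mu s1 s2 z0 unfolding resolvent_set_def by blast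
  then have z: "z t = 0" if "a \<le> t" "t \<le> b" for t
    using continuous_AE_zero[OF ab cz _ that] by (simp add: ae_eq_def)
  have "AE x in lebesgue_on {a..b}. u x = 0"
    using dz[unfolded ac_deriv_def, THEN conjunct2] AE_interior
  proof eventually_elim
    case (elim x)
    have "(z has_vector_derivative 0) (at x)"
      by (rule has_vector_derivative_transform_within_open[of "\<lambda>_. 0" 0 x "{a<..<b}" z]) (use elim z in auto)
    with elim(1) have "q x * z x + u x = 0" by (rule vector_derivative_unique_at)
    then show "u x = 0" using z[of x] elim(2) by simp
  qed
  then have "u a = 0" by (rule continuous_AE_zero[OF ab cu]) (use ab in auto)
  moreover have "z a = 0" using z ab by simp
  ultimately have "c = 0" using V(2,3) by (simp add: vec_eq_iff forall_2)
  with c show False by simp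
qed

section \<open>Convergence of the gauge transformation\<close>

lemma uniform_limitI_bound:
  fixes g :: "'i \<Rightarrow> 'a \<Rightarrow> 'b::real_normed_vector" and c :: "'i \<Rightarrow> real"
  assumes "\<forall>\<^sub>F i in F. \<forall>x\<in>S. norm (g i x - l x) \<le> c i" "(c \<longlongrightarrow> 0) F"
  shows "uniform_limit S g l F"
proof (rule uniform_limitI)
  fix e :: real assume "e > 0"
  with assms(2) have "\<forall>\<^sub>F i in F. c i < e" by (rule order_tendstoD(2))
  with assms(1) show "\<forall>\<^sub>F i in F. \<forall>x\<in>S. dist (g i x) (l x) < e"
    by eventually_elim (force simp: dist_norm)
qed

lemma norm_le_norm_C:
  assumes "continuous_on {a..b} g" "a \<le> t" "t \<le> b"
  shows "norm (g t) \<le> norm_C a b g"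
  unfolding norm_C_def
proof (rule cSUP_upper)
  obtain B where "\<And>t. a \<le> t \<Longrightarrow> t \<le> b \<Longrightarrow> norm (g t) \<le> B" using bounded_on_interval[OF assms(1)] by blast
  then show "bdd_above ((\<lambda>t. norm (g t)) ` {a..b})" by (auto intro!: bdd_aboveI[of _ B])
qed (use assms in simp)

text \<open>The singularity of the quotient at 0 is removable, which \<open>pole_lemma\<close>
  supplies. The last identity is half the derivative of the one before it, that is, (z h)' =
  e^(2z).\<close>

lemma entire_quotient_exp:
  obtains h :: "complex \<Rightarrow> complex" where "h holomorphic_on UNIV" "\<And>z. 2 * z * h z = exp (2 * z) - 1"
    "\<And>z. h z + z * deriv h z = exp (2 * z)"
proof -
  let ?E = "\<lambda>z::complex. exp (2 * z) / 2"
  define h where "h z = (if z = 0 then deriv ?E 0 else (?E z - ?E 0) / (z - 0))" for z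
  have h: "h holomorphic_on UNIV"
    unfolding h_def[abs_def] by (rule pole_lemma) (auto intro!: holomorphic_intros)
  have eq: "2 * z * h z = exp (2 * z) - 1" for z
    by (cases "z = 0") (simp_all add: h_def diff_divide_distrib right_diff_distrib)
  have "h z + z * deriv h z = exp (2 * z)" for z
  proof -
    have "(h has_field_derivative deriv h z) (at z)"
      using h by (auto intro: holomorphic_derivI)
    then have "((\<lambda>z. 2 * z * h z) has_field_derivative 2 * h z + deriv h z * (2 * z)) (at z)"
      by (auto intro!: derivative_eq_intros)
    then have "((\<lambda>z. exp (2 * z) - 1) has_field_derivative 2 * h z + deriv h z * (2 * z)) (at z)"
      unfolding eq .
    moreover have "((\<lambda>z. exp (2 * z) - 1) has_field_derivative 2 * exp (2 * z)) (at z)"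
      by (auto intro!: derivative_eq_intros)
    ultimately have "2 * h z + deriv h z * (2 * z) = 2 * exp (2 * z)" by (rule DERIV_unique)
    then have "2 * (h z + z * deriv h z) = 2 * exp (2 * z)" by (simp add: algebra_simps)
    then show ?thesis unfolding mult_cancel_left by simp
  qed
  with h eq show thesis by (rule that)
qed

text \<open>With $2 z h(z) = e^{2z} - 1$ the product rule gives
  $s e^{2v} = (w\, h(v))' + (s v - r w)\, h'(v)$ for $v' = r$ and $w' = s$. This is how the commutator
  entry $r w - s v$ controls the oscillating term $s e^{2v}$ although $s$ may be unbounded in $L_1$.\<close>

lemma gauge_M_limit:
  fixes q :: "'i \<Rightarrow> real \<Rightarrow> complex" and q0 :: "real \<Rightarrow> complex"
  assumes ab: "a < b" and q: "\<forall>\<^sub>F i in F. q i \<in> L2 a b" and q0: "q0 \<in> L2 a b"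
    and v: "((\<lambda>i. norm_C a b (vee a (\<lambda>x. q i x - q0 x))) \<longlongrightarrow> 0) F"
    and w: "((\<lambda>i. norm_C a b (vee a (\<lambda>x. (q i x)\<^sup>2 - (q0 x)\<^sup>2))) \<longlongrightarrow> 0) F"
    and J: "((\<lambda>i. LINT x|lebesgue_on {a..b}. norm ((q i x - q0 x) * vee a (\<lambda>x. (q i x)\<^sup>2 - (q0 x)\<^sup>2) x
               - ((q i x)\<^sup>2 - (q0 x)\<^sup>2) * vee a (\<lambda>x. q i x - q0 x) x)) \<longlongrightarrow> 0) F"
  shows "uniform_limit {a..b} (\<lambda>i. gauge_M a (q i) \<mu>) (gauge_M a q0 \<mu>) F"
proof -
  let ?M = "lebesgue_on {a..b}"
  obtain h where h: "h holomorphic_on UNIV" "\<And>z. 2 * z * h z = exp (2 * z) - 1"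
    "\<And>z. h z + z * deriv h z = exp (2 * z)" using entire_quotient_exp by blast
  have hc: "continuous_on S h" "continuous_on S (deriv h)" for S
    using h(1) holomorphic_deriv[OF h(1) open_UNIV]
    by (auto intro: holomorphic_on_imp_continuous_on holomorphic_on_subset)
  have "bounded (h ` cball 0 1 \<union> deriv h ` cball 0 1)"
    by (auto intro!: compact_imp_bounded compact_continuous_image hc)
  then obtain H where H: "H > 0" "\<And>z. norm z \<le> 1 \<Longrightarrow> norm (h z) \<le> H" "\<And>z. norm z \<le> 1 \<Longrightarrow> norm (deriv h z) \<le> H"
    by (auto simp: bounded_pos)
  define E where "E t = exp (2 * vee a q0 t)" for t
  have dQ: "ac_deriv a b (vee a q0) q0" by (rule ac_deriv_vee[OF L2_integrable[OF q0]])
  have dE: "ac_deriv a b E (\<lambda>x. 2 * q0 x * E x)" unfolding E_def[abs_def] by (rule ac_deriv_exp[OF dQ])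
  have cE: "continuous_on {a..b} E" by (rule ac_deriv_continuous[OF dE])
  obtain B where B: "B > 0" "\<And>t. a \<le> t \<Longrightarrow> t \<le> b \<Longrightarrow> norm (E t) \<le> B" using bounded_on_interval[OF cE] by blast
  have p0: "integrable ?M (\<lambda>x. (q0 x)\<^sup>2 + \<mu>)"
    by (intro Bochner_Integration.integrable_add L2_square_integrable[OF q0] integrable_continuous_lebesgue_on continuous_intros)
  define V where "V i = vee a (\<lambda>x. q i x - q0 x)" for i
  define W where "W i = vee a (\<lambda>x. (q i x)\<^sup>2 - (q0 x)\<^sup>2)" for i
  define nv where "nv i = norm_C a b (V i)" for i
  define nw where "nw i = norm_C a b (W i)" for i
  define k where "k i x = (q i x - q0 x) * W i x - ((q i x)\<^sup>2 - (q0 x)\<^sup>2) * V i x" for i x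
  define j where "j i = (LINT x|?M. norm (k i x))" for i
  define I0 where "I0 = (LINT x|?M. norm (q0 x))"
  define I2 where "I2 = (LINT x|?M. norm ((q0 x)\<^sup>2 + \<mu>))"
  have lims: "(nv \<longlongrightarrow> 0) F" "(nw \<longlongrightarrow> 0) F" "(j \<longlongrightarrow> 0) F"
    using v w J by (simp_all add: nv_def[abs_def] nw_def[abs_def] j_def[abs_def] k_def V_def W_def)
  \<comment> \<open>The summands bound, in this order, the boundary term \<open>G\<close> and the
    integrals of \<open>n1\<close>, \<open>n2\<close> and \<open>n3\<close> introduced
    below.\<close>
  define c where "c i = nw i * H * B + (H * B * j i + 2 * nw i * H * B * I0 + 2 * nv i * H * B * I2)" for i
  have "((\<lambda>i. nw i * H * B + (H * B * j i + 2 * nw i * H * B * I0 + 2 * nv i * H * B * I2)) \<longlongrightarrow>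
      0 * H * B + (H * B * 0 + 2 * 0 * H * B * I0 + 2 * 0 * H * B * I2)) F"
    by (intro tendsto_intros lims)
  then have c: "(c \<longlongrightarrow> 0) F" by (simp add: c_def[abs_def])
  show ?thesis
  proof (rule uniform_limitI_bound[OF _ c])
    \<comment> \<open>From here on the values of \<open>V i\<close> lie in the unit disc, where
      \<open>H\<close> bounds \<open>h\<close> and its derivative.\<close>
    have "\<forall>\<^sub>F i in F. nv i < 1" using lims(1) by (rule order_tendstoD(2)) simp
    with q show "\<forall>\<^sub>F i in F. \<forall>t\<in>{a..b}. norm (gauge_M a (q i) \<mu> t - gauge_M a q0 \<mu> t) \<le> c i"
    proof eventually_elim
      case (elim i)
      note qi = elim(1)
      have ri: "integrable ?M (\<lambda>x. q i x - q0 x)"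
        by (intro Bochner_Integration.integrable_diff L2_integrable qi q0)
      have si: "integrable ?M (\<lambda>x. (q i x)\<^sup>2 - (q0 x)\<^sup>2)"
        by (intro Bochner_Integration.integrable_diff L2_square_integrable qi q0)
      have dV: "ac_deriv a b (V i) (\<lambda>x. q i x - q0 x)" unfolding V_def by (rule ac_deriv_vee[OF ri])
      have dW: "ac_deriv a b (W i) (\<lambda>x. (q i x)\<^sup>2 - (q0 x)\<^sup>2)" unfolding W_def by (rule ac_deriv_vee[OF si])
      have cV: "continuous_on {a..b} (V i)" and cW: "continuous_on {a..b} (W i)"
        using dV dW by (auto intro: ac_deriv_continuous)
      have Vb: "norm (V i x) \<le> nv i" and V1: "norm (V i x) \<le> 1" and Wb: "norm (W i x) \<le> nw i"
        if "a \<le> x" "x \<le> b" for x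
        using norm_le_norm_C[OF cV that] norm_le_norm_C[OF cW that] elim(2) by (auto simp: nv_def nw_def)
      have nn: "nv i \<ge> 0" "nw i \<ge> 0"
        using Vb[of a] Wb[of a] ab norm_ge_zero order_trans by (meson less_imp_le order_refl)+
      have chV: "continuous_on {a..b} (\<lambda>x. h (V i x))" "continuous_on {a..b} (\<lambda>x. deriv h (V i x))"
        by (auto intro!: continuous_on_compose2[OF hc(1)[of UNIV] cV] continuous_on_compose2[OF hc(2)[of UNIV] cV])
      \<comment> \<open>The difference \<open>d\<close> of the two integrands is the derivative of
        \<open>G\<close> plus three terms: \<open>n1\<close> carries the commutator entry
        \<open>k i\<close>, \<open>n2\<close> compensates for differentiating the factor
        \<open>E\<close>, and \<open>n3\<close> is the change of the exponential against the fixed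
        coefficient \<open>(q0 x)\<^sup>2 + \<mu>\<close>. Each is a continuous factor times an
        integrable function, and either the factor or the L1 norm tends to 0.\<close>
      define G where "G x = W i x * h (V i x) * E x" for x
      define n1 n2 n3 where "n1 x = - (deriv h (V i x) * E x) * k i x" and "n2 x = - (2 * W i x * h (V i x) * E x) * q0 x"
        and "n3 x = (E x * (exp (2 * V i x) - 1)) * ((q0 x)\<^sup>2 + \<mu>)" for x
      have ki: "integrable ?M (k i)"
      proof -
        have "integrable ?M (\<lambda>x. W i x * (q i x - q0 x) - V i x * ((q i x)\<^sup>2 - (q0 x)\<^sup>2))"
          by (intro Bochner_Integration.integrable_diff integrable_continuous_mult cV cW ri si)
        then show ?thesis by (simp add: k_def[abs_def] mult.commute)
      qed
      have c1: "continuous_on {a..b} (\<lambda>x. - (deriv h (V i x) * E x))"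
        and c2: "continuous_on {a..b} (\<lambda>x. - (2 * W i x * h (V i x) * E x))"
        and c3: "continuous_on {a..b} (\<lambda>x. E x * (exp (2 * V i x) - 1))"
        by (intro continuous_intros chV cE cV cW)+
      have i1: "integrable ?M n1" and i2: "integrable ?M n2" and i3: "integrable ?M n3"
        unfolding n1_def[abs_def] n2_def[abs_def] n3_def[abs_def]
        by (intro integrable_continuous_mult c1 c2 c3 ki L2_integrable[OF q0] p0)+
      define d where "d x = ((q i x)\<^sup>2 + \<mu>) * exp (2 * vee a (q i) x) - ((q0 x)\<^sup>2 + \<mu>) * E x" for x
      have Qi: "vee a (q i) x = vee a q0 x + V i x" if "x \<le> b" for x
        unfolding V_def using vee_diff_fun[OF L2_integrable[OF qi] L2_integrable[OF q0] that] by simp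
      have e1: "integrable ?M (\<lambda>x. ((q i x)\<^sup>2 + \<mu>) * exp (2 * vee a (q i) x))"
      proof -
        have "integrable ?M (\<lambda>x. exp (2 * vee a (q i) x) * ((q i x)\<^sup>2 + \<mu>))"
          by (intro integrable_continuous_mult continuous_intros continuous_on_vee L2_integrable[OF qi]
            Bochner_Integration.integrable_add L2_square_integrable[OF qi] integrable_continuous_lebesgue_on)
        then show ?thesis by (simp add: mult.commute)
      qed
      have e2: "integrable ?M (\<lambda>x. ((q0 x)\<^sup>2 + \<mu>) * E x)"
        using integrable_continuous_mult[OF cE p0] by (simp add: mult.commute)
      have dG: "ac_deriv a b G (\<lambda>x. d x - (n1 x + n2 x + n3 x))"
        unfolding G_def[abs_def]
      proof (rule ac_deriv_rhs_cong[OF ac_deriv_mult[OF ac_deriv_mult[OF dW ac_deriv_compose_entire[OF dV h(1)]] dE]])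
        fix x assume x: "a \<le> x" "x \<le> b"
        have ex: "exp (2 * vee a (q i) x) = E x * (h (V i x) + V i x * deriv h (V i x))"
          unfolding h(3) E_def Qi[OF x(2)] by (simp add: distrib_left exp_add)
        have ex': "exp (2 * V i x) = h (V i x) + V i x * deriv h (V i x)" by (simp only: h(3))
        show "W i x * h (V i x) * (2 * q0 x * E x) + (W i x * ((q i x - q0 x) * deriv h (V i x))
            + ((q i x)\<^sup>2 - (q0 x)\<^sup>2) * h (V i x)) * E x = d x - (n1 x + n2 x + n3 x)"
          unfolding d_def n1_def n2_def n3_def k_def ex ex' by (simp add: algebra_simps)
      qed
      have int_d: "integrable ?M (\<lambda>x. d x - (n1 x + n2 x + n3 x))"
        unfolding d_def[abs_def]
        by (intro Bochner_Integration.integrable_diff Bochner_Integration.integrable_add e1 e2 i1 i2 i3)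
      show ?case
      proof
        fix t assume "t \<in> {a..b}"
        then have t: "a \<le> t" "t \<le> b" by auto
        have "G a = 0" by (simp add: G_def W_def)
        then have "G t = vee a (\<lambda>x. d x - (n1 x + n2 x + n3 x)) t"
          using ac_deriv_integral[OF dG int_d t] by simp
        also have "\<dots> = vee a d t - (vee a n1 t + vee a n2 t + vee a n3 t)"
          unfolding d_def[abs_def]
          by (simp add: vee_diff_fun[OF _ _ t(2)] vee_add[OF _ _ t(2)] e1 e2 i1 i2 i3)
        finally have vd: "vee a d t = G t + (vee a n1 t + vee a n2 t + vee a n3 t)" by simp
        have "gauge_M a (q i) \<mu> t - gauge_M a q0 \<mu> t = - vee a d t"
          unfolding gauge_M_def d_def[abs_def] by (simp add: vee_diff_fun[OF e1 e2 t(2)]) (simp add: E_def)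
        then have "norm (gauge_M a (q i) \<mu> t - gauge_M a q0 \<mu> t) \<le> norm (G t) + (norm (vee a n1 t) + norm (vee a n2 t) + norm (vee a n3 t))"
          unfolding vd by (simp only: norm_minus_cancel) (intro order_trans[OF norm_triangle_ineq] add_mono order_refl)
        also have "\<dots> \<le> c i"
          unfolding c_def
        proof (intro add_mono)
          show "norm (G t) \<le> nw i * H * B"
            unfolding G_def norm_mult
            using Wb[OF t] H(2)[OF V1[OF t]] B(2)[OF t] nn H(1) B(1) by (intro mult_mono mult_nonneg_nonneg) auto
          show "norm (vee a n1 t) \<le> H * B * j i"
            unfolding n1_def[abs_def] j_def
          proof (rule norm_vee_mult_le[OF ki c1 _ t(2)])
            fix x assume x: "a \<le> x" "x \<le> b"
            show "norm (- (deriv h (V i x) * E x)) \<le> H * B"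
              unfolding norm_mult norm_minus_cancel
              using H(3)[OF V1[OF x]] B(2)[OF x] H(1) B(1) by (intro mult_mono) auto
          qed
          show "norm (vee a n2 t) \<le> 2 * nw i * H * B * I0"
            unfolding n2_def[abs_def] I0_def
          proof (rule norm_vee_mult_le[OF L2_integrable[OF q0] c2 _ t(2)])
            fix x assume x: "a \<le> x" "x \<le> b"
            show "norm (- (2 * W i x * h (V i x) * E x)) \<le> 2 * nw i * H * B"
              unfolding norm_mult norm_minus_cancel
              using Wb[OF x] H(2)[OF V1[OF x]] B(2)[OF x] nn H(1) B(1) by (intro mult_mono mult_nonneg_nonneg) auto
          qed
          show "norm (vee a n3 t) \<le> 2 * nv i * H * B * I2"
            unfolding n3_def[abs_def] I2_def
          proof (rule norm_vee_mult_le[OF p0 c3 _ t(2)])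
            fix x assume x: "a \<le> x" "x \<le> b"
            have "norm (E x * (exp (2 * V i x) - 1)) = norm (2 * V i x * h (V i x) * E x)"
              unfolding h(2)[symmetric] by (simp add: norm_mult)
            also have "\<dots> \<le> 2 * nv i * H * B"
              unfolding norm_mult norm_minus_cancel
              using Vb[OF x] H(2)[OF V1[OF x]] B(2)[OF x] nn H(1) B(1) by (intro mult_mono mult_nonneg_nonneg) auto
            finally show "norm (E x * (exp (2 * V i x) - 1)) \<le> 2 * nv i * H * B" .
          qed
        qed
        finally show "norm (gauge_M a (q i) \<mu> t - gauge_M a q0 \<mu> t) \<le> c i" .
      qed
    qed
  qed
qed

section \<open>Convergence of the fundamental matrix and of the resolvent\<close>

text \<open>Both \<open>vee a q\<close> and \<open>gauge_M\<close> vanish at \<open>a\<close>, so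
  the gauge is the identity there and the unit vectors remain the initial values.\<close>

lemma fundamental_of_reduced_solutions:
  assumes ab: "a < b" and q: "q \<in> L2 a b"
    and X: "reduced_solution a b (vee a q) (gauge_M a q \<mu>) (1, 0) X"
    and Y: "reduced_solution a b (vee a q) (gauge_M a q \<mu>) (0, 1) Y"
  shows "fundamental a b q \<mu> (\<lambda>t. vector
     [vector [exp (vee a q t) * fst (X t), exp (vee a q t) * fst (Y t)],
      vector [exp (- vee a q t) * (gauge_M a q \<mu> t * fst (X t) + snd (X t)),
              exp (- vee a q t) * (gauge_M a q \<mu> t * fst (Y t) + snd (Y t))]])" (is "fundamental _ _ _ _ ?\<Psi>")
  unfolding fundamental_def
proof
  note sX = sl_system_of_reduced_solution[OF less_imp_le[OF ab] q X]
  note sY = sl_system_of_reduced_solution[OF less_imp_le[OF ab] q Y]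
  show "\<forall>j. sl_system a b q \<mu> (\<lambda>_. 0) (\<lambda>t. ?\<Psi> t $ 1 $ j) (\<lambda>t. ?\<Psi> t $ 2 $ j)"
    using sX(1) sY(1) by (simp add: forall_2)
  show "?\<Psi> a = mat 1"
    by (simp add: vec_eq_iff forall_2 mat_def sX(2) sY(2) gauge_M_def)
qed

lemma fundamental_limit:
  fixes q :: "'i \<Rightarrow> real \<Rightarrow> complex"
  assumes ab: "a < b" and q: "\<forall>\<^sub>F i in F. q i \<in> L2 a b" and q0: "q0 \<in> L2 a b"
    and uQ: "uniform_limit {a..b} (\<lambda>i. vee a (q i)) (vee a q0) F"
    and uM: "uniform_limit {a..b} (\<lambda>i. gauge_M a (q i) \<mu>) (gauge_M a q0 \<mu>) F"
  obtains \<Psi> \<Psi>0 where "fundamental a b q0 \<mu> \<Psi>0" "\<forall>\<^sub>F i in F. fundamental a b (q i) \<mu> (\<Psi> i)"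
    "\<And>k l. uniform_limit {a..b} (\<lambda>i t. \<Psi> i t $ k $ l) (\<lambda>t. \<Psi>0 t $ k $ l) F"
proof -
  have le: "a \<le> b" using ab by simp
  have cQ: "continuous_on {a..b} (vee a p)" and cM: "continuous_on {a..b} (gauge_M a p \<mu>)" if "p \<in> L2 a b" for p
    using that by (auto intro: continuous_on_vee L2_integrable ac_deriv_continuous[OF ac_deriv_gauge_M])
  \<comment> \<open>One choice depending on the potential \<open>p\<close>, so that the perturbed
    and the limiting matrix are instances of the same function;
    \<open>reduced_solution_limit\<close> holds for any choice.\<close>
  define X where "X x0 p = (SOME X. reduced_solution a b (vee a p) (gauge_M a p \<mu>) x0 X)" for x0 p
  have X: "reduced_solution a b (vee a p) (gauge_M a p \<mu>) x0 (X x0 p)" if "p \<in> L2 a b" for x0 p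
    unfolding X_def by (rule someI_ex[OF reduced_solution_exists[OF le cQ[OF that] cM[OF that]]])
  have uX: "uniform_limit {a..b} (\<lambda>i. X x0 (q i)) (X x0 q0) F" for x0
    by (rule reduced_solution_limit[OF le _ _ cQ[OF q0] cM[OF q0] uQ uM _ X[OF q0]])
      (use q in \<open>auto elim!: eventually_mono intro: cQ cM X\<close>)
  have cX: "continuous_on {a..b} (X x0 q0)" for x0
    using X[OF q0] by (simp add: reduced_solution_def)
  have bnd: "bounded (g ` {a..b})" if "continuous_on {a..b} g" for g :: "real \<Rightarrow> complex"
    using that by (auto intro!: compact_imp_bounded compact_continuous_image)
  note u1 = uniform_limit_exp[OF uQ cQ[OF q0], of 1, simplified]
  note u2 = uniform_limit_exp[OF uQ cQ[OF q0], of "-1", simplified]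
  note uf = bounded_linear.uniform_limit[OF bounded_linear_fst uX]
  note us = bounded_linear.uniform_limit[OF bounded_linear_snd uX]
  define \<Psi> where "\<Psi> p t = (vector
     [vector [exp (vee a p t) * fst (X (1, 0) p t), exp (vee a p t) * fst (X (0, 1) p t)],
      vector [exp (- vee a p t) * (gauge_M a p \<mu> t * fst (X (1, 0) p t) + snd (X (1, 0) p t)),
              exp (- vee a p t) * (gauge_M a p \<mu> t * fst (X (0, 1) p t) + snd (X (0, 1) p t))]] :: complex^2^2)" for p t
  have F: "fundamental a b p \<mu> (\<Psi> p)" if "p \<in> L2 a b" for p
    unfolding \<Psi>_def[abs_def] by (rule fundamental_of_reduced_solutions[OF ab that X[OF that] X[OF that]])
  have z: "uniform_limit {a..b} (\<lambda>i t. exp (vee a (q i) t) * fst (X x0 (q i) t)) (\<lambda>t. exp (vee a q0 t) * fst (X x0 q0 t)) F" for x0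
    by (intro uniform_lim_mult u1 uf bnd) (intro continuous_intros cX cQ[OF q0])+
  have u: "uniform_limit {a..b} (\<lambda>i t. exp (- vee a (q i) t) * (gauge_M a (q i) \<mu> t * fst (X x0 (q i) t) + snd (X x0 (q i) t)))
     (\<lambda>t. exp (- vee a q0 t) * (gauge_M a q0 \<mu> t * fst (X x0 q0 t) + snd (X x0 q0 t))) F" for x0
    by (intro uniform_lim_mult uniform_limit_add u2 uM uf us bnd) (intro continuous_intros cX cQ[OF q0] cM[OF q0])+
  have "uniform_limit {a..b} (\<lambda>i t. \<Psi> (q i) t $ k $ l) (\<lambda>t. \<Psi> q0 t $ k $ l) F" for k l
    using exhaust_2[of k] exhaust_2[of l] by (auto simp: \<Psi>_def z u)
  with F[OF q0] show thesis
    by (intro that[of "\<Psi> q0" "\<lambda>i. \<Psi> (q i)"]) (use q F in \<open>auto elim!: eventually_mono\<close>)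
qed

text \<open>Uniform limits may be multiplied when the limits are bounded. Carrying boundedness along
  gives a notion closed under all operations in the formula for \<open>green\<close>, which can then
  be treated term by term.\<close>

definition bounded_uniform_limit :: "'a set \<Rightarrow> ('i \<Rightarrow> 'a \<Rightarrow> complex) \<Rightarrow> ('a \<Rightarrow> complex) \<Rightarrow> 'i filter \<Rightarrow> bool" where
  "bounded_uniform_limit S f l F \<longleftrightarrow> uniform_limit S f l F \<and> bounded (l ` S)"

lemma bounded_uniform_limit_add:
  assumes "bounded_uniform_limit S f l F" "bounded_uniform_limit S g m F"
  shows "bounded_uniform_limit S (\<lambda>i x. f i x + g i x) (\<lambda>x. l x + m x) F"
  using assms unfolding bounded_uniform_limit_def by (auto intro: uniform_limit_add bounded_plus_comp)

lemma bounded_uniform_limit_diff: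
  assumes "bounded_uniform_limit S f l F" "bounded_uniform_limit S g m F"
  shows "bounded_uniform_limit S (\<lambda>i x. f i x - g i x) (\<lambda>x. l x - m x) F"
  using assms unfolding bounded_uniform_limit_def by (auto intro: uniform_limit_minus bounded_minus_comp)

lemma bounded_uniform_limit_minus:
  assumes "bounded_uniform_limit S f l F"
  shows "bounded_uniform_limit S (\<lambda>i x. - f i x) (\<lambda>x. - l x) F"
  using assms unfolding bounded_uniform_limit_def
  by (auto intro: uniform_limit_uminus simp: bounded_iff)

lemma bounded_uniform_limit_mult:
  assumes "bounded_uniform_limit S f l F" "bounded_uniform_limit S g m F"
  shows "bounded_uniform_limit S (\<lambda>i x. f i x * g i x) (\<lambda>x. l x * m x) F"
proof -
  from assms obtain B C where BC: "\<And>x. x \<in> S \<Longrightarrow> norm (l x) \<le> B" "\<And>x. x \<in> S \<Longrightarrow> norm (m x) \<le> C"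
    unfolding bounded_uniform_limit_def bounded_iff by blast
  have "bounded ((\<lambda>x. l x * m x) ` S)"
    unfolding bounded_iff
  proof (intro exI ballI)
    fix y assume "y \<in> (\<lambda>x. l x * m x) ` S"
    then obtain x where x: "x \<in> S" "y = l x * m x" by blast
    then have "norm y = norm (l x) * norm (m x)" by (simp add: norm_mult)
    also have "\<dots> \<le> B * C"
      using BC[OF x(1)] by (intro mult_mono) (auto intro: order_trans[OF norm_ge_zero])
    finally show "norm y \<le> B * C" .
  qed
  with assms show ?thesis
    unfolding bounded_uniform_limit_def by (auto intro: uniform_lim_mult)
qed

lemma bounded_uniform_limit_const:
  assumes "(c \<longlongrightarrow> d) F"
  shows "bounded_uniform_limit S (\<lambda>i x. c i) (\<lambda>x. d) F"
  unfolding bounded_uniform_limit_def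
proof
  show "uniform_limit S (\<lambda>i x. c i) (\<lambda>x. d) F"
    using assms by (intro uniform_limitI) (auto dest: tendstoD elim: eventually_mono)
  show "bounded ((\<lambda>x. d) ` S)" by (auto simp: bounded_iff)
qed

text \<open>Convergence is uniform in the pair \<open>(f, t)\<close> with \<open>f\<close> in the
  unit ball of L2, because the operator norm takes a supremum over \<open>f\<close>. The data enter
  through integrals against entries of \<Psi>, and the L1 norm of \<open>f\<close> is at most
  \<open>sqrt (b - a)\<close> on the ball.\<close>

lemma green_limit:
  fixes \<alpha> \<beta> :: "'i \<Rightarrow> complex^2^2" and \<Psi> :: "'i \<Rightarrow> real \<Rightarrow> complex^2^2"
  assumes ab: "a < b" and F0: "fundamental a b q0 \<mu> \<Psi>0" and F: "\<forall>\<^sub>F i in F. fundamental a b (q i) \<mu> (\<Psi> i)"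
    and u: "\<And>k l. uniform_limit {a..b} (\<lambda>i t. \<Psi> i t $ k $ l) (\<lambda>t. \<Psi>0 t $ k $ l) F"
    and \<alpha>: "(\<alpha> \<longlongrightarrow> \<alpha>0) F" and \<beta>: "(\<beta> \<longlongrightarrow> \<beta>0) F"
    and det: "det (\<alpha>0 + \<beta>0 ** \<Psi>0 b) \<noteq> 0"
  shows "\<forall>\<^sub>F i in F. det (\<alpha> i + \<beta> i ** \<Psi> i b) \<noteq> 0"
    and "uniform_limit ({f \<in> L2 a b. norm_L2 a b f \<le> 1} \<times> {a..b})
           (\<lambda>i (f, t). green a b (\<alpha> i) (\<beta> i) (\<Psi> i) f t) (\<lambda>(f, t). green a b \<alpha>0 \<beta>0 \<Psi>0 f t) F"
proof -
  let ?S = "{f \<in> L2 a b. norm_L2 a b f \<le> 1} \<times> {a..b}"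
  have lb: "((\<lambda>i. \<Psi> i b $ k $ l) \<longlongrightarrow> \<Psi>0 b $ k $ l) F" for k l
    using tendsto_uniform_limitI[OF u[of k l], of b] ab by simp
  have lE: "((\<lambda>i. (\<beta> i ** \<Psi> i b) $ k $ l) \<longlongrightarrow> (\<beta>0 ** \<Psi>0 b) $ k $ l) F" for k l
    unfolding matrix_matrix_2 by (intro tendsto_intros lb \<beta>)
  have lD: "((\<lambda>i. (\<alpha> i + \<beta> i ** \<Psi> i b) $ k $ l) \<longlongrightarrow> (\<alpha>0 + \<beta>0 ** \<Psi>0 b) $ k $ l) F" for k l
    by (simp, intro tendsto_intros lE \<alpha>)
  have ldet: "((\<lambda>i. det (\<alpha> i + \<beta> i ** \<Psi> i b)) \<longlongrightarrow> det (\<alpha>0 + \<beta>0 ** \<Psi>0 b)) F"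
    unfolding det_2 by (intro tendsto_intros lD)
  show "\<forall>\<^sub>F i in F. det (\<alpha> i + \<beta> i ** \<Psi> i b) \<noteq> 0"
    using tendsto_imp_eventually_ne[OF ldet det] .
  have linv: "((\<lambda>i. inverse (det (\<alpha> i + \<beta> i ** \<Psi> i b))) \<longlongrightarrow> inverse (det (\<alpha>0 + \<beta>0 ** \<Psi>0 b))) F"
    by (intro tendsto_inverse ldet det)
  have I: "(LINT x|lebesgue_on {a..b}. norm (f x)) \<le> sqrt (b - a)" if "f \<in> L2 a b" "norm_L2 a b f \<le> 1" for f
    by (rule order_trans[OF L1_le_L2[OF ab that(1)]]) (use that(2) ab in \<open>simp add: mult_left_le\<close>)
  \<comment> \<open>The map \<open>\<tau>\<close> is used as the identity, for the integrals up to
    \<open>t\<close> in \<open>var_z\<close>, and as the constant \<open>b\<close>, for those in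
    \<open>green_rhs\<close>.\<close>
  have V: "bounded_uniform_limit ?S (\<lambda>i x. vee a (\<lambda>y. \<Psi> i y $ 1 $ j * fst x y) (\<tau> (snd x)))
      (\<lambda>x. vee a (\<lambda>y. \<Psi>0 y $ 1 $ j * fst x y) (\<tau> (snd x))) F" if \<tau>: "\<And>t. t \<le> b \<Longrightarrow> \<tau> t \<le> b" for j and \<tau> :: "real \<Rightarrow> real"
    unfolding bounded_uniform_limit_def
  proof
    note c0 = fundamentalD(7)[OF F0, of 1 j]
    obtain B where B: "B > 0" "\<And>t. a \<le> t \<Longrightarrow> t \<le> b \<Longrightarrow> norm (\<Psi>0 t $ 1 $ j) \<le> B" using bounded_on_interval[OF c0] by blast
    show "bounded ((\<lambda>x. vee a (\<lambda>y. \<Psi>0 y $ 1 $ j * fst x y) (\<tau> (snd x))) ` ?S)"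
      unfolding bounded_iff
    proof (intro exI ballI)
      fix y assume "y \<in> (\<lambda>x. vee a (\<lambda>y. \<Psi>0 y $ 1 $ j * fst x y) (\<tau> (snd x))) ` ?S"
      then obtain f t where ft: "f \<in> L2 a b" "norm_L2 a b f \<le> 1" "t \<le> b" "y = vee a (\<lambda>y. \<Psi>0 y $ 1 $ j * f y) (\<tau> t)" by auto
      have "norm y \<le> B * (LINT x|lebesgue_on {a..b}. norm (f x))"
        unfolding ft(4) by (rule norm_vee_mult_le[OF L2_integrable[OF ft(1)] c0 B(2) \<tau>[OF ft(3)]])
      also have "\<dots> \<le> B * sqrt (b - a)" using I[OF ft(1,2)] B(1) by (intro mult_left_mono) auto
      finally show "norm y \<le> B * sqrt (b - a)" .
    qed
    show "uniform_limit ?S (\<lambda>i x. vee a (\<lambda>y. \<Psi> i y $ 1 $ j * fst x y) (\<tau> (snd x)))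
      (\<lambda>x. vee a (\<lambda>y. \<Psi>0 y $ 1 $ j * fst x y) (\<tau> (snd x))) F"
    proof (rule uniform_limitI)
      fix e :: real assume e: "e > 0"
      define d where "d = e / (2 * sqrt (b - a))"
      have d: "d > 0" using e ab by (simp add: d_def)
      show "\<forall>\<^sub>F i in F. \<forall>x\<in>?S. dist (vee a (\<lambda>y. \<Psi> i y $ 1 $ j * fst x y) (\<tau> (snd x)))
          (vee a (\<lambda>y. \<Psi>0 y $ 1 $ j * fst x y) (\<tau> (snd x))) < e"
        using F uniform_limitD[OF u[of 1 j] d]
      proof eventually_elim
        case (elim i)
        note ci = fundamentalD(7)[OF elim(1), of 1 j]
        show ?case
        proof
          fix x assume "x \<in> ?S"
          then obtain f t where ft: "f \<in> L2 a b" "norm_L2 a b f \<le> 1" "t \<le> b" "x = (f, t)" by auto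
          note fi = L2_integrable[OF ft(1)]
          have "vee a (\<lambda>y. \<Psi> i y $ 1 $ j * f y) (\<tau> t) - vee a (\<lambda>y. \<Psi>0 y $ 1 $ j * f y) (\<tau> t)
              = vee a (\<lambda>y. (\<Psi> i y $ 1 $ j - \<Psi>0 y $ 1 $ j) * f y) (\<tau> t)"
            using vee_diff_fun[OF integrable_continuous_mult[OF ci fi] integrable_continuous_mult[OF c0 fi] \<tau>[OF ft(3)]]
            by (simp add: left_diff_distrib)
          also have "norm \<dots> \<le> d * (LINT x|lebesgue_on {a..b}. norm (f x))"
            by (rule norm_vee_mult_le[OF fi continuous_on_diff[OF ci c0] _ \<tau>[OF ft(3)]])
              (use elim(2) in \<open>auto simp: dist_norm less_imp_le\<close>)
          also have "\<dots> \<le> d * sqrt (b - a)" using I[OF ft(1,2)] d by (intro mult_left_mono) auto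
          also have "\<dots> < e" using e ab by (simp add: d_def)
          finally show "dist (vee a (\<lambda>y. \<Psi> i y $ 1 $ j * fst x y) (\<tau> (snd x)))
            (vee a (\<lambda>y. \<Psi>0 y $ 1 $ j * fst x y) (\<tau> (snd x))) < e"
            by (simp add: dist_norm ft(4))
        qed
      qed
    qed
  qed
  have P: "bounded_uniform_limit ?S (\<lambda>i x. \<Psi> i (snd x) $ k $ l) (\<lambda>x. \<Psi>0 (snd x) $ k $ l) F" for k l
    unfolding bounded_uniform_limit_def
  proof
    show "uniform_limit ?S (\<lambda>i x. \<Psi> i (snd x) $ k $ l) (\<lambda>x. \<Psi>0 (snd x) $ k $ l) F"
    proof (rule uniform_limitI)
      fix e :: real assume "e > 0"
      from uniform_limitD[OF u[of k l] this]
      show "\<forall>\<^sub>F i in F. \<forall>x\<in>?S. dist (\<Psi> i (snd x) $ k $ l) (\<Psi>0 (snd x) $ k $ l) < e"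
        by eventually_elim auto
    qed
    obtain B where "\<And>t. a \<le> t \<Longrightarrow> t \<le> b \<Longrightarrow> norm (\<Psi>0 t $ k $ l) \<le> B"
      using bounded_on_interval[OF fundamentalD(7)[OF F0]] by blast
    then show "bounded ((\<lambda>x. \<Psi>0 (snd x) $ k $ l) ` ?S)"
      by (auto simp: bounded_iff intro!: exI[of _ B])
  qed
  note Vt = V[of "\<lambda>t. t", simplified] and Vb = V[of "\<lambda>_. b", simplified]
  have "bounded_uniform_limit ?S (\<lambda>i x. green a b (\<alpha> i) (\<beta> i) (\<Psi> i) (fst x) (snd x)) (\<lambda>x. green a b \<alpha>0 \<beta>0 \<Psi>0 (fst x) (snd x)) F"
    unfolding green_def var_z_def green_const_def green_rhs_def Let_def fst_conv snd_conv
      vector_uminus_component matrix_vector_2 vector_2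
    by (intro bounded_uniform_limit_add bounded_uniform_limit_diff bounded_uniform_limit_minus
        bounded_uniform_limit_mult Vt Vb P bounded_uniform_limit_const[OF lE] bounded_uniform_limit_const[OF lD]
        bounded_uniform_limit_const[OF linv])
  then show "uniform_limit ?S
           (\<lambda>i (f, t). green a b (\<alpha> i) (\<beta> i) (\<Psi> i) f t) (\<lambda>(f, t). green a b \<alpha>0 \<beta>0 \<Psi>0 f t) F"
    by (simp add: bounded_uniform_limit_def case_prod_unfold)
qed

text \<open>The chosen resolvent values agree with \<open>green\<close> only almost everywhere,
  which is enough for an L2 norm; uniform closeness of the Green operators on the unit ball then
  bounds the operator norm.\<close>

lemma norm_resolvent_convergentI:
  assumes ab: "a < b" and F0: "fundamental a b (q 0) \<mu> \<Psi>0" and F: "\<forall>\<^sub>F \<epsilon> in at_right 0. fundamental a b (q \<epsilon>) \<mu> (\<Psi> \<epsilon>)"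
    and u: "\<And>k l. uniform_limit {a..b} (\<lambda>\<epsilon> t. \<Psi> \<epsilon> t $ k $ l) (\<lambda>t. \<Psi>0 t $ k $ l) (at_right 0)"
    and \<alpha>: "(\<alpha> \<longlongrightarrow> \<alpha> 0) (at_right 0)" and \<beta>: "(\<beta> \<longlongrightarrow> \<beta> 0) (at_right 0)"
    and mu: "\<mu> \<in> resolvent_set a b (SL_op a b (q 0) (\<alpha> 0) (\<beta> 0))"
  shows "norm_resolvent_convergent a b (\<lambda>\<epsilon>. SL_op a b (q \<epsilon>) (\<alpha> \<epsilon>) (\<beta> \<epsilon>))"
  unfolding norm_resolvent_convergent_def
proof (intro exI conjI)
  have det0: "det (\<alpha> 0 + \<beta> 0 ** \<Psi>0 b) \<noteq> 0" by (rule resolvent_setD[OF ab F0 mu])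
  note lim = green_limit[OF ab F0 F u \<alpha> \<beta> det0]
  show "\<mu> \<in> resolvent_set a b (SL_op a b (q 0) (\<alpha> 0) (\<beta> 0))" by (rule mu)
  show "\<forall>\<^sub>F \<epsilon> in at_right 0. \<mu> \<in> resolvent_set a b (SL_op a b (q \<epsilon>) (\<alpha> \<epsilon>) (\<beta> \<epsilon>))"
    using F lim(1) by eventually_elim (rule resolvent_setI[OF ab])
  have res: "ae_eq a b (resolvent a b (SL_op a b p A B) \<mu> f) (green a b A B \<Phi> f)"
    if "fundamental a b p \<mu> \<Phi>" "f \<in> L2 a b" "det (A + B ** \<Phi> b) \<noteq> 0" for p A B \<Phi> f
    unfolding resolvent_def
    by (rule green_solves(3)[OF ab that someI[of "solves a b (SL_op a b p A B) \<mu> f", OF green_solves(1)[OF ab that]]])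
  show "((\<lambda>\<epsilon>. opnorm_L2 a b (\<lambda>f x. resolvent a b (SL_op a b (q \<epsilon>) (\<alpha> \<epsilon>) (\<beta> \<epsilon>)) \<mu> f x
      - resolvent a b (SL_op a b (q 0) (\<alpha> 0) (\<beta> 0)) \<mu> f x)) \<longlongrightarrow> 0) (at_right 0)"
  proof (rule order_tendstoI)
    fix e :: ennreal assume "0 < e"
    \<comment> \<open>\<open>e\<close> may be infinite, and a supremum inherits only weak
      inequalities: a finite number strictly between 0 and \<open>e\<close> solves both
      problems.\<close>
    then obtain c :: ennreal where c: "0 < c" "c < e" using dense by blast
    then obtain d where d: "c = ennreal d" "d > 0"
      by (cases c) (auto simp: ennreal_less_zero_iff)
    \<comment> \<open>A pointwise bound by this number means an L2 norm of at most
      \<open>d\<close>.\<close>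
    have d': "d / sqrt (b - a) > 0" using d ab by simp
    show "\<forall>\<^sub>F \<epsilon> in at_right 0. opnorm_L2 a b (\<lambda>f x. resolvent a b (SL_op a b (q \<epsilon>) (\<alpha> \<epsilon>) (\<beta> \<epsilon>)) \<mu> f x
      - resolvent a b (SL_op a b (q 0) (\<alpha> 0) (\<beta> 0)) \<mu> f x) < e"
      using F lim(1) uniform_limitD[OF lim(2) d']
    proof eventually_elim
      case (elim \<epsilon>)
      have "opnorm_L2 a b (\<lambda>f x. resolvent a b (SL_op a b (q \<epsilon>) (\<alpha> \<epsilon>) (\<beta> \<epsilon>)) \<mu> f x
        - resolvent a b (SL_op a b (q 0) (\<alpha> 0) (\<beta> 0)) \<mu> f x) \<le> ennreal d"
        unfolding opnorm_L2_def
      proof (rule SUP_least)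
        fix f assume f: "f \<in> {f \<in> L2 a b. norm_L2 a b f \<le> 1}"
        then have fL: "f \<in> L2 a b" by simp
        have "AE x in lebesgue_on {a..b}. norm (resolvent a b (SL_op a b (q \<epsilon>) (\<alpha> \<epsilon>) (\<beta> \<epsilon>)) \<mu> f x
          - resolvent a b (SL_op a b (q 0) (\<alpha> 0) (\<beta> 0)) \<mu> f x) \<le> d / sqrt (b - a)"
          using res[OF elim(1) fL elim(2), unfolded ae_eq_def] res[OF F0 fL det0, unfolded ae_eq_def] AE_interior
        proof eventually_elim
          fix x assume x: "a < x \<and> x < b" and eq: "resolvent a b (SL_op a b (q \<epsilon>) (\<alpha> \<epsilon>) (\<beta> \<epsilon>)) \<mu> f x = green a b (\<alpha> \<epsilon>) (\<beta> \<epsilon>) (\<Psi> \<epsilon>) f x"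
            "resolvent a b (SL_op a b (q 0) (\<alpha> 0) (\<beta> 0)) \<mu> f x = green a b (\<alpha> 0) (\<beta> 0) \<Psi>0 f x"
          have "(f, x) \<in> {f \<in> L2 a b. norm_L2 a b f \<le> 1} \<times> {a..b}" using f x by simp
          from bspec[OF elim(3) this]
          show "norm (resolvent a b (SL_op a b (q \<epsilon>) (\<alpha> \<epsilon>) (\<beta> \<epsilon>)) \<mu> f x
            - resolvent a b (SL_op a b (q 0) (\<alpha> 0) (\<beta> 0)) \<mu> f x) \<le> d / sqrt (b - a)"
            unfolding eq by (simp add: dist_norm)
        qed
        from norm_L2_le_bound[OF ab less_imp_le[OF d'] this]
        show "ennreal (norm_L2 a b (\<lambda>x. resolvent a b (SL_op a b (q \<epsilon>) (\<alpha> \<epsilon>) (\<beta> \<epsilon>)) \<mu> f x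
          - resolvent a b (SL_op a b (q 0) (\<alpha> 0) (\<beta> 0)) \<mu> f x)) \<le> ennreal d"
          using ab by (intro ennreal_leI) simp
      qed
      also have "\<dots> < e" using c d by simp
      finally show ?case .
    qed
  qed simp
qed

section \<open>Matrix norms and the conditions (I), (II), (III)\<close>

lemma norm_matrix_2:
  fixes M :: "complex^2^2"
  shows "norm M = sqrt ((norm (M $ 1 $ 1))\<^sup>2 + (norm (M $ 1 $ 2))\<^sup>2 + (norm (M $ 2 $ 1))\<^sup>2 + (norm (M $ 2 $ 2))\<^sup>2)"
  by (simp add: norm_vec_def L2_set_def sum_2)

lemma norm_matrix_2_le:
  fixes M :: "complex^2^2"
  shows "norm M \<le> norm (M $ 1 $ 1) + norm (M $ 1 $ 2) + norm (M $ 2 $ 1) + norm (M $ 2 $ 2)"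
proof -
  have "norm M \<le> norm (M $ 1) + norm (M $ 2)"
    by (simp add: norm_vec_def[of M] L2_set_def sum_2 sqrt_sum_squares_le_sum)
  also have "norm (M $ i) \<le> norm (M $ i $ 1) + norm (M $ i $ 2)" for i
    by (simp add: norm_vec_def[of "M $ i"] L2_set_def sum_2 sqrt_sum_squares_le_sum)
  from add_mono[OF this[of 1] this[of 2]]
  have "norm (M $ 1) + norm (M $ 2) \<le> norm (M $ 1 $ 1) + norm (M $ 1 $ 2) + norm (M $ 2 $ 1) + norm (M $ 2 $ 2)"
    by simp
  finally show ?thesis .
qed

lemma norm_matrix_2_entry:
  fixes M :: "complex^2^2"
  shows "norm (M $ i $ j) \<le> norm M"
  by (rule order_trans[OF Finite_Cartesian_Product.norm_nth_le[of "M $ i" j] Finite_Cartesian_Product.norm_nth_le[of M i]])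

lemma integrable_norm_matrix_2:
  fixes M :: "real \<Rightarrow> complex^2^2"
  assumes M: "\<And>i j. integrable (lebesgue_on {a..b}) (\<lambda>x. M x $ i $ j)"
  shows "integrable (lebesgue_on {a..b}) (\<lambda>x. norm (M x))"
proof (rule Bochner_Integration.integrable_bound)
  show "integrable (lebesgue_on {a..b}) (\<lambda>x. norm (M x $ 1 $ 1) + norm (M x $ 1 $ 2) + norm (M x $ 2 $ 1) + norm (M x $ 2 $ 2))"
    by (intro Bochner_Integration.integrable_add integrable_norm M)
  have [measurable]: "(\<lambda>x. M x $ i $ j) \<in> borel_measurable (lebesgue_on {a..b})" for i j
    using M by (rule borel_measurable_integrable)
  show "(\<lambda>x. norm (M x)) \<in> borel_measurable (lebesgue_on {a..b})"
    unfolding norm_matrix_2 by measurable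
  show "AE x in lebesgue_on {a..b}. norm (norm (M x)) \<le> norm (norm (M x $ 1 $ 1) + norm (M x $ 1 $ 2) + norm (M x $ 2 $ 1) + norm (M x $ 2 $ 2))"
    by (intro AE_I2) (use norm_matrix_2_le in auto)
qed

lemma norm_L1_ge_entry:
  assumes M: "\<And>i j. integrable (lebesgue_on {a..b}) (\<lambda>x. M x $ i $ j)"
  shows "(LINT x|lebesgue_on {a..b}. norm (M x $ i $ j)) \<le> norm_L1 a b M"
  unfolding norm_L1_def
  by (rule integral_mono[OF integrable_norm[OF M] integrable_norm_matrix_2[OF M]]) (rule norm_matrix_2_entry)

lemma norm_L1_le_entries:
  assumes M: "\<And>i j. integrable (lebesgue_on {a..b}) (\<lambda>x. M x $ i $ j)"
  shows "norm_L1 a b M \<le> (LINT x|lebesgue_on {a..b}. norm (M x $ 1 $ 1)) + (LINT x|lebesgue_on {a..b}. norm (M x $ 1 $ 2))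
     + (LINT x|lebesgue_on {a..b}. norm (M x $ 2 $ 1)) + (LINT x|lebesgue_on {a..b}. norm (M x $ 2 $ 2))"
proof -
  have "norm_L1 a b M \<le> (LINT x|lebesgue_on {a..b}. norm (M x $ 1 $ 1) + norm (M x $ 1 $ 2) + norm (M x $ 2 $ 1) + norm (M x $ 2 $ 2))"
    unfolding norm_L1_def
    by (rule integral_mono[OF integrable_norm_matrix_2[OF M]])
      (auto intro!: Bochner_Integration.integrable_add integrable_norm M norm_matrix_2_le)
  then show ?thesis by (simp add: M)
qed

lemma R_mat_entries:
  "R_mat q \<epsilon> x $ 1 $ 1 = q \<epsilon> x - q 0 x" "R_mat q \<epsilon> x $ 1 $ 2 = 0"
  "R_mat q \<epsilon> x $ 2 $ 1 = - ((q \<epsilon> x)\<^sup>2 - (q 0 x)\<^sup>2)" "R_mat q \<epsilon> x $ 2 $ 2 = - (q \<epsilon> x - q 0 x)"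
  by (simp_all add: R_mat_def A_mat_def)

lemma vee_zero [simp]: "vee a (\<lambda>_. 0) t = 0"
  by (simp add: vee_def)

lemma mat_vee_R_entries:
  "mat_vee a (R_mat q \<epsilon>) t $ 1 $ 1 = vee a (\<lambda>x. q \<epsilon> x - q 0 x) t" "mat_vee a (R_mat q \<epsilon>) t $ 1 $ 2 = 0"
  "mat_vee a (R_mat q \<epsilon>) t $ 2 $ 1 = - vee a (\<lambda>x. (q \<epsilon> x)\<^sup>2 - (q 0 x)\<^sup>2) t"
  "mat_vee a (R_mat q \<epsilon>) t $ 2 $ 2 = - vee a (\<lambda>x. q \<epsilon> x - q 0 x) t"
  unfolding mat_vee_def vec_lambda_beta R_mat_entries vee_minus by simp_all

context
  fixes a b :: real and q :: "real \<Rightarrow> real \<Rightarrow> complex"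
begin

abbreviation (input) "vr \<epsilon> \<equiv> vee a (\<lambda>x. q \<epsilon> x - q 0 x)"
abbreviation (input) "vs \<epsilon> \<equiv> vee a (\<lambda>x. (q \<epsilon> x)\<^sup>2 - (q 0 x)\<^sup>2)"

definition commutator_entry :: "real \<Rightarrow> real \<Rightarrow> complex" where
  "commutator_entry \<epsilon> x = (q \<epsilon> x - q 0 x) * vs \<epsilon> x - ((q \<epsilon> x)\<^sup>2 - (q 0 x)\<^sup>2) * vr \<epsilon> x"

text \<open>The two orders of multiplication have equal diagonals, because the diagonal entries of
  the product are products of scalars; so the diagonals cancel in (III), while the lower left
  entries have opposite signs and double.\<close>

lemma product_entries:
  "(R_mat q \<epsilon> x ** mat_vee a (R_mat q \<epsilon>) x) $ 1 $ 1 = (q \<epsilon> x - q 0 x) * vr \<epsilon> x"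
  "(R_mat q \<epsilon> x ** mat_vee a (R_mat q \<epsilon>) x) $ 1 $ 2 = 0"
  "(R_mat q \<epsilon> x ** mat_vee a (R_mat q \<epsilon>) x) $ 2 $ 1 = commutator_entry \<epsilon> x"
  "(R_mat q \<epsilon> x ** mat_vee a (R_mat q \<epsilon>) x) $ 2 $ 2 = (q \<epsilon> x - q 0 x) * vr \<epsilon> x"
  "(mat_vee a (R_mat q \<epsilon>) x ** R_mat q \<epsilon> x) $ 1 $ 1 = (q \<epsilon> x - q 0 x) * vr \<epsilon> x"
  "(mat_vee a (R_mat q \<epsilon>) x ** R_mat q \<epsilon> x) $ 1 $ 2 = 0"
  "(mat_vee a (R_mat q \<epsilon>) x ** R_mat q \<epsilon> x) $ 2 $ 1 = - commutator_entry \<epsilon> x"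
  "(mat_vee a (R_mat q \<epsilon>) x ** R_mat q \<epsilon> x) $ 2 $ 2 = (q \<epsilon> x - q 0 x) * vr \<epsilon> x"
  unfolding matrix_matrix_2 R_mat_entries mat_vee_R_entries commutator_entry_def
  by (simp_all add: algebra_simps)

text \<open>Each entry is a combination of integrable functions times continuous ones. Integrability
  must be known before entries can be compared with \<open>norm_L1\<close>, since the integral of a
  non-integrable function is 0.\<close>

lemma product_integrable:
  assumes q: "q \<epsilon> \<in> L2 a b" "q 0 \<in> L2 a b"
  shows "continuous_on {a..b} (vr \<epsilon>)" "continuous_on {a..b} (vs \<epsilon>)"
    and "integrable (lebesgue_on {a..b}) (\<lambda>x. q \<epsilon> x - q 0 x)"
    and "integrable (lebesgue_on {a..b}) (\<lambda>x. (q \<epsilon> x)\<^sup>2 - (q 0 x)\<^sup>2)"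
    and "integrable (lebesgue_on {a..b}) (commutator_entry \<epsilon>)"
    and "integrable (lebesgue_on {a..b}) (\<lambda>x. (R_mat q \<epsilon> x ** mat_vee a (R_mat q \<epsilon>) x) $ i $ j)"
    and "integrable (lebesgue_on {a..b}) (\<lambda>x. (mat_vee a (R_mat q \<epsilon>) x ** R_mat q \<epsilon> x) $ i $ j)"
    and "integrable (lebesgue_on {a..b}) (\<lambda>x. (R_mat q \<epsilon> x ** mat_vee a (R_mat q \<epsilon>) x - mat_vee a (R_mat q \<epsilon>) x ** R_mat q \<epsilon> x) $ i $ j)"
proof -
  show r: "integrable (lebesgue_on {a..b}) (\<lambda>x. q \<epsilon> x - q 0 x)"
    by (intro Bochner_Integration.integrable_diff L2_integrable q)
  show s: "integrable (lebesgue_on {a..b}) (\<lambda>x. (q \<epsilon> x)\<^sup>2 - (q 0 x)\<^sup>2)"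
    by (intro Bochner_Integration.integrable_diff L2_square_integrable q)
  show cr: "continuous_on {a..b} (vr \<epsilon>)" and cs: "continuous_on {a..b} (vs \<epsilon>)"
    by (intro continuous_on_vee r s)+
  have rr: "integrable (lebesgue_on {a..b}) (\<lambda>x. (q \<epsilon> x - q 0 x) * vr \<epsilon> x)"
    using integrable_continuous_mult[OF cr r] by (simp add: mult.commute)
  have "integrable (lebesgue_on {a..b}) (\<lambda>x. vs \<epsilon> x * (q \<epsilon> x - q 0 x) - vr \<epsilon> x * ((q \<epsilon> x)\<^sup>2 - (q 0 x)\<^sup>2))"
    by (intro Bochner_Integration.integrable_diff integrable_continuous_mult cr cs r s)
  then show k: "integrable (lebesgue_on {a..b}) (commutator_entry \<epsilon>)"
    by (simp add: commutator_entry_def[abs_def] mult.commute)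
  show RV: "integrable (lebesgue_on {a..b}) (\<lambda>x. (R_mat q \<epsilon> x ** mat_vee a (R_mat q \<epsilon>) x) $ i $ j)" for i j
    using exhaust_2[of i] exhaust_2[of j] k rr by (auto simp: product_entries)
  show VR: "integrable (lebesgue_on {a..b}) (\<lambda>x. (mat_vee a (R_mat q \<epsilon>) x ** R_mat q \<epsilon> x) $ i $ j)" for i j
    using exhaust_2[of i] exhaust_2[of j] k rr by (auto simp: product_entries)
  show "integrable (lebesgue_on {a..b}) (\<lambda>x. (R_mat q \<epsilon> x ** mat_vee a (R_mat q \<epsilon>) x - mat_vee a (R_mat q \<epsilon>) x ** R_mat q \<epsilon> x) $ i $ j)"
    unfolding vector_minus_component by (intro Bochner_Integration.integrable_diff RV VR)
qed

text \<open>The norm of a matrix dominates each of its entries, and the lower left one is, up to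
  sign or a factor 2, \<open>commutator_entry\<close> in all three conditions.\<close>

lemma commutator_entry_tendsto:
  assumes q: "\<forall>\<^sub>F \<epsilon> in at_right 0. q \<epsilon> \<in> L2 a b" and q0: "q 0 \<in> L2 a b"
    and cond: "cond_I a b q \<or> cond_II a b q \<or> cond_III a b q"
  shows "((\<lambda>\<epsilon>. LINT x|lebesgue_on {a..b}. norm (commutator_entry \<epsilon> x)) \<longlongrightarrow> 0) (at_right 0)"
proof -
  have *: ?thesis if lim: "((\<lambda>\<epsilon>. norm_L1 a b (M \<epsilon>)) \<longlongrightarrow> 0) (at_right 0)"
    and le: "\<And>\<epsilon>. q \<epsilon> \<in> L2 a b \<Longrightarrow> (LINT x|lebesgue_on {a..b}. norm (commutator_entry \<epsilon> x)) \<le> norm_L1 a b (M \<epsilon>)" for M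
  proof (rule Lim_null_comparison[OF _ lim])
    show "\<forall>\<^sub>F \<epsilon> in at_right 0. norm (LINT x|lebesgue_on {a..b}. norm (commutator_entry \<epsilon> x)) \<le> norm_L1 a b (M \<epsilon>)"
      using q by eventually_elim (use le in simp)
  qed
  from cond show ?thesis
  proof (elim disjE)
    assume "cond_I a b q"
    then show ?thesis
      by (rule *[OF cond_I_def[THEN iffD1]])
        (use norm_L1_ge_entry[OF product_integrable(6)[OF _ q0], of _ 2 1] in \<open>simp add: product_entries\<close>)
  next
    assume "cond_II a b q"
    then show ?thesis
      by (rule *[OF cond_II_def[THEN iffD1]])
        (use norm_L1_ge_entry[OF product_integrable(7)[OF _ q0], of _ 2 1] in \<open>simp add: product_entries\<close>)
  next
    assume "cond_III a b q"
    then show ?thesis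
    proof (rule *[OF cond_III_def[THEN iffD1]])
      fix \<epsilon> assume qe: "q \<epsilon> \<in> L2 a b"
      have "2 * (LINT x|lebesgue_on {a..b}. norm (commutator_entry \<epsilon> x))
          = (LINT x|lebesgue_on {a..b}. norm ((R_mat q \<epsilon> x ** mat_vee a (R_mat q \<epsilon>) x - mat_vee a (R_mat q \<epsilon>) x ** R_mat q \<epsilon> x) $ 2 $ 1))"
        unfolding vector_minus_component product_entries by (simp flip: mult_2 add: norm_mult)
      also have "\<dots> \<le> norm_L1 a b (\<lambda>x. R_mat q \<epsilon> x ** mat_vee a (R_mat q \<epsilon>) x - mat_vee a (R_mat q \<epsilon>) x ** R_mat q \<epsilon> x)"
        by (rule norm_L1_ge_entry[OF product_integrable(8)[OF qe q0]])
      finally have "2 * (LINT x|lebesgue_on {a..b}. norm (commutator_entry \<epsilon> x))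
        \<le> norm_L1 a b (\<lambda>x. R_mat q \<epsilon> x ** mat_vee a (R_mat q \<epsilon>) x - mat_vee a (R_mat q \<epsilon>) x ** R_mat q \<epsilon> x)" .
      moreover have "0 \<le> (LINT x|lebesgue_on {a..b}. norm (commutator_entry \<epsilon> x))" by simp
      ultimately show "(LINT x|lebesgue_on {a..b}. norm (commutator_entry \<epsilon> x))
        \<le> norm_L1 a b (\<lambda>x. R_mat q \<epsilon> x ** mat_vee a (R_mat q \<epsilon>) x - mat_vee a (R_mat q \<epsilon>) x ** R_mat q \<epsilon> x)"
        by linarith
    qed
  qed
qed

text \<open>Bounded L2 norms bound both \<open>q \<epsilon> - q 0\<close> and the difference of the
  squares in L1. Every nonzero entry of the products is built from these, multiplied by functions
  whose sup norms tend to 0 by conditions 2) and 3).\<close>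

lemma conditions_of_bounded:
  assumes ab: "a < b" and q: "\<forall>\<^sub>F \<epsilon> in at_right 0. q \<epsilon> \<in> L2 a b" and q0: "q 0 \<in> L2 a b"
    and v: "((\<lambda>\<epsilon>. norm_C a b (vr \<epsilon>)) \<longlongrightarrow> 0) (at_right 0)"
    and w: "((\<lambda>\<epsilon>. norm_C a b (vs \<epsilon>)) \<longlongrightarrow> 0) (at_right 0)"
    and bnd: "(\<lambda>\<epsilon>. norm_L2 a b (q \<epsilon>)) \<in> O[at_right 0](\<lambda>_. 1)"
  shows "cond_I a b q \<and> cond_II a b q \<and> cond_III a b q"
proof -
  let ?M = "lebesgue_on {a..b}"
  obtain C where "\<forall>\<^sub>F \<epsilon> in at_right 0. norm (norm_L2 a b (q \<epsilon>)) \<le> C * norm (1 :: real)"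
    using landau_o.bigE[OF bnd] by blast
  then have C: "\<forall>\<^sub>F \<epsilon> in at_right 0. norm_L2 a b (q \<epsilon>) \<le> C"
    by eventually_elim simp
  define nv nw where "nv \<epsilon> = norm_C a b (vr \<epsilon>)" and "nw \<epsilon> = norm_C a b (vs \<epsilon>)" for \<epsilon>
  \<comment> \<open>\<open>K\<close> bounds the L1 norm of \<open>q \<epsilon> - q 0\<close>,
    through the Cauchy-Schwarz inequality, and \<open>L\<close> below bounds that of the difference
    of squares.\<close>
  define K where "K = sqrt (b - a) * C + sqrt (b - a) * norm_L2 a b (q 0)"
  define L where "L = C\<^sup>2 + (norm_L2 a b (q 0))\<^sup>2"
  have est: "\<forall>\<^sub>F \<epsilon> in at_right 0. q \<epsilon> \<in> L2 a b \<and>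
      (LINT x|?M. norm ((q \<epsilon> x - q 0 x) * vr \<epsilon> x)) \<le> nv \<epsilon> * K \<and>
      (LINT x|?M. norm (commutator_entry \<epsilon> x)) \<le> nw \<epsilon> * K + nv \<epsilon> * L"
    using q C
  proof eventually_elim
    case (elim \<epsilon>)
    note P = product_integrable[OF elim(1) q0]
    have vb: "norm (vr \<epsilon> x) \<le> nv \<epsilon>" "norm (vs \<epsilon> x) \<le> nw \<epsilon>" if "a \<le> x" "x \<le> b" for x
      unfolding nv_def nw_def by (intro norm_le_norm_C P that)+
    have nn: "nv \<epsilon> \<ge> 0" "nw \<epsilon> \<ge> 0"
      using vb[of a] ab order_trans[OF norm_ge_zero] by auto
    have r1: "(LINT x|?M. norm (q \<epsilon> x - q 0 x)) \<le> K"
    proof -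
      have "(LINT x|?M. norm (q \<epsilon> x - q 0 x)) \<le> (LINT x|?M. norm (q \<epsilon> x) + norm (q 0 x))"
        by (rule integral_mono) (auto intro!: integrable_norm P(3) Bochner_Integration.integrable_add L2_integrable elim(1) q0 norm_triangle_ineq4)
      also have "\<dots> = (LINT x|?M. norm (q \<epsilon> x)) + (LINT x|?M. norm (q 0 x))"
        by (rule Bochner_Integration.integral_add) (intro integrable_norm L2_integrable elim(1) q0)+
      also have "\<dots> \<le> sqrt (b - a) * norm_L2 a b (q \<epsilon>) + sqrt (b - a) * norm_L2 a b (q 0)"
        by (intro add_mono L1_le_L2 ab elim(1) q0)
      also have "\<dots> \<le> K" unfolding K_def using elim(2) ab by (intro add_mono mult_left_mono) auto
      finally show ?thesis .
    qed
    have s1: "(LINT x|?M. norm ((q \<epsilon> x)\<^sup>2 - (q 0 x)\<^sup>2)) \<le> L"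
    proof -
      have i: "integrable ?M (\<lambda>x. (norm (q \<epsilon> x))\<^sup>2)" "integrable ?M (\<lambda>x. (norm (q 0 x))\<^sup>2)"
        using elim(1) q0 by (simp_all add: L2_def)
      have "(LINT x|?M. norm ((q \<epsilon> x)\<^sup>2 - (q 0 x)\<^sup>2)) \<le> (LINT x|?M. (norm (q \<epsilon> x))\<^sup>2 + (norm (q 0 x))\<^sup>2)"
      proof (rule integral_mono)
        show "norm ((q \<epsilon> x)\<^sup>2 - (q 0 x)\<^sup>2) \<le> (norm (q \<epsilon> x))\<^sup>2 + (norm (q 0 x))\<^sup>2" for x
          using norm_triangle_ineq4[of "(q \<epsilon> x)\<^sup>2" "(q 0 x)\<^sup>2"] by (simp add: norm_power)
      qed (intro integrable_norm P(4) Bochner_Integration.integrable_add i)+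
      also have "\<dots> = (norm_L2 a b (q \<epsilon>))\<^sup>2 + (norm_L2 a b (q 0))\<^sup>2"
        unfolding norm_L2_square by (rule Bochner_Integration.integral_add[OF i])
      also have "\<dots> \<le> L" unfolding L_def using elim(2) by (intro add_mono power_mono) (auto simp: norm_L2_nonneg)
      finally show ?thesis .
    qed
    have bound: "(LINT x|?M. norm (g x * c x)) \<le> B * G"
      if g: "integrable ?M g" and c: "continuous_on {a..b} c" and B: "\<And>x. a \<le> x \<Longrightarrow> x \<le> b \<Longrightarrow> norm (c x) \<le> B" "B \<ge> 0"
        and G: "(LINT x|?M. norm (g x)) \<le> G" for g c :: "real \<Rightarrow> complex" and B G :: real
    proof -
      have "(LINT x|?M. norm (g x * c x)) \<le> (LINT x|?M. B * norm (g x))"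
      proof (rule integral_mono)
        show "integrable ?M (\<lambda>x. norm (g x * c x))"
          using integrable_norm[OF integrable_continuous_mult[OF c g]] by (simp add: mult.commute)
        show "integrable ?M (\<lambda>x. B * norm (g x))" using g by simp
        fix x assume "x \<in> space ?M"
        then show "norm (g x * c x) \<le> B * norm (g x)"
          using B(1)[of x] by (simp add: norm_mult mult.commute mult_right_mono)
      qed
      also have "\<dots> = B * (LINT x|?M. norm (g x))" by simp
      also have "\<dots> \<le> B * G" using G B(2) by (rule mult_left_mono)
      finally show ?thesis .
    qed
    have k1: "(LINT x|?M. norm (commutator_entry \<epsilon> x)) \<le> nw \<epsilon> * K + nv \<epsilon> * L"
    proof -
      have i: "integrable ?M (\<lambda>x. (q \<epsilon> x - q 0 x) * vs \<epsilon> x)" "integrable ?M (\<lambda>x. ((q \<epsilon> x)\<^sup>2 - (q 0 x)\<^sup>2) * vr \<epsilon> x)"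
        using integrable_continuous_mult[OF P(2,3)] integrable_continuous_mult[OF P(1,4)] by (simp_all add: mult.commute)
      have "(LINT x|?M. norm (commutator_entry \<epsilon> x)) \<le> (LINT x|?M. norm ((q \<epsilon> x - q 0 x) * vs \<epsilon> x) + norm (((q \<epsilon> x)\<^sup>2 - (q 0 x)\<^sup>2) * vr \<epsilon> x))"
      proof (rule integral_mono)
        show "norm (commutator_entry \<epsilon> x) \<le> norm ((q \<epsilon> x - q 0 x) * vs \<epsilon> x) + norm (((q \<epsilon> x)\<^sup>2 - (q 0 x)\<^sup>2) * vr \<epsilon> x)" for x
          unfolding commutator_entry_def by (rule norm_triangle_ineq4)
      qed (intro integrable_norm P(5) Bochner_Integration.integrable_add i)+
      also have "\<dots> = (LINT x|?M. norm ((q \<epsilon> x - q 0 x) * vs \<epsilon> x)) + (LINT x|?M. norm (((q \<epsilon> x)\<^sup>2 - (q 0 x)\<^sup>2) * vr \<epsilon> x))"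
        by (rule Bochner_Integration.integral_add) (intro integrable_norm i)+
      also have "\<dots> \<le> nw \<epsilon> * K + nv \<epsilon> * L"
        by (intro add_mono bound P vb nn r1 s1)
      finally show ?thesis .
    qed
    show ?case
      using elim(1) k1 bound[OF P(3) P(1) vb(1) nn(1) r1] by simp
  qed
  have lims: "(nv \<longlongrightarrow> 0) (at_right 0)" "(nw \<longlongrightarrow> 0) (at_right 0)"
    using v w by (simp_all add: nv_def[abs_def] nw_def[abs_def])
  have "((\<lambda>\<epsilon>. 2 * (nv \<epsilon> * K + (nw \<epsilon> * K + nv \<epsilon> * L))) \<longlongrightarrow> 2 * (0 * K + (0 * K + 0 * L))) (at_right 0)"
    by (intro tendsto_intros lims)
  then have lim: "((\<lambda>\<epsilon>. 2 * (nv \<epsilon> * K + (nw \<epsilon> * K + nv \<epsilon> * L))) \<longlongrightarrow> 0) (at_right 0)" by simp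
  have le: "norm_L1 a b (\<lambda>x. R_mat q \<epsilon> x ** mat_vee a (R_mat q \<epsilon>) x) \<le> 2 * (nv \<epsilon> * K + (nw \<epsilon> * K + nv \<epsilon> * L))"
    "norm_L1 a b (\<lambda>x. mat_vee a (R_mat q \<epsilon>) x ** R_mat q \<epsilon> x) \<le> 2 * (nv \<epsilon> * K + (nw \<epsilon> * K + nv \<epsilon> * L))"
    "norm_L1 a b (\<lambda>x. R_mat q \<epsilon> x ** mat_vee a (R_mat q \<epsilon>) x - mat_vee a (R_mat q \<epsilon>) x ** R_mat q \<epsilon> x) \<le> 2 * (nv \<epsilon> * K + (nw \<epsilon> * K + nv \<epsilon> * L))"
    if E: "q \<epsilon> \<in> L2 a b \<and>
      (LINT x|?M. norm ((q \<epsilon> x - q 0 x) * vr \<epsilon> x)) \<le> nv \<epsilon> * K \<and>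
      (LINT x|?M. norm (commutator_entry \<epsilon> x)) \<le> nw \<epsilon> * K + nv \<epsilon> * L" for \<epsilon>
  proof -
    have qe: "q \<epsilon> \<in> L2 a b" using E by simp
    have E1: "(LINT x|?M. norm ((q \<epsilon> x - q 0 x) * vr \<epsilon> x)) \<le> nv \<epsilon> * K"
      and E2: "(LINT x|?M. norm (commutator_entry \<epsilon> x)) \<le> nw \<epsilon> * K + nv \<epsilon> * L" using E by blast+
    \<comment> \<open>Twice the sum covers both patterns: two diagonal entries and one commutator
      entry in (I) and (II), a doubled commutator entry alone in (III).\<close>
    have arith1: "n \<le> 2 * (x + y)" if "n \<le> 2 * i + j" "i \<le> x" "j \<le> y" "0 \<le> j" for n x y i j :: real
      using that by simp
    have arith2: "n \<le> 2 * (x + y)" if "n \<le> 2 * j" "i \<le> x" "j \<le> y" "0 \<le> i" for n x y i j :: real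
      using that by simp
    have nn: "0 \<le> (LINT x|?M. norm (g x))" for g :: "real \<Rightarrow> complex" by simp
    have nnr: "0 \<le> (LINT x|?M. norm ((q \<epsilon> x - q 0 x) * vr \<epsilon> x))" and nnk: "0 \<le> (LINT x|?M. norm (commutator_entry \<epsilon> x))"
      by (rule nn)+
    have "norm_L1 a b (\<lambda>x. R_mat q \<epsilon> x ** mat_vee a (R_mat q \<epsilon>) x)
        \<le> 2 * (LINT x|?M. norm ((q \<epsilon> x - q 0 x) * vr \<epsilon> x)) + (LINT x|?M. norm (commutator_entry \<epsilon> x))"
      using norm_L1_le_entries[OF product_integrable(6)[OF qe q0]] unfolding product_entries by simp
    then show "norm_L1 a b (\<lambda>x. R_mat q \<epsilon> x ** mat_vee a (R_mat q \<epsilon>) x) \<le> 2 * (nv \<epsilon> * K + (nw \<epsilon> * K + nv \<epsilon> * L))"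
      by (rule arith1[OF _ E1 E2 nnk])
    have "norm_L1 a b (\<lambda>x. mat_vee a (R_mat q \<epsilon>) x ** R_mat q \<epsilon> x)
        \<le> 2 * (LINT x|?M. norm ((q \<epsilon> x - q 0 x) * vr \<epsilon> x)) + (LINT x|?M. norm (commutator_entry \<epsilon> x))"
      using norm_L1_le_entries[OF product_integrable(7)[OF qe q0]] unfolding product_entries by simp
    then show "norm_L1 a b (\<lambda>x. mat_vee a (R_mat q \<epsilon>) x ** R_mat q \<epsilon> x) \<le> 2 * (nv \<epsilon> * K + (nw \<epsilon> * K + nv \<epsilon> * L))"
      by (rule arith1[OF _ E1 E2 nnk])
    have "norm_L1 a b (\<lambda>x. R_mat q \<epsilon> x ** mat_vee a (R_mat q \<epsilon>) x - mat_vee a (R_mat q \<epsilon>) x ** R_mat q \<epsilon> x)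
        \<le> 2 * (LINT x|?M. norm (commutator_entry \<epsilon> x))"
      using norm_L1_le_entries[OF product_integrable(8)[OF qe q0]] unfolding vector_minus_component product_entries
      by (simp flip: mult_2 add: norm_mult)
    then show "norm_L1 a b (\<lambda>x. R_mat q \<epsilon> x ** mat_vee a (R_mat q \<epsilon>) x - mat_vee a (R_mat q \<epsilon>) x ** R_mat q \<epsilon> x) \<le> 2 * (nv \<epsilon> * K + (nw \<epsilon> * K + nv \<epsilon> * L))"
      by (rule arith2[OF _ E1 E2 nnr])
  qed
  have nonneg: "norm (norm_L1 a b M) = norm_L1 a b M" for M by (simp add: norm_L1_def)
  show ?thesis
    unfolding cond_I_def cond_II_def cond_III_def
    by (intro conjI Lim_null_comparison[OF eventually_mono[OF est] lim]; simp only: nonneg; rule le)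
qed

end

theorem theorem4:
  fixes a b \<epsilon>0 :: real
    and q :: "real \<Rightarrow> real \<Rightarrow> complex"
    and \<alpha> \<beta> :: "real \<Rightarrow> complex^2^2"
  assumes "a < b" and "\<epsilon>0 > 0"
    and "\<And>\<epsilon>. \<epsilon> \<in> {0..\<epsilon>0} \<Longrightarrow> q \<epsilon> \<in> L2 a b"
    and cond_2: "((\<lambda>\<epsilon>. norm_C a b (vee a (\<lambda>x. q \<epsilon> x - q 0 x))) \<longlongrightarrow> 0) (at_right 0)"
    and cond_3: "((\<lambda>\<epsilon>. norm_C a b (vee a (\<lambda>x. (q \<epsilon> x)\<^sup>2 - (q 0 x)\<^sup>2))) \<longlongrightarrow> 0) (at_right 0)"
  shows "(resolvent_set a b (SL_op a b (q 0) (\<alpha> 0) (\<beta> 0)) \<noteq> {} \<and>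
            (\<alpha> \<longlongrightarrow> \<alpha> 0) (at_right 0) \<and> (\<beta> \<longlongrightarrow> \<beta> 0) (at_right 0) \<and>
            (cond_I a b q \<or> cond_II a b q \<or> cond_III a b q)
          \<longrightarrow> norm_resolvent_convergent a b (\<lambda>\<epsilon>. SL_op a b (q \<epsilon>) (\<alpha> \<epsilon>) (\<beta> \<epsilon>)))
       \<and> ((\<lambda>\<epsilon>. norm_L2 a b (q \<epsilon>)) \<in> O[at_right 0](\<lambda>_. 1)
          \<longrightarrow> cond_I a b q \<and> cond_II a b q \<and> cond_III a b q)"
proof (intro conjI[of "_ \<longrightarrow> _"] impI)
  have q0: "q 0 \<in> L2 a b" using assms(2,3) by simp
  have q: "\<forall>\<^sub>F \<epsilon> in at_right 0. q \<epsilon> \<in> L2 a b"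
    using eventually_at_right_less[of "0::real"] order_tendstoD(2)[OF tendsto_ident_at \<open>\<epsilon>0 > 0\<close>]
    by eventually_elim (use assms(3) in simp)
  {
    assume "(\<lambda>\<epsilon>. norm_L2 a b (q \<epsilon>)) \<in> O[at_right 0](\<lambda>_. 1)"
    then show "cond_I a b q \<and> cond_II a b q \<and> cond_III a b q"
      by (rule conditions_of_bounded[OF \<open>a < b\<close> q q0 cond_2 cond_3])
  }
  assume H: "resolvent_set a b (SL_op a b (q 0) (\<alpha> 0) (\<beta> 0)) \<noteq> {} \<and>
            (\<alpha> \<longlongrightarrow> \<alpha> 0) (at_right 0) \<and> (\<beta> \<longlongrightarrow> \<beta> 0) (at_right 0) \<and>
            (cond_I a b q \<or> cond_II a b q \<or> cond_III a b q)"
  \<comment> \<open>This one point serves for all small \<open>\<epsilon>\<close>, and it is fixed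
    first because \<open>gauge_M\<close> depends on it.\<close>
  then obtain \<mu> where mu: "\<mu> \<in> resolvent_set a b (SL_op a b (q 0) (\<alpha> 0) (\<beta> 0))" by blast
  have uM: "uniform_limit {a..b} (\<lambda>\<epsilon>. gauge_M a (q \<epsilon>) \<mu>) (gauge_M a (q 0) \<mu>) (at_right 0)"
    using commutator_entry_tendsto[OF q q0] H
    by (intro gauge_M_limit[OF \<open>a < b\<close> q q0 cond_2 cond_3]) (simp add: commutator_entry_def)
  have uQ: "uniform_limit {a..b} (\<lambda>\<epsilon>. vee a (q \<epsilon>)) (vee a (q 0)) (at_right 0)"
  proof (rule uniform_limitI_bound[OF _ cond_2])
    show "\<forall>\<^sub>F \<epsilon> in at_right 0. \<forall>t\<in>{a..b}. norm (vee a (q \<epsilon>) t - vee a (q 0) t) \<le> norm_C a b (vee a (\<lambda>x. q \<epsilon> x - q 0 x))"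
      using q
    proof eventually_elim
      case (elim \<epsilon>)
      note v = vee_diff_fun[OF L2_integrable[OF elim] L2_integrable[OF q0]]
      show ?case
        using norm_le_norm_C[OF product_integrable(1)[OF elim q0]] by (auto simp: v[symmetric])
    qed
  qed
  obtain \<Psi> \<Psi>0 where F0: "fundamental a b (q 0) \<mu> \<Psi>0" and F: "\<forall>\<^sub>F \<epsilon> in at_right 0. fundamental a b (q \<epsilon>) \<mu> (\<Psi> \<epsilon>)"
    and u: "\<And>k l. uniform_limit {a..b} (\<lambda>\<epsilon> t. \<Psi> \<epsilon> t $ k $ l) (\<lambda>t. \<Psi>0 t $ k $ l) (at_right 0)"
    by (rule fundamental_limit[OF \<open>a < b\<close> q q0 uQ uM]) (rule that)
  show "norm_resolvent_convergent a b (\<lambda>\<epsilon>. SL_op a b (q \<epsilon>) (\<alpha> \<epsilon>) (\<beta> \<epsilon>))"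
    by (rule norm_resolvent_convergentI[where q = q and \<alpha> = \<alpha> and \<beta> = \<beta>, OF \<open>a < b\<close> F0 F u _ _ mu]) (use H in blast)+
qed

end
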